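(* Let $V$ be a finite-dimensional vector space over a field $\Bbbk$. Then the following data are equivalent: (i) cyclic algebra structures $(b,\{T_r\}_{r\ge 1})$ on $V$; (ii) $\mathcal{R}$-algebra structures on $V$, i.e. actions $Z=\{Z_{p,q}:\mathcal{R}(p,q)\to \mathrm{Hom}(V^{\otimes p},V^{\otimes q})\}_{p,q\ge 0}$ on $V$ of the PROP $\mathcal{R}$ of ribbon graphs. Here the equivalence means that associating to an action $Z$ the maps $$b:=Z(\text{coupling graph}),\qquad T_r:=Z(\text{$r$-valent star graph}),\quad r\ge 1,$$ is a bijection from the set of data (ii) to the set of data (i).
   Context: Cyclic algebra structure on $V$: a non-degenerate symmetric bilinear form $b:V\otimes V\to\Bbbk$ together with a sequence $\{T_r\}_{r\ge1}$ of linear maps $T_r:V^{\otimes r}\to\Bbbk$ which are cyclically invariant: $T_r(X_1\otimes\cdots\otimes X_{r-1}\otimes X_r)=T_r(X_r\otimes X_1\otimes\cdots\otimes X_{r-1})$. The tensors $T_r$ for different $r$ satisfy no further compatibility. Ribbon graphs: a ribbon graph of type $(p,q)$ is a finite purely 1-dimensional complex (graph; possibly disconnected or empty, loops and multiple edges allowed, no isolated vertices) with vertices of any valence $\ge 1$ and with $p+q$ additional distinguished free ends called endpoints (not counted as vertices), divided into two totally ordered sets $\mathrm{In}(\Gamma)$ of cardinality $p$ and $\mathrm{Out}(\Gamma)$ of cardinality $q$, together with a cyclic order on the half-edges stemming from each vertex. An edge may join two vertices (possibly equal), a vertex and an endpoint, or two endpoints; components that are circles without vertices are allowed (they arise when composing).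 Graphs are considered up to isomorphism (preserving endpoints with their orders and the cyclic orders at vertices). PROP $\mathcal{R}$: $\mathcal{R}(p,q)$ is the $\Bbbk$-linear span of (isomorphism classes of) ribbon graphs of type $(p,q)$. The composition $\mathcal{R}(q,r)\otimes\mathcal{R}(p,q)\to\mathcal{R}(p,r)$, $(\Gamma,\Phi)\mapsto\Gamma\circ\Phi$, is the bilinear extension of gluing the $i$-th Out endpoint of $\Phi$ to the $i$-th In endpoint of $\Gamma$ for all $i$ (the glued point becoming an interior point of an edge). The tensor product $\mathcal{R}(p,q)\otimes\mathcal{R}(p',q')\to\mathcal{R}(p+p',q+q')$ is the bilinear extension of juxtaposition (disjoint union, with the endpoints of the first graph preceding those of the second). The identity in $\mathcal{R}(p,p)$ is the graph consisting of $p$ edges joining the $i$-th In endpoint to the $i$-th Out endpoint. The crossing in $\mathcal{R}(2,2)$ consists of two edges joining In endpoint 1 to Out endpoint 2 and In endpoint 2 to Out endpoint 1. Action: an action of $\mathcal{R}$ on $V$ is a family of linear maps $Z_{p,q}:\mathcal{R}(p,q)\to\mathrm{Hom}(V^{\otimes p},V^{\otimes q})$ (with $V^{\otimes 0}=\Bbbk$) such that $Z(\Gamma\circ\Phi)=Z(\Gamma)\circ Z(\Phi)$, $Z(\Gamma\otimes\Phi)=Z(\Gamma)\otimes Z(\Phi)$, identities go to identities, and the crossing goes to the flip $x\otimes y\mapsto y\otimes x$. A vector space with such an action is an $\mathcal{R}$-algebra. Coupling graph: the element of $\mathcal{R}(2,0)$ consisting of a single edge whose two ends are the two In endpoints. $r$-valent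 star graph: the element of $\mathcal{R}(r,0)$ with a single vertex of valence $r$, joined by $r$ edges to the $r$ In endpoints, the cyclic order at the vertex being $1,2,\dots,r$. *)

theory Defs
  imports
    Complex_Main
    "HOL-Library.Poly_Mapping"
    "HOL-Library.Function_Algebras"
    "HOL-Library.Nat_Bijection"
    "HOL-Library.Disjoint_Sets"
    "HOL-Combinatorics.Permutations"
begin

section \<open>Tensor powers\<close>

text \<open>
  A vector space is given by a scalar multiplication \<open>scale\<close> on a type \<open>'v\<close>. Its tensor powers
  are realised without quotients: a pure tensor is the evaluation functional on multilinear forms,
  and the \<open>p\<close>-th tensor power is the span of the pure tensors of length \<open>p\<close>. To have all powers
  inside one type, a multilinear form here is a function on lists that is multilinear in the
  entries for every length separately (a linear form on the tensor algebra). The lemmas at the end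
  of this section (multilinearity of pure tensors and the universal property) show that this is
  the usual tensor power.
\<close>

definition multilinear_form ::
  "('k::field \<Rightarrow> 'v::ab_group_add \<Rightarrow> 'v) \<Rightarrow> ('v list \<Rightarrow> 'k) \<Rightarrow> bool" where
  "multilinear_form scale M \<longleftrightarrow>
     (\<forall>xs x y ys. M (xs @ [x + y] @ ys) = M (xs @ [x] @ ys) + M (xs @ [y] @ ys)) \<and>
     (\<forall>xs c x ys. M (xs @ [scale c x] @ ys) = c * M (xs @ [x] @ ys))"

type_synonym ('k, 'v) tensor = "('v list \<Rightarrow> 'k) \<Rightarrow> 'k"

definition pure_tensor ::
  "('k::field \<Rightarrow> 'v::ab_group_add \<Rightarrow> 'v) \<Rightarrow> 'v list \<Rightarrow> ('k, 'v) tensor" where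
  "pure_tensor scale xs = (\<lambda>M. if multilinear_form scale M then M xs else 0)"

definition tensor_scale :: "'k::field \<Rightarrow> ('k, 'v) tensor \<Rightarrow> ('k, 'v) tensor" where
  "tensor_scale c t = (\<lambda>M. c * t M)"

definition tensor_power ::
  "('k::field \<Rightarrow> 'v::ab_group_add \<Rightarrow> 'v) \<Rightarrow> nat \<Rightarrow> ('k, 'v) tensor set" where
  "tensor_power scale p = module.span tensor_scale {pure_tensor scale xs | xs. length xs = p}"

text \<open>
  The product \<open>(t, s) \<mapsto> t \<otimes> s\<close> from the \<open>p\<close>-th and the \<open>q\<close>-th to the \<open>(p + q)\<close>-th tensor power;
  on pure tensors it is concatenation (\<open>tensor_mult_pure\<close>).
\<close>
definition tensor_mult ::
  "('k::field \<Rightarrow> 'v::ab_group_add \<Rightarrow> 'v) \<Rightarrow> ('k, 'v) tensor \<Rightarrow> ('k, 'v) tensor \<Rightarrow> ('k, 'v) tensor"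
  where
  "tensor_mult scale t s =
     (\<lambda>M. if multilinear_form scale M then t (\<lambda>xs. s (\<lambda>ys. M (xs @ ys))) else 0)"

text \<open>
  The identification of the zeroth tensor power with the field: \<open>tensor_scale c (pure_tensor scale [])\<close>
  corresponds to \<open>c\<close>.
\<close>
definition scalar_part :: "('k::field, 'v) tensor \<Rightarrow> 'k" where
  "scalar_part t = t (\<lambda>xs. if xs = [] then 1 else 0)"

text \<open>
  Linear maps between subspaces \<open>A\<close> and \<open>B\<close>, normalised to vanish outside \<open>A\<close>, so that a linear map
  is determined by its values on \<open>A\<close>, and composition, sums and multiples are the pointwise ones.
\<close>
definition linear_maps ::
  "('k \<Rightarrow> 'a \<Rightarrow> 'a) \<Rightarrow> 'a set \<Rightarrow> ('k \<Rightarrow> 'b \<Rightarrow> 'b) \<Rightarrow> 'b set \<Rightarrow> ('a::ab_group_add \<Rightarrow> 'b::ab_group_add) set"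
  where
  "linear_maps scaleA A scaleB B =
     {f. (\<forall>x\<in>A. f x \<in> B) \<and>
         (\<forall>x\<in>A. \<forall>y\<in>A. f (x + y) = f x + f y) \<and>
         (\<forall>c. \<forall>x\<in>A. f (scaleA c x) = scaleB c (f x)) \<and>
         (\<forall>x. x \<notin> A \<longrightarrow> f x = 0)}"

definition tensor_hom ::
  "('k::field \<Rightarrow> 'v::ab_group_add \<Rightarrow> 'v) \<Rightarrow> nat \<Rightarrow> nat \<Rightarrow> (('k, 'v) tensor \<Rightarrow> ('k, 'v) tensor) set" where
  "tensor_hom scale p q =
     linear_maps tensor_scale (tensor_power scale p) tensor_scale (tensor_power scale q)"

definition hom_scale ::
  "'k::field \<Rightarrow> (('k, 'v) tensor \<Rightarrow> ('k, 'v) tensor) \<Rightarrow> ('k, 'v) tensor \<Rightarrow> ('k, 'v) tensor" where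
  "hom_scale c f = (\<lambda>t. tensor_scale c (f t))"

lemma vector_space_tensor_scale: "vector_space (tensor_scale :: 'k::field \<Rightarrow> ('k, 'v) tensor \<Rightarrow> _)"
  by unfold_locales (auto simp: tensor_scale_def fun_eq_iff algebra_simps)

interpretation tensor: vector_space "tensor_scale :: 'k::field \<Rightarrow> ('k, 'v) tensor \<Rightarrow> _"
  by (rule vector_space_tensor_scale)

lemma pure_tensor_add:
  "pure_tensor scale (xs @ [x + y] @ ys) =
     pure_tensor scale (xs @ [x] @ ys) + pure_tensor scale (xs @ [y] @ ys)"
  unfolding pure_tensor_def fun_eq_iff plus_fun_def multilinear_form_def by simp

lemma pure_tensor_scale:
  "pure_tensor scale (xs @ [scale c x] @ ys) = tensor_scale c (pure_tensor scale (xs @ [x] @ ys))"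
  unfolding pure_tensor_def tensor_scale_def fun_eq_iff multilinear_form_def by simp

lemma tensor_mult_pure:
  "tensor_mult scale (pure_tensor scale xs) (pure_tensor scale ys) = pure_tensor scale (xs @ ys)"
proof
  fix M
  have *: "multilinear_form scale (\<lambda>ys. M (us @ ys))" if "multilinear_form scale M" for us
    using that unfolding multilinear_form_def by (metis append.assoc)
  moreover have "multilinear_form scale (\<lambda>us. M (us @ ys))" if "multilinear_form scale M"
    using that unfolding multilinear_form_def by simp
  ultimately show "tensor_mult scale (pure_tensor scale xs) (pure_tensor scale ys) M =
      pure_tensor scale (xs @ ys) M"
    by (simp add: tensor_mult_def pure_tensor_def)
qed

lemma scalar_part_unit: "scalar_part (tensor_scale c (pure_tensor scale [])) = c"
  by (simp add: scalar_part_def tensor_scale_def pure_tensor_def multilinear_form_def)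

theorem tensor_power_universal:
  fixes scale :: "'k::field \<Rightarrow> 'v::ab_group_add \<Rightarrow> 'v"
    and scaleW :: "'k \<Rightarrow> 'w::ab_group_add \<Rightarrow> 'w"
    and F :: "'v list \<Rightarrow> 'w"
  assumes W: "vector_space scaleW"
    and F_add: "\<And>xs x y ys. length xs + 1 + length ys = p \<Longrightarrow>
      F (xs @ [x + y] @ ys) = F (xs @ [x] @ ys) + F (xs @ [y] @ ys)"
    and F_scale: "\<And>xs c x ys. length xs + 1 + length ys = p \<Longrightarrow>
      F (xs @ [scale c x] @ ys) = scaleW c (F (xs @ [x] @ ys))"
  shows "\<exists>!f. f \<in> linear_maps tensor_scale (tensor_power scale p) scaleW UNIV \<and>
              (\<forall>xs. length xs = p \<longrightarrow> f (pure_tensor scale xs) = F xs)"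
proof -
  interpret W: vector_space scaleW by (rule W)
  interpret WK: vector_space_pair scaleW "(*) :: 'k \<Rightarrow> 'k \<Rightarrow> 'k"
    by unfold_locales (auto simp: algebra_simps)
  let ?S = "{pure_tensor scale xs | xs. length xs = p}"
  let ?lin = "\<lambda>\<phi>. Vector_Spaces.linear scaleW (*) \<phi>"
  define M where "M = (\<lambda>(\<phi> :: 'w \<Rightarrow> 'k) xs. if length xs = p then \<phi> (F xs) else 0)"
  define P where "P = (\<lambda>t w. \<forall>\<phi>. ?lin \<phi> \<longrightarrow> \<phi> w = t (M \<phi>))"
  have M: "multilinear_form scale (M \<phi>)" if "?lin \<phi>" for \<phi>
  proof -
    interpret \<phi>: Vector_Spaces.linear scaleW "(*)" \<phi> by (rule that)
    show ?thesis
      unfolding multilinear_form_def M_def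
      using F_add F_scale by (auto simp: \<phi>.add \<phi>.scale)
  qed
  have sep: "w = w'" if "\<And>\<phi>. ?lin \<phi> \<Longrightarrow> \<phi> w = \<phi> w'" for w w'
  proof (rule ccontr)
    assume "w \<noteq> w'"
    then have "W.independent {w - w'}" by simp
    from WK.linear_independent_extend[OF this, of "\<lambda>_. 1"]
    obtain \<phi> where \<phi>: "?lin \<phi>" "\<phi> (w - w') = 1" by auto
    interpret \<phi>: Vector_Spaces.linear scaleW "(*)" \<phi> by (rule \<phi>)
    show False using that[OF \<phi>(1)] \<phi>(2) by (simp add: \<phi>.diff)
  qed
  have lin_add: "\<phi> (w + u) = \<phi> w + \<phi> u"
    and lin_scale: "\<phi> (scaleW c w) = c * \<phi> w" if "?lin \<phi>" for \<phi> w u c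
    using WK.linear_add[OF that] WK.linear_scale[OF that] by auto
  have P_0: "P 0 0"
    unfolding P_def by (simp add: WK.linear_0)
  have P_pure: "P (pure_tensor scale xs) (F xs)" if "length xs = p" for xs
    using that M by (auto simp: P_def pure_tensor_def M_def)
  have P_add: "P (t + s) (w + u)" if "P t w" "P s u" for t s w u
    using that by (simp add: P_def lin_add)
  have P_scale: "P (tensor_scale c t) (scaleW c w)" if "P t w" for c t w
    using that by (simp add: P_def lin_scale tensor_scale_def)
  have P_unique: "w = w'" if "P t w" "P t w'" for t w w'
    using that sep unfolding P_def by metis
  have P_ex: "\<exists>w. P t w" if "t \<in> tensor_power scale p" for t
    using that unfolding tensor_power_def
  proof (induction rule: tensor.span_induct_alt)
    case base
    show ?case using P_0 by blast
  next
    case (step c x y)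
    then show ?case using P_pure P_add P_scale by blast
  qed
  define f where "f = (\<lambda>t. if t \<in> tensor_power scale p then THE w. P t w else 0)"
  have f_eq: "f t = w" if "t \<in> tensor_power scale p" "P t w" for t w
    using that P_unique unfolding f_def by auto
  have f_P: "P t (f t)" if "t \<in> tensor_power scale p" for t
    using P_ex[OF that] f_eq[OF that] by auto
  have pure_in: "pure_tensor scale xs \<in> tensor_power scale p" if "length xs = p" for xs
    unfolding tensor_power_def using that by (auto intro: tensor.span_base)
  have add_in: "t + s \<in> tensor_power scale p"
    if "t \<in> tensor_power scale p" "s \<in> tensor_power scale p" for t s
    using that unfolding tensor_power_def by (rule tensor.span_add)
  have scale_in: "tensor_scale c t \<in> tensor_power scale p"
    if "t \<in> tensor_power scale p" for c t
    using that unfolding tensor_power_def by (rule tensor.span_scale)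
  show ?thesis
  proof (rule ex1I[of _ f], intro conjI allI impI)
    have "f (t + s) = f t + f s" if "t \<in> tensor_power scale p" "s \<in> tensor_power scale p" for t s
      using f_eq[OF add_in[OF that] P_add[OF f_P f_P]] that by blast
    moreover have "f (tensor_scale c t) = scaleW c (f t)" if "t \<in> tensor_power scale p" for c t
      using f_eq[OF scale_in[OF that] P_scale[OF f_P]] that by blast
    moreover have "f t = 0" if "t \<notin> tensor_power scale p" for t
      using that by (simp add: f_def)
    ultimately show "f \<in> linear_maps tensor_scale (tensor_power scale p) scaleW UNIV"
      unfolding linear_maps_def by blast
    show "f (pure_tensor scale xs) = F xs" if "length xs = p" for xs
      using f_eq[OF pure_in P_pure] that by blast
  next
    fix g
    assume g: "g \<in> linear_maps tensor_scale (tensor_power scale p) scaleW UNIV \<and>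
      (\<forall>xs. length xs = p \<longrightarrow> g (pure_tensor scale xs) = F xs)"
    have "t \<in> tensor_power scale p \<and> P t (g t)" if "t \<in> tensor.span ?S" for t
      using that
    proof (induction rule: tensor.span_induct_alt)
      case base
      have z: "0 \<in> tensor_power scale p" unfolding tensor_power_def by (rule tensor.span_zero)
      have "g (0 + 0) = g 0 + g 0"
        using g z unfolding linear_maps_def by blast
      then have "g 0 = 0" by simp
      then show ?case using z P_0 by (simp only: simp_thms)
    next
      case (step c x y)
      obtain xs where xs: "x = pure_tensor scale xs" "length xs = p" using step(1) by blast
      let ?cx = "tensor_scale c x"
      have x: "x \<in> tensor_power scale p" using pure_in xs by simp
      have y: "y \<in> tensor_power scale p" "P y (g y)" using step(2) by blast+
      have "g (?cx + y) = g ?cx + g y"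
        using g y(1) scale_in[OF x] unfolding linear_maps_def by blast
      moreover have "g ?cx = scaleW c (g x)"
        using g x unfolding linear_maps_def by blast
      moreover have "g x = F xs" using g xs by blast
      moreover have "P (?cx + y) (scaleW c (F xs) + g y)"
        using P_add[OF P_scale[OF P_pure]] xs y(2) by blast
      ultimately have "P (?cx + y) (g (?cx + y))" by (simp only:)
      then show ?case using add_in[OF scale_in[OF x] y(1)] by blast
    qed
    then have g_P: "P t (g t)" if "t \<in> tensor_power scale p" for t
      using that unfolding tensor_power_def by blast
    show "g = f"
    proof
      fix t
      show "g t = f t"
      proof (cases "t \<in> tensor_power scale p")
        case True
        then show ?thesis using f_eq[OF True g_P] by simp
      next
        case False
        then have "g t = 0" using g unfolding linear_maps_def by blast
        then show ?thesis using False by (simp add: f_def)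
      qed
    qed
  qed
qed


section \<open>Cyclic algebra structures\<close>

text \<open>\<open>T 0\<close> is not part of the data and normalised to \<open>0\<close>.\<close>

definition cyclic_algebra ::
  "('k::field \<Rightarrow> 'v::ab_group_add \<Rightarrow> 'v) \<Rightarrow>
   (('k, 'v) tensor \<Rightarrow> 'k) \<Rightarrow> (nat \<Rightarrow> ('k, 'v) tensor \<Rightarrow> 'k) \<Rightarrow> bool" where
  "cyclic_algebra scale b T \<longleftrightarrow>
     b \<in> linear_maps tensor_scale (tensor_power scale 2) (*) UNIV \<and>
     (\<forall>x y. b (pure_tensor scale [x, y]) = b (pure_tensor scale [y, x])) \<and>
     (\<forall>x. (\<forall>y. b (pure_tensor scale [x, y]) = 0) \<longrightarrow> x = 0) \<and>
     (\<forall>r\<ge>1. T r \<in> linear_maps tensor_scale (tensor_power scale r) (*) UNIV) \<and>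
     (\<forall>r\<ge>1. \<forall>xs x. length xs = r - 1 \<longrightarrow>
        T r (pure_tensor scale (xs @ [x])) = T r (pure_tensor scale (x # xs))) \<and>
     T 0 = 0"


section \<open>Ribbon graphs\<close>

text \<open>
  The flags of a graph are the half-edges at its vertices and its endpoints. An edge is the
  two-element set of flags at its ends; circles without vertices carry no flags and are only
  counted. The cyclic orders are given by the permutation \<open>nxt\<close> sending a half-edge to its
  successor at the same vertex, so the vertices are exactly the orbits of \<open>nxt\<close> on the half-edges
  (and have valence at least 1). The \<open>i\<close>-th endpoint (counting from 0) in the total order of the
  incoming resp. outgoing ones is \<open>InEnd i\<close> resp. \<open>OutEnd i\<close>.
\<close>

datatype 'h flag = HalfEdge 'h | InEnd nat | OutEnd nat

record 'h rgraph =
  ins :: nat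
  outs :: nat
  halfs :: "'h set"
  nxt :: "'h \<Rightarrow> 'h"
  edges :: "'h flag set set"
  circles :: nat

definition flags :: "'h rgraph \<Rightarrow> 'h flag set" where
  "flags G = HalfEdge ` halfs G \<union> InEnd ` {..<ins G} \<union> OutEnd ` {..<outs G}"

definition ribbon_graph :: "'h rgraph \<Rightarrow> bool" where
  "ribbon_graph G \<longleftrightarrow>
     finite (halfs G) \<and> nxt G permutes halfs G \<and>
     partition_on (flags G) (edges G) \<and> (\<forall>e\<in>edges G. card e = 2)"

definition rgraph_iso :: "'h rgraph \<Rightarrow> 'g rgraph \<Rightarrow> bool" where
  "rgraph_iso G H \<longleftrightarrow>
     ins G = ins H \<and> outs G = outs H \<and> circles G = circles H \<and>
     (\<exists>\<phi>. bij_betw \<phi> (halfs G) (halfs H) \<and>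
          (\<forall>h\<in>halfs G. \<phi> (nxt G h) = nxt H (\<phi> h)) \<and>
          edges H = (\<lambda>e. map_flag \<phi> ` e) ` edges G)"

definition id_graph :: "nat \<Rightarrow> nat rgraph" where
  "id_graph p = \<lparr>ins = p, outs = p, halfs = {}, nxt = id,
     edges = {{InEnd i, OutEnd i} | i. i < p}, circles = 0\<rparr>"

definition crossing_graph :: "nat rgraph" where
  "crossing_graph = \<lparr>ins = 2, outs = 2, halfs = {}, nxt = id,
     edges = {{InEnd 0, OutEnd 1}, {InEnd 1, OutEnd 0}}, circles = 0\<rparr>"

definition coupling_graph :: "nat rgraph" where
  "coupling_graph = \<lparr>ins = 2, outs = 0, halfs = {}, nxt = id,
     edges = {{InEnd 0, InEnd 1}}, circles = 0\<rparr>"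

definition star_graph :: "nat \<Rightarrow> nat rgraph" where
  "star_graph r = \<lparr>ins = r, outs = 0, halfs = {..<r},
     nxt = (\<lambda>i. if i < r then Suc i mod r else i),
     edges = {{HalfEdge i, InEnd i} | i. i < r}, circles = 0\<rparr>"

fun shift_flag :: "nat \<Rightarrow> nat \<Rightarrow> 'h flag \<Rightarrow> 'h flag" where
  "shift_flag m n (HalfEdge h) = HalfEdge h"
| "shift_flag m n (InEnd i) = InEnd (m + i)"
| "shift_flag m n (OutEnd j) = OutEnd (n + j)"

definition juxtapose :: "'h rgraph \<Rightarrow> 'g rgraph \<Rightarrow> ('h + 'g) rgraph" where
  "juxtapose G F = \<lparr>ins = ins G + ins F, outs = outs G + outs F,
     halfs = halfs G <+> halfs F, nxt = map_sum (nxt G) (nxt F),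
     edges = (\<lambda>e. map_flag Inl ` e) ` edges G \<union>
             (\<lambda>e. shift_flag (ins G) (outs G) ` map_flag Inr ` e) ` edges F,
     circles = circles G + circles F\<rparr>"

text \<open>
  Gluing the outgoing endpoints of \<open>F\<close> to the incoming endpoints of \<open>G\<close>. Inside the disjoint union
  of the two graphs, \<open>glue_rel\<close> relates flags lying on the same edge and flags glued to each other.
  A connected component of this relation is a chain of edges which contains either two flags that
  are not glued (\<open>outer_flag\<close>), and is then an edge of the result, or none, and is then a new
  circle.
\<close>

definition glue_rel :: "'h rgraph \<Rightarrow> 'g rgraph \<Rightarrow> ('h flag + 'g flag) rel" where
  "glue_rel G F =
     {(Inl x, Inl y) | x y. \<exists>e\<in>edges G. x \<in> e \<and> y \<in> e} \<union>
     {(Inr x, Inr y) | x y. \<exists>e\<in>edges F. x \<in> e \<and> y \<in> e} \<union>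
     {(Inr (OutEnd i), Inl (InEnd i)) | i. i < outs F} \<union>
     {(Inl (InEnd i), Inr (OutEnd i)) | i. i < outs F}"

definition chains :: "'h rgraph \<Rightarrow> 'g rgraph \<Rightarrow> ('h flag + 'g flag) set set" where
  "chains G F = (flags G <+> flags F) // (glue_rel G F)\<^sup>*"

fun outer_flag :: "'h flag + 'g flag \<Rightarrow> ('h + 'g) flag option" where
  "outer_flag (Inl (HalfEdge h)) = Some (HalfEdge (Inl h))"
| "outer_flag (Inl (InEnd i)) = None"
| "outer_flag (Inl (OutEnd j)) = Some (OutEnd j)"
| "outer_flag (Inr (HalfEdge h)) = Some (HalfEdge (Inr h))"
| "outer_flag (Inr (InEnd i)) = Some (InEnd i)"
| "outer_flag (Inr (OutEnd j)) = None"

definition chain_ends :: "('h flag + 'g flag) set \<Rightarrow> ('h + 'g) flag set" where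
  "chain_ends c = Option.these (outer_flag ` c)"

definition glue :: "'h rgraph \<Rightarrow> 'g rgraph \<Rightarrow> ('h + 'g) rgraph" where
  "glue G F = \<lparr>ins = ins F, outs = outs G,
     halfs = halfs G <+> halfs F, nxt = map_sum (nxt G) (nxt F),
     edges = chain_ends ` chains G F - {{}},
     circles = circles G + circles F + card {c \<in> chains G F. chain_ends c = {}}\<rparr>"

definition relabel :: "('h \<Rightarrow> 'g) \<Rightarrow> 'h rgraph \<Rightarrow> 'g rgraph" where
  "relabel \<phi> G = \<lparr>ins = ins G, outs = outs G, halfs = \<phi> ` halfs G,
     nxt = \<phi> \<circ> nxt G \<circ> inv \<phi>, edges = (\<lambda>e. map_flag \<phi> ` e) ` edges G,
     circles = circles G\<rparr>"


subsection \<open>Isomorphism classes\<close>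

lemma rgraph_iso_refl: "rgraph_iso G G"
  unfolding rgraph_iso_def by (auto intro!: exI[of _ id] simp: flag.map_id0)

lemma rgraph_iso_trans:
  assumes "rgraph_iso G H" "rgraph_iso H K"
  shows "rgraph_iso G K"
proof -
  obtain \<phi> where \<phi>: "bij_betw \<phi> (halfs G) (halfs H)"
      "\<forall>h\<in>halfs G. \<phi> (nxt G h) = nxt H (\<phi> h)" "edges H = (\<lambda>e. map_flag \<phi> ` e) ` edges G"
    using assms(1) unfolding rgraph_iso_def by blast
  obtain \<psi> where \<psi>: "bij_betw \<psi> (halfs H) (halfs K)"
      "\<forall>h\<in>halfs H. \<psi> (nxt H h) = nxt K (\<psi> h)" "edges K = (\<lambda>e. map_flag \<psi> ` e) ` edges H"
    using assms(2) unfolding rgraph_iso_def by blast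
  have "\<forall>h\<in>halfs G. (\<psi> \<circ> \<phi>) (nxt G h) = nxt K ((\<psi> \<circ> \<phi>) h)"
    using \<phi>(1,2) \<psi>(2) by (auto simp: bij_betw_def)
  moreover have "edges K = (\<lambda>e. map_flag (\<psi> \<circ> \<phi>) ` e) ` edges G"
    unfolding \<psi>(3) \<phi>(3) image_image flag.map_comp by simp
  moreover have "ins G = ins K" "outs G = outs K" "circles G = circles K"
    using assms by (simp_all add: rgraph_iso_def)
  ultimately show ?thesis
    using bij_betw_trans[OF \<phi>(1) \<psi>(1)] unfolding rgraph_iso_def by blast
qed

lemma rgraph_iso_sym:
  assumes "rgraph_iso G H" "ribbon_graph G"
  shows "rgraph_iso H G"
proof -
  obtain \<phi> where \<phi>: "bij_betw \<phi> (halfs G) (halfs H)"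
      "\<forall>h\<in>halfs G. \<phi> (nxt G h) = nxt H (\<phi> h)" "edges H = (\<lambda>e. map_flag \<phi> ` e) ` edges G"
    using assms(1) unfolding rgraph_iso_def by blast
  define \<psi> where "\<psi> = inv_into (halfs G) \<phi>"
  have inv: "\<psi> (\<phi> h) = h" if "h \<in> halfs G" for h
    unfolding \<psi>_def using that \<phi>(1) by (rule bij_betw_inv_into_left[rotated])
  have nxt_in: "nxt G h \<in> halfs G" if "h \<in> halfs G" for h
    using that assms(2) permutes_in_image unfolding ribbon_graph_def by metis
  have "\<psi> (nxt H k) = nxt G (\<psi> k)" if "k \<in> halfs H" for k
  proof -
    have "k \<in> \<phi> ` halfs G"
      using that unfolding bij_betw_imp_surj_on[OF \<phi>(1)] .
    then obtain h where h: "h \<in> halfs G" "k = \<phi> h" by (elim imageE)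
    have "nxt H k = \<phi> (nxt G h)" using \<phi>(2) h by simp
    then have "\<psi> (nxt H k) = nxt G h" using inv[OF nxt_in[OF h(1)]] by (simp only:)
    then show ?thesis using inv[OF h(1)] h(2) by (simp only:)
  qed
  moreover have "edges G = (\<lambda>e. map_flag \<psi> ` e) ` edges H"
  proof -
    have inv_flag: "map_flag \<psi> (map_flag \<phi> x) = x" if "x \<in> flags G" for x
      using that inv by (cases x) (auto simp: flags_def)
    have "map_flag \<psi> ` map_flag \<phi> ` e = e" if "e \<in> edges G" for e
    proof -
      have "e \<subseteq> flags G"
        using that assms(2) unfolding ribbon_graph_def partition_on_def by blast
      then have "(\<lambda>x. map_flag \<psi> (map_flag \<phi> x)) ` e = (\<lambda>x. x) ` e"
        using inv_flag by (intro image_cong) blast+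
      then show ?thesis by (simp only: image_image image_ident)
    qed
    then have "(\<lambda>e. map_flag \<psi> ` map_flag \<phi> ` e) ` edges G = (\<lambda>e. e) ` edges G"
      by (intro image_cong) blast+
    then show ?thesis unfolding \<phi>(3) by (simp only: image_image image_ident)
  qed
  moreover have "bij_betw \<psi> (halfs H) (halfs G)"
    unfolding \<psi>_def by (rule bij_betw_inv_into[OF \<phi>(1)])
  moreover have "ins H = ins G" "outs H = outs G" "circles H = circles G"
    using assms(1) unfolding rgraph_iso_def by metis+
  ultimately show ?thesis
    unfolding rgraph_iso_def by blast
qed

lemma ribbon_graph_id: "ribbon_graph (id_graph p)"
  by (auto simp: ribbon_graph_def id_graph_def flags_def partition_on_def disjoint_def permutes_id)

lemma ribbon_graph_crossing: "ribbon_graph crossing_graph"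
  by (auto simp: ribbon_graph_def crossing_graph_def flags_def partition_on_def disjoint_def
      permutes_id less_2_cases_iff)

lemma ribbon_graph_coupling: "ribbon_graph coupling_graph"
  by (auto simp: ribbon_graph_def coupling_graph_def flags_def partition_on_def disjoint_def
      permutes_id less_2_cases_iff)

lemma ribbon_graph_star: "ribbon_graph (star_graph r)"
proof -
  let ?f = "\<lambda>i. if i < r then Suc i mod r else i"
  have inj: "inj_on ?f {..<r}"
    by (rule inj_onI) (auto simp: mod_Suc split: if_splits)
  have "?f ` {..<r} \<subseteq> {..<r}"
    by auto
  then have "?f ` {..<r} = {..<r}"
    using inj by (rule endo_inj_surj[OF finite_lessThan])
  then have "?f permutes {..<r}"
    using inj by (intro bij_imp_permutes) (simp_all only: bij_betw_def, simp)
  then show ?thesis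
    by (auto simp: ribbon_graph_def star_graph_def flags_def partition_on_def disjoint_def)
qed

quotient_type ribbon = "nat rgraph" / partial:
  "\<lambda>G H. ribbon_graph G \<and> ribbon_graph H \<and> rgraph_iso G H"
proof (rule part_equivpI)
  show "\<exists>G :: nat rgraph. ribbon_graph G \<and> ribbon_graph G \<and> rgraph_iso G G"
    using ribbon_graph_id rgraph_iso_refl by blast
  show "symp (\<lambda>(G :: nat rgraph) H. ribbon_graph G \<and> ribbon_graph H \<and> rgraph_iso G H)"
    using rgraph_iso_sym by (blast intro: sympI)
  show "transp (\<lambda>(G :: nat rgraph) H. ribbon_graph G \<and> ribbon_graph H \<and> rgraph_iso G H)"
    using rgraph_iso_trans by (blast intro: transpI)
qed

text \<open>
  Here \<open>rep_ribbon\<close> picks a representative of an isomorphism class, and \<open>sum_encode\<close> only turns the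
  half-edges of a disjoint union back into natural numbers.
\<close>

definition ribbon_ins :: "ribbon \<Rightarrow> nat" where
  "ribbon_ins A = ins (rep_ribbon A)"

definition ribbon_outs :: "ribbon \<Rightarrow> nat" where
  "ribbon_outs A = outs (rep_ribbon A)"

definition ribbon_comp :: "ribbon \<Rightarrow> ribbon \<Rightarrow> ribbon" where
  "ribbon_comp A B = abs_ribbon (relabel sum_encode (glue (rep_ribbon A) (rep_ribbon B)))"

definition ribbon_tensor :: "ribbon \<Rightarrow> ribbon \<Rightarrow> ribbon" where
  "ribbon_tensor A B = abs_ribbon (relabel sum_encode (juxtapose (rep_ribbon A) (rep_ribbon B)))"


section \<open>The PROP of ribbon graphs and its actions\<close>

definition prop_R :: "nat \<Rightarrow> nat \<Rightarrow> (ribbon \<Rightarrow>\<^sub>0 'k::field) set" where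
  "prop_R p q = {f. \<forall>A\<in>Poly_Mapping.keys f. ribbon_ins A = p \<and> ribbon_outs A = q}"

definition prop_scale :: "'k::field \<Rightarrow> (ribbon \<Rightarrow>\<^sub>0 'k) \<Rightarrow> (ribbon \<Rightarrow>\<^sub>0 'k)" where
  "prop_scale c f = Poly_Mapping.map ((*) c) f"

definition basis_elt :: "nat rgraph \<Rightarrow> (ribbon \<Rightarrow>\<^sub>0 'k::field)" where
  "basis_elt G = Poly_Mapping.single (abs_ribbon G) 1"

definition bilinear_ext ::
  "(ribbon \<Rightarrow> ribbon \<Rightarrow> ribbon) \<Rightarrow> (ribbon \<Rightarrow>\<^sub>0 'k::field) \<Rightarrow> (ribbon \<Rightarrow>\<^sub>0 'k) \<Rightarrow> (ribbon \<Rightarrow>\<^sub>0 'k)" where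
  "bilinear_ext m f g = (\<Sum>A\<in>Poly_Mapping.keys f. \<Sum>B\<in>Poly_Mapping.keys g.
     Poly_Mapping.single (m A B) (Poly_Mapping.lookup f A * Poly_Mapping.lookup g B))"

abbreviation prop_comp :: "(ribbon \<Rightarrow>\<^sub>0 'k::field) \<Rightarrow> (ribbon \<Rightarrow>\<^sub>0 'k) \<Rightarrow> (ribbon \<Rightarrow>\<^sub>0 'k)" where
  "prop_comp \<equiv> bilinear_ext ribbon_comp"

abbreviation prop_tensor :: "(ribbon \<Rightarrow>\<^sub>0 'k::field) \<Rightarrow> (ribbon \<Rightarrow>\<^sub>0 'k) \<Rightarrow> (ribbon \<Rightarrow>\<^sub>0 'k)" where
  "prop_tensor \<equiv> bilinear_ext ribbon_tensor"

text \<open>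
  Since \<open>Z\<close> takes values in \<open>tensor_hom\<close>, the second clause is composition of linear maps on the
  tensor powers, and the third clause is the definition of the tensor product of linear maps, which
  is determined by its values on the products \<open>t \<otimes> s\<close>.
\<close>
definition R_action ::
  "('k::field \<Rightarrow> 'v::ab_group_add \<Rightarrow> 'v) \<Rightarrow>
   (nat \<Rightarrow> nat \<Rightarrow> (ribbon \<Rightarrow>\<^sub>0 'k) \<Rightarrow> ('k, 'v) tensor \<Rightarrow> ('k, 'v) tensor) \<Rightarrow> bool" where
  "R_action scale Z \<longleftrightarrow>
     (\<forall>p q. Z p q \<in> linear_maps prop_scale (prop_R p q) hom_scale (tensor_hom scale p q)) \<and>
     (\<forall>p q r. \<forall>g\<in>prop_R q r. \<forall>f\<in>prop_R p q. Z p r (prop_comp g f) = Z q r g \<circ> Z p q f) \<and>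
     (\<forall>p q p' q'. \<forall>g\<in>prop_R p q. \<forall>f\<in>prop_R p' q'.
        \<forall>t\<in>tensor_power scale p. \<forall>s\<in>tensor_power scale p'.
          Z (p + p') (q + q') (prop_tensor g f) (tensor_mult scale t s) =
          tensor_mult scale (Z p q g t) (Z p' q' f s)) \<and>
     (\<forall>p. \<forall>t\<in>tensor_power scale p. Z p p (basis_elt (id_graph p)) t = t) \<and>
     (\<forall>x y. Z 2 2 (basis_elt crossing_graph) (pure_tensor scale [x, y]) = pure_tensor scale [y, x])"

definition induced_form ::
  "(nat \<Rightarrow> nat \<Rightarrow> (ribbon \<Rightarrow>\<^sub>0 'k::field) \<Rightarrow> ('k, 'v) tensor \<Rightarrow> ('k, 'v) tensor) \<Rightarrow>
   ('k, 'v) tensor \<Rightarrow> 'k" where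
  "induced_form Z = scalar_part \<circ> Z 2 0 (basis_elt coupling_graph)"

definition induced_cyclic ::
  "(nat \<Rightarrow> nat \<Rightarrow> (ribbon \<Rightarrow>\<^sub>0 'k::field) \<Rightarrow> ('k, 'v) tensor \<Rightarrow> ('k, 'v) tensor) \<Rightarrow>
   nat \<Rightarrow> ('k, 'v) tensor \<Rightarrow> 'k" where
  "induced_cyclic Z r = (if r \<ge> 1 then scalar_part \<circ> Z r 0 (basis_elt (star_graph r)) else 0)"

end

theory Submission
  imports Defs "HOL-Combinatorics.Cycles"
begin

text \<open>
  From a cyclic algebra to an action. Choose a basis of \<open>V\<close> and its dual basis with respect to \<open>b\<close>.
  The map assigned to a ribbon graph is a state sum: colour the half-edges by basis vectors, let every
  vertex contribute the tensor \<open>T\<^sub>r\<close> of the colours around it (well defined by cyclic invariance),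
  every edge the form \<open>b\<close> of the labels at its two ends, where a half-edge is labelled by the dual of
  its colour and an incoming endpoint by the input vector, every circle the dimension of \<open>V\<close>, and sum
  over all colourings. Summing over dual bases satisfies \<open>\<Sum>\<^sub>w b(x, w\<^sup>*) b(w, y) = b(x, y)\<close> and
  \<open>\<Sum>\<^sub>w b(w\<^sup>*, w) = dim V\<close>, so the contraction at a glued pair of endpoints either fuses two edges or
  closes an edge to a circle, which is exactly what gluing does. Induction over the glued pairs
  (\<open>chain_state_sum\<close>) therefore yields compatibility with composition (\<open>amplitude_glue\<close>); the other
  axioms are direct (\<open>R_action_state_sum\<close>), and on the coupling and the stars the state sum returns
  \<open>b\<close> and \<open>T\<^sub>r\<close> (\<open>cyclic_algebra_imp_action\<close>).

  From an action to a cyclic algebra. Symmetry of \<open>b\<close> holds because the coupling absorbs the crossing,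
  cyclic invariance of \<open>T\<^sub>r\<close> because rotating the legs of a star gives an isomorphic graph. Let \<open>\<kappa>\<close> be
  the value of the copairing, the edge with two outgoing ends. Straightening an S-shaped edge gives the
  snake identity \<open>(b(x, -) \<otimes> id) \<kappa> = x\<close>, so \<open>b\<close> is non-degenerate (\<open>cyclic_algebra_induced\<close>).

  Injectivity. Every ribbon graph is built from identities, crossings, couplings, copairings and stars
  (\<open>all_good\<close>): incoming endpoints are bent to the outgoing side, vertices are split off as
  stars, circles are couplings of copairings, and the remaining matchings of outgoing endpoints are
  permuted copairings. Only two explicit gluings are needed for this, one that substitutes flags for
  outgoing endpoints (\<open>glue_leg\<close>) and one that joins two outgoing endpoints (\<open>glue_coupling\<close>). The snake
  identity determines \<open>\<kappa>\<close> from \<open>b\<close> (\<open>copairing_unique\<close>), so two actions with the same \<open>b\<close> and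
  \<open>T\<^sub>r\<close> agree on all generators, hence everywhere (\<open>action_unique\<close>).
\<close>

section \<open>Chains of edges\<close>

lemma edge_eqI:
  assumes "partition_on X E" "e \<in> E" "f \<in> E" "x \<in> e" "x \<in> f"
  shows "e = f"
  using assms unfolding partition_on_def disjoint_def by blast

lemma partition_quotient_rtrancl:
  assumes "sym R" "R \<subseteq> X \<times> X"
  shows "partition_on X (X // R\<^sup>*)"
proof -
  have 1: "R\<^sup>* `` {x} \<subseteq> X" if "x \<in> X" for x
  proof
    fix y assume "y \<in> R\<^sup>* `` {x}"
    then have "(x, y) \<in> R\<^sup>*" by simp
    then show "y \<in> X" using that by induction (use assms(2) in auto)
  qed
  have 2: "R\<^sup>* `` {x} = R\<^sup>* `` {y}" if "z \<in> R\<^sup>* `` {x}" "z \<in> R\<^sup>* `` {y}" for x y z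
  proof -
    have s: "sym (R\<^sup>*)" using assms(1) by (rule sym_rtrancl)
    have "(x, y) \<in> R\<^sup>*" "(y, x) \<in> R\<^sup>*"
      using that s by (auto simp: sym_def intro: rtrancl_trans)
    then show ?thesis by (auto intro: rtrancl_trans)
  qed
  show ?thesis
  proof (rule partition_onI)
    show "\<Union>(X // R\<^sup>*) = X"
      using 1 unfolding quotient_def by (intro equalityI subsetI) auto
    show "{} \<notin> X // R\<^sup>*"
      unfolding quotient_def by auto
    fix p q assume "p \<in> X // R\<^sup>*" "q \<in> X // R\<^sup>*" "p \<noteq> q"
    then obtain x y where "p = R\<^sup>* `` {x}" "q = R\<^sup>* `` {y}" unfolding quotient_def by auto
    then show "disjnt p q" using 2 \<open>p \<noteq> q\<close> unfolding disjnt_def by blast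
  qed
qed

text \<open>
  Components of a relation are found by guessing: a partition is the right one as soon as its blocks
  are closed under the relation and connected. All chains below are computed through this criterion.
\<close>
lemma quotient_rtrancl_eqI:
  assumes C: "partition_on X C"
    and closed: "\<And>c x y. c \<in> C \<Longrightarrow> x \<in> c \<Longrightarrow> (x, y) \<in> R \<Longrightarrow> y \<in> c"
    and conn: "\<And>c. c \<in> C \<Longrightarrow> \<exists>r. \<forall>y\<in>c. (r, y) \<in> R\<^sup>*"
    and "sym R"
  shows "X // R\<^sup>* = C"
proof -
  have eq: "R\<^sup>* `` {x} = c" if c: "c \<in> C" "x \<in> c" for x c
  proof
    show "R\<^sup>* `` {x} \<subseteq> c"
    proof
      fix y assume "y \<in> R\<^sup>* `` {x}"
      then have "(x, y) \<in> R\<^sup>*" by simp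
      then show "y \<in> c" by induction (use that closed in blast)+
    qed
    obtain r where r: "\<forall>y\<in>c. (r, y) \<in> R\<^sup>*" using conn[OF c(1)] by blast
    then have "(x, r) \<in> R\<^sup>*" using c sym_rtrancl[OF \<open>sym R\<close>] by (auto simp: sym_def)
    then show "c \<subseteq> R\<^sup>* `` {x}" using r by (auto intro: rtrancl_trans)
  qed
  have "\<exists>c\<in>C. x \<in> c" if "x \<in> X" for x using C that unfolding partition_on_def by blast
  moreover have "\<exists>x\<in>X. x \<in> c" if "c \<in> C" for c
    using C that unfolding partition_on_def by (metis Union_iff ex_in_conv)
  ultimately show ?thesis
    using eq unfolding quotient_def by fastforce
qed

text \<open>
  The relation \<open>glue_rel\<close> in the abstract: flags related by an edge from \<open>E\<close> or by one of the gluings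
  \<open>s k\<close> to \<open>t k\<close>. The gluings are indexed by an arbitrary finite set so that they can be removed
  one at a time.
\<close>
definition chain_rel :: "'x set set \<Rightarrow> ('n \<Rightarrow> 'x) \<Rightarrow> ('n \<Rightarrow> 'x) \<Rightarrow> 'n set \<Rightarrow> 'x rel" where
  "chain_rel E s t N = {(x, y). \<exists>e\<in>E. x \<in> e \<and> y \<in> e} \<union> {(s k, t k) | k. k \<in> N} \<union> {(t k, s k) | k. k \<in> N}"

definition chain_system :: "'x set \<Rightarrow> 'x set set \<Rightarrow> ('n \<Rightarrow> 'x) \<Rightarrow> ('n \<Rightarrow> 'x) \<Rightarrow> 'n set \<Rightarrow> bool" where
  "chain_system X E s t N \<longleftrightarrow> finite X \<and> partition_on X E \<and> (\<forall>e\<in>E. card e = 2) \<and> finite N \<and>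
     inj_on s N \<and> inj_on t N \<and> s ` N \<inter> t ` N = {} \<and> s ` N \<union> t ` N \<subseteq> X"

definition outer :: "'x set \<Rightarrow> ('n \<Rightarrow> 'x) \<Rightarrow> ('n \<Rightarrow> 'x) \<Rightarrow> 'n set \<Rightarrow> 'x set" where
  "outer X s t N = X - (s ` N \<union> t ` N)"

lemma sym_chain_rel: "sym (chain_rel E s t N)"
  unfolding chain_rel_def sym_def by blast

lemma chain_rel_subset: "chain_system X E s t N \<Longrightarrow> chain_rel E s t N \<subseteq> X \<times> X"
  unfolding chain_rel_def chain_system_def partition_on_def by blast

lemma partition_chains: "chain_system X E s t N \<Longrightarrow> partition_on X (X // (chain_rel E s t N)\<^sup>*)"
  by (intro partition_quotient_rtrancl sym_chain_rel chain_rel_subset)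

lemma edge_partner:
  assumes "partition_on X E" "\<forall>e\<in>E. card e = 2" "x \<in> X"
  obtains y where "{x, y} \<in> E" "x \<noteq> y" "y \<in> X"
proof -
  obtain e where e: "e \<in> E" "x \<in> e" using assms(1,3) unfolding partition_on_def by blast
  then obtain y z where "e = {y, z}" "y \<noteq> z" using assms(2) by (meson card_2_iff)
  moreover have "e \<subseteq> X" using e assms(1) unfolding partition_on_def by blast
  ultimately show thesis using e that by (cases "x = y") (auto simp: insert_commute)
qed

text \<open>
  The first of two ways in which a single gluing can be undone. An edge whose two ends are glued to
  each other is a closed chain by itself and can be deleted.
\<close>
lemma chains_loop:
  assumes cs: "chain_system X E s t (insert k N)" and k: "k \<notin> N" and e: "{s k, t k} \<in> E"
  defines "X' \<equiv> X - {s k, t k}" and "E' \<equiv> E - {{s k, t k}}"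
  shows "chain_system X' E' s t N"
    and "X // (chain_rel E s t (insert k N))\<^sup>* = insert {s k, t k} (X' // (chain_rel E' s t N)\<^sup>*)"
proof -
  have E: "partition_on X E" and c2: "\<forall>e\<in>E. card e = 2" and fin: "finite X" "finite N"
    and inj: "inj_on s (insert k N)" "inj_on t (insert k N)"
    and dj: "s ` insert k N \<inter> t ` insert k N = {}" and sub: "s ` insert k N \<union> t ` insert k N \<subseteq> X"
    using cs unfolding chain_system_def by auto
  have notin: "s k \<notin> s ` N" "s k \<notin> t ` N" "t k \<notin> s ` N" "t k \<notin> t ` N"
    using inj dj k by auto
  have dis: "f \<inter> {s k, t k} = {}" if "f \<in> E" "f \<noteq> {s k, t k}" for f
    using edge_eqI[OF E that(1) e] that(2) by blast
  have UE: "\<Union>E' = X'"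
  proof
    show "\<Union>E' \<subseteq> X'"
      using dis E unfolding E'_def partition_on_def X'_def by blast
    show "X' \<subseteq> \<Union>E'"
      using E unfolding E'_def partition_on_def X'_def by blast
  qed
  have E': "partition_on X' E'"
  proof (rule partition_onI)
    show "\<Union>E' = X'" by (rule UE)
    show "{} \<notin> E'"
      using E unfolding E'_def partition_on_def by blast
    show "disjnt p q" if "p \<in> E'" "q \<in> E'" "p \<noteq> q" for p q
      using that E unfolding E'_def partition_on_def disjoint_def disjnt_def by blast
  qed
  have "s ` N \<union> t ` N \<subseteq> X'" using sub notin unfolding X'_def by blast
  then show cs': "chain_system X' E' s t N"
    unfolding chain_system_def
    using E' c2 fin inj dj by (auto simp: X'_def E'_def)
  let ?R = "chain_rel E s t (insert k N)" and ?R' = "chain_rel E' s t N"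
  have sub': "?R' \<subseteq> X' \<times> X'" by (rule chain_rel_subset[OF cs'])
  have R: "?R = ?R' \<union> {s k, t k} \<times> {s k, t k}"
    using e unfolding chain_rel_def E'_def by auto
  show "X // ?R\<^sup>* = insert {s k, t k} (X' // ?R'\<^sup>*)"
  proof (rule quotient_rtrancl_eqI)
    have p: "partition_on X' (X' // ?R'\<^sup>*)" using partition_chains[OF cs'] .
    have X: "X = X' \<union> {s k, t k}" using sub by (auto simp: X'_def)
    show "partition_on X (insert {s k, t k} (X' // ?R'\<^sup>*))"
    proof (rule partition_onI)
      show "\<Union>(insert {s k, t k} (X' // ?R'\<^sup>*)) = X"
        using p unfolding X partition_on_def by auto
      show "{} \<notin> insert {s k, t k} (X' // ?R'\<^sup>*)"
        using p unfolding partition_on_def by auto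
      have "disjnt {s k, t k} c" if "c \<in> X' // ?R'\<^sup>*" for c
        using that p unfolding partition_on_def X'_def disjnt_def by blast
      then show "disjnt c c'" if "c \<in> insert {s k, t k} (X' // ?R'\<^sup>*)"
          "c' \<in> insert {s k, t k} (X' // ?R'\<^sup>*)" "c \<noteq> c'" for c c'
        using that p unfolding partition_on_def disjoint_def by (metis disjnt_def disjnt_sym insertE)
    qed
  next
    fix c x y assume c: "c \<in> insert {s k, t k} (X' // ?R'\<^sup>*)" "x \<in> c" "(x, y) \<in> ?R"
    have *: "x \<in> X'" if "x \<in> c" "c \<in> X' // ?R'\<^sup>*" for x c
      using that partition_chains[OF cs'] unfolding partition_on_def by blast
    show "y \<in> c"
    proof (cases "c = {s k, t k}")
      case True
      then have "(x, y) \<notin> ?R'" using c(2) sub' unfolding X'_def by auto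
      then show ?thesis using c(3) True unfolding R by blast
    next
      case False
      then have c': "c \<in> X' // ?R'\<^sup>*" using c by blast
      then have "x \<notin> {s k, t k}" using *[OF c(2)] unfolding X'_def by blast
      then have "(x, y) \<in> ?R'" using c(3) unfolding R by blast
      then show ?thesis using c' c(2) unfolding quotient_def by (auto intro: rtrancl.rtrancl_into_rtrancl)
    qed
  next
    fix c assume c: "c \<in> insert {s k, t k} (X' // ?R'\<^sup>*)"
    show "\<exists>r. \<forall>y\<in>c. (r, y) \<in> ?R\<^sup>*"
    proof (cases "c = {s k, t k}")
      case True
      then show ?thesis unfolding R by blast
    next
      case False
      then obtain r where "c = ?R'\<^sup>* `` {r}" using c unfolding quotient_def by blast
      moreover have "?R'\<^sup>* \<subseteq> ?R\<^sup>*" by (rule rtrancl_mono) (auto simp: R)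
      ultimately show ?thesis by blast
    qed
  qed (rule sym_chain_rel)
qed

text \<open>
  The second way: if the flags \<open>s k\<close> and \<open>t k\<close> lie on different edges, these two edges are
  replaced by a single edge between their other ends \<open>a\<close> and \<open>a'\<close>. Every chain keeps its ends;
  the chain through \<open>a\<close> only loses the two flags.
\<close>
lemma chains_join:
  assumes cs: "chain_system X E s t (insert k N)" and k: "k \<notin> N"
    and a: "{s k, a} \<in> E" and a': "{t k, a'} \<in> E" and neq: "a \<noteq> t k"
  defines "X' \<equiv> X - {s k, t k}" and "E' \<equiv> insert {a, a'} (E - {{s k, a}, {t k, a'}})"
  shows "chain_system X' E' s t N" and "a \<in> X'" "a' \<in> X'" "a \<noteq> a'"
    and "X // (chain_rel E s t (insert k N))\<^sup>* =
      (\<lambda>c. if a \<in> c then c \<union> {s k, t k} else c) ` (X' // (chain_rel E' s t N)\<^sup>*)"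
proof -
  have E: "partition_on X E" and c2: "\<forall>e\<in>E. card e = 2" and fin: "finite X" "finite N"
    and inj: "inj_on s (insert k N)" "inj_on t (insert k N)"
    and dj: "s ` insert k N \<inter> t ` insert k N = {}" and sub: "s ` insert k N \<union> t ` insert k N \<subseteq> X"
    using cs unfolding chain_system_def by auto
  have notin: "s k \<notin> s ` N" "s k \<notin> t ` N" "t k \<notin> s ` N" "t k \<notin> t ` N" "s k \<noteq> t k"
    using inj dj k by auto
  have ne: "a \<noteq> s k" "a' \<noteq> t k" using c2 a a' by fastforce+
  have ne': "a' \<noteq> s k" using edge_eqI[OF E a a', of "s k"] neq notin(5) by (auto simp: doubleton_eq_iff)
  show aa': "a \<noteq> a'" using edge_eqI[OF E a a', of a] neq notin(5) ne by (auto simp: doubleton_eq_iff)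
  show aX: "a \<in> X'" and a'X: "a' \<in> X'"
    using E a a' ne ne' neq unfolding partition_on_def X'_def by blast+
  have dis: "e \<inter> {s k, a, t k, a'} = {}" if "e \<in> E - {{s k, a}, {t k, a'}}" for e
    using edge_eqI[OF E _ a, of e] edge_eqI[OF E _ a', of e] that by blast
  have UE: "\<Union>E' = X'"
  proof
    show "\<Union>E' \<subseteq> X'"
      using dis aX a'X E unfolding E'_def partition_on_def X'_def by blast
    show "X' \<subseteq> \<Union>E'"
      using E unfolding E'_def partition_on_def X'_def by blast
  qed
  have E': "partition_on X' E'"
  proof (rule partition_onI)
    show "\<Union>E' = X'" by (rule UE)
    show "{} \<notin> E'"
      using E unfolding E'_def partition_on_def by blast
    have new: "disjnt {a, a'} p" if "p \<in> E'" "p \<noteq> {a, a'}" for p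
      using dis[of p] that unfolding E'_def disjnt_def by blast
    have old: "disjnt p q" if "p \<in> E" "q \<in> E" "p \<noteq> q" for p q
      using that E unfolding partition_on_def disjoint_def disjnt_def by blast
    show "disjnt p q" if "p \<in> E'" "q \<in> E'" "p \<noteq> q" for p q
      using that new old disjnt_sym unfolding E'_def by (metis insertE DiffD1)
  qed
  have "\<forall>e\<in>E'. card e = 2" using c2 aa' unfolding E'_def by auto
  moreover have "s ` N \<union> t ` N \<subseteq> X'" using sub notin unfolding X'_def by blast
  ultimately show cs': "chain_system X' E' s t N"
    unfolding chain_system_def
    using E' fin inj dj by (auto simp: X'_def)
  let ?R = "chain_rel E s t (insert k N)" and ?R' = "chain_rel E' s t N"
  let ?h = "\<lambda>c. if a \<in> c then c \<union> {s k, t k} else c"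
  have sub': "?R' \<subseteq> X' \<times> X'" by (rule chain_rel_subset[OF cs'])
  have R: "(x, y) \<in> ?R' \<or> {x, y} \<subseteq> {s k, t k, a, a'}" if "(x, y) \<in> ?R" for x y
    using that unfolding chain_rel_def E'_def by blast
  have st: "(s k, a) \<in> ?R" "(a, s k) \<in> ?R" "(s k, t k) \<in> ?R" "(t k, s k) \<in> ?R" "(t k, a') \<in> ?R" "(a', t k) \<in> ?R"
    using a a' unfolding chain_rel_def by blast+
  then have as: "(a, s k) \<in> ?R\<^sup>*" and at: "(a, t k) \<in> ?R\<^sup>*" and aa: "(a, a') \<in> ?R\<^sup>*"
    by (meson r_into_rtrancl rtrancl.rtrancl_into_rtrancl)+
  have a'a: "(a', a) \<in> ?R\<^sup>*" using sym_rtrancl[OF sym_chain_rel] aa by (rule symD)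
  have "?R' \<subseteq> ?R\<^sup>*"
  proof
    fix z assume "z \<in> ?R'"
    then have "z \<in> ?R \<or> z \<in> {a, a'} \<times> {a, a'}" unfolding chain_rel_def E'_def by blast
    then show "z \<in> ?R\<^sup>*" using aa a'a by auto
  qed
  then have RR: "?R'\<^sup>* \<subseteq> ?R\<^sup>*" using rtrancl_subset_rtrancl by blast
  have aR': "(a, a') \<in> ?R'" "(a', a) \<in> ?R'" "(a, a) \<in> ?R'" "(a', a') \<in> ?R'"
    by (simp_all add: chain_rel_def E'_def)
  have p: "partition_on X' (X' // ?R'\<^sup>*)" using partition_chains[OF cs'] .
  have cl: "y \<in> c" if "c \<in> X' // ?R'\<^sup>*" "x \<in> c" "(x, y) \<in> ?R'" for c x y
    using that unfolding quotient_def by (auto intro: rtrancl.rtrancl_into_rtrancl)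
  have cX: "x \<in> X'" if "x \<in> c" "c \<in> X' // ?R'\<^sup>*" for x c
    using that p unfolding partition_on_def by blast
  have X: "X = X' \<union> {s k, t k}" using sub by (auto simp: X'_def)
  obtain c0 where c0: "c0 \<in> X' // ?R'\<^sup>*" "a \<in> c0" using aX p unfolding partition_on_def by blast
  show "X // ?R\<^sup>* = ?h ` (X' // ?R'\<^sup>*)"
  proof (rule quotient_rtrancl_eqI)
    show "partition_on X (?h ` (X' // ?R'\<^sup>*))"
    proof (rule partition_onI)
      have "\<Union>(?h ` (X' // ?R'\<^sup>*)) = \<Union>(X' // ?R'\<^sup>*) \<union> {s k, t k}"
        using c0 by (auto split: if_splits)
      then show "\<Union>(?h ` (X' // ?R'\<^sup>*)) = X" using p unfolding X partition_on_def by blast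
      show "{} \<notin> ?h ` (X' // ?R'\<^sup>*)"
      using p unfolding partition_on_def by (auto split: if_splits)
      fix q q' assume q: "q \<in> ?h ` (X' // ?R'\<^sup>*)" "q' \<in> ?h ` (X' // ?R'\<^sup>*)" "q \<noteq> q'"
      obtain c where c: "c \<in> X' // ?R'\<^sup>*" "q = ?h c" using q by blast
      obtain c' where c': "c' \<in> X' // ?R'\<^sup>*" "q' = ?h c'" using q by blast
      have "c \<noteq> c'" using q c c' by blast
      then have "c \<inter> c' = {}" using p c c' unfolding partition_on_def disjoint_def by blast
      moreover have "c \<inter> {s k, t k} = {}" "c' \<inter> {s k, t k} = {}" using cX c c' unfolding X'_def by blast+
      ultimately show "disjnt q q'" unfolding c c' disjnt_def by auto
    qed
  next
    fix c x y assume h: "c \<in> ?h ` (X' // ?R'\<^sup>*)" "x \<in> c" "(x, y) \<in> ?R"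
    obtain c' where c': "c' \<in> X' // ?R'\<^sup>*" "c = ?h c'" using h by blast
    have a'c: "a \<in> c' \<longleftrightarrow> a' \<in> c'" using cl c'(1) aR' by blast
    show "y \<in> c"
    proof (cases "(x, y) \<in> ?R'")
      case True
      then have "x \<in> c'" using h(2) sub' unfolding c'(2) X'_def by (auto split: if_splits)
      then show ?thesis using cl[OF c'(1) _ True] unfolding c' by auto
    next
      case False
      then have "{x, y} \<subseteq> {s k, t k, a, a'}" using R h by blast
      moreover from this have "a \<in> c'"
        using h(2) a'c cX[OF _ c'(1)] unfolding c'(2) X'_def by (auto split: if_splits)
      ultimately show ?thesis using a'c unfolding c' by auto
    qed
  next
    fix c assume h: "c \<in> ?h ` (X' // ?R'\<^sup>*)"
    obtain c' where c': "c' \<in> X' // ?R'\<^sup>*" "c = ?h c'" using h by blast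
    obtain r where r: "c' = ?R'\<^sup>* `` {r}" using c' unfolding quotient_def by blast
    have "(r, y) \<in> ?R\<^sup>*" if "y \<in> c" for y
    proof (cases "y \<in> c'")
      case True
      then show ?thesis using RR unfolding r by blast
    next
      case False
      then have "a \<in> c'" "y \<in> {s k, t k}" using that unfolding c' by (auto split: if_splits)
      then have "(r, a) \<in> ?R\<^sup>*" "(a, y) \<in> ?R\<^sup>*" using RR as at unfolding r by blast+
      then show ?thesis by simp
    qed
    then show "\<exists>r. \<forall>y\<in>c. (r, y) \<in> ?R\<^sup>*" by blast
  qed (rule sym_chain_rel)
qed

lemma chain_cases [consumes 2]:
  assumes cs: "chain_system X E s t (insert k N)" and k: "k \<notin> N"
  obtains (loop) "{s k, t k} \<in> E"
  | (join) a a' where "{s k, a} \<in> E" "{t k, a'} \<in> E" "a \<noteq> t k"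
proof -
  have E: "partition_on X E" "\<forall>e\<in>E. card e = 2" and X: "s k \<in> X" "t k \<in> X"
    using cs unfolding chain_system_def by auto
  obtain a where a: "{s k, a} \<in> E" by (rule edge_partner[OF E X(1)])
  obtain a' where a': "{t k, a'} \<in> E" by (rule edge_partner[OF E X(2)])
  show thesis using a a' loop join by blast
qed

text \<open>
  The unordered pair \<open>e\<close> has no preferred enumeration, but for a symmetric \<open>b\<close> both give the same
  value (\<open>edge_val_pair\<close>).
\<close>
definition edge_val :: "('v \<Rightarrow> 'v \<Rightarrow> 'k) \<Rightarrow> ('x \<Rightarrow> 'v) \<Rightarrow> 'x set \<Rightarrow> 'k" where
  "edge_val b l e = (THE r. \<exists>x y. e = {x, y} \<and> x \<noteq> y \<and> r = b (l x) (l y))"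

lemma edge_val_pair:
  assumes "\<And>v w. b v w = b w v" "x \<noteq> y"
  shows "edge_val b l {x, y} = b (l x) (l y)"
  unfolding edge_val_def
  by (rule the_equality) (use assms in \<open>auto simp: doubleton_eq_iff\<close>)

lemma edge_val_cong:
  assumes "\<And>x. x \<in> e \<Longrightarrow> l x = l' x"
  shows "edge_val b l e = edge_val b l' e"
proof -
  have "(\<exists>x y. e = {x, y} \<and> x \<noteq> y \<and> r = b (l x) (l y)) \<longleftrightarrow>
      (\<exists>x y. e = {x, y} \<and> x \<noteq> y \<and> r = b (l' x) (l' y))" for r
    using assms by (metis insertCI)
  then show ?thesis unfolding edge_val_def by simp
qed

lemma edge_val_image:
  assumes "\<And>v w. b v w = b w v" "card e = 2" "inj_on h e"
  shows "edge_val b l (h ` e) = edge_val b (l \<circ> h) e"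
proof -
  obtain x y where "e = {x, y}" "x \<noteq> y" using assms(2) by (meson card_2_iff)
  then show ?thesis using assms(1,3) by (simp add: edge_val_pair)
qed

lemma sum_PiE_insert:
  fixes f :: "('n \<Rightarrow> 'v) \<Rightarrow> 'k::comm_monoid_add"
  assumes "k \<notin> N"
  shows "(\<Sum>u\<in>PiE (insert k N) (\<lambda>_. D). f u) = (\<Sum>u\<in>PiE N (\<lambda>_. D). \<Sum>w\<in>D. f (u(k := w)))"
proof -
  have "(\<Sum>u\<in>PiE (insert k N) (\<lambda>_. D). f u) =
      (\<Sum>(w, u)\<in>D \<times> PiE N (\<lambda>_. D). f (u(k := w)))"
    unfolding PiE_insert_eq
    by (subst sum.reindex[OF inj_combinator[OF assms]]) (simp add: case_prod_unfold)
  also have "\<dots> = (\<Sum>w\<in>D. \<Sum>u\<in>PiE N (\<lambda>_. D). f (u(k := w)))"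
    by (rule sum.cartesian_product[symmetric])
  also have "\<dots> = (\<Sum>u\<in>PiE N (\<lambda>_. D). \<Sum>w\<in>D. f (u(k := w)))"
    by (rule sum.swap)
  finally show ?thesis .
qed

text \<open>
  A basis vector \<open>u k\<close> is attached to the gluing \<open>k\<close>: it labels \<open>t k\<close>, and its dual vector
  labels \<open>s k\<close>. Summing over all \<open>u\<close> is the contraction of tensors along the gluings.
\<close>
definition chain_label ::
  "('n \<Rightarrow> 'x) \<Rightarrow> ('n \<Rightarrow> 'x) \<Rightarrow> 'n set \<Rightarrow> ('v \<Rightarrow> 'v) \<Rightarrow> ('x \<Rightarrow> 'v) \<Rightarrow> ('n \<Rightarrow> 'v) \<Rightarrow> 'x \<Rightarrow> 'v" where
  "chain_label s t N d l u x =
     (if x \<in> s ` N then d (u (inv_into N s x)) else if x \<in> t ` N then u (inv_into N t x) else l x)"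

text \<open>
  The combinatorial heart of functoriality. Summing over the label of one gluing replaces two edges by
  one, because \<open>\<Sum>\<^sub>w b x (d w) * b w y = b x y\<close>, or deletes a closed edge at the cost of a factor
  \<open>\<Sum>\<^sub>w b (d w) w = card D\<close>. These are the two cases \<open>chains_join\<close> and \<open>chains_loop\<close>, so induction
  over the gluings leaves one factor for each open chain and one power of \<open>card D\<close> for each closed
  one. The same induction shows that a chain has two ends or none.
\<close>
theorem chain_state_sum:
  fixes b :: "'v \<Rightarrow> 'v \<Rightarrow> 'k::comm_ring_1" and d :: "'v \<Rightarrow> 'v" and D :: "'v set"
  assumes cs: "chain_system X E s t N"
    and b_sym: "\<And>v w. b v w = b w v"
    and contract: "\<And>x y. (\<Sum>w\<in>D. b x (d w) * b w y) = b x y"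
    and loop: "\<And>w. w \<in> D \<Longrightarrow> b (d w) w = 1"
  defines "C \<equiv> X // (chain_rel E s t N)\<^sup>*" and "Q \<equiv> outer X s t N"
  shows "(\<forall>c\<in>C. c \<inter> Q = {} \<or> card (c \<inter> Q) = 2) \<and>
    (\<Sum>u\<in>PiE N (\<lambda>_. D). \<Prod>e\<in>E. edge_val b (chain_label s t N d l u) e) =
    of_nat (card D) ^ card {c \<in> C. c \<inter> Q = {}} * (\<Prod>c\<in>{c \<in> C. c \<inter> Q \<noteq> {}}. edge_val b l (c \<inter> Q))"
proof -
  have "finite N" using cs unfolding chain_system_def by blast
  then show ?thesis using cs unfolding C_def Q_def
  proof (induction N arbitrary: X E)
    case empty
    have E: "partition_on X E" "\<forall>e\<in>E. card e = 2" using empty unfolding chain_system_def by auto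
    have ne: "{} \<notin> E" and sub: "\<And>e. e \<in> E \<Longrightarrow> e \<subseteq> X" using E unfolding partition_on_def by auto
    have "X // (chain_rel E s t {})\<^sup>* = E"
    proof (rule quotient_rtrancl_eqI[OF E(1)])
      show "y \<in> c" if "c \<in> E" "x \<in> c" "(x, y) \<in> chain_rel E s t {}" for c x y
        using that edge_eqI[OF E(1)] unfolding chain_rel_def by blast
      show "\<exists>r. \<forall>y\<in>c. (r, y) \<in> (chain_rel E s t {})\<^sup>*" if c: "c \<in> E" for c
      proof -
        have "c \<noteq> {}" using c ne by blast
        then obtain r where "r \<in> c" by blast
        then have "\<forall>y\<in>c. (r, y) \<in> chain_rel E s t {}" using c unfolding chain_rel_def by blast
        then show ?thesis by blast
      qed
    qed (rule sym_chain_rel)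
    moreover have whole: "c \<inter> outer X s t {} = c" if "c \<in> E" for c
      using sub[OF that] unfolding outer_def by auto
    moreover have "card {c \<in> E. c \<inter> outer X s t {} = {}} = 0"
    proof -
      have "{c \<in> E. c \<inter> outer X s t {} = {}} = {}" using whole ne by auto
      then show ?thesis by (simp only: card.empty)
    qed
    moreover have "{c \<in> E. c \<inter> outer X s t {} \<noteq> {}} = E"
      using whole ne by auto
    moreover have "chain_label s t {} d l u = l" for u
      unfolding chain_label_def by auto
    ultimately show ?case
      using E(2) by simp
  next
    case (insert k N)
    let ?C = "X // (chain_rel E s t (insert k N))\<^sup>*" and ?Q = "outer X s t (insert k N)"
    have inj: "inj_on s (insert k N)" "inj_on t (insert k N)"
      and dj: "s ` insert k N \<inter> t ` insert k N = {}" and E: "partition_on X E" "\<forall>e\<in>E. card e = 2"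
      and finX: "finite X"
      using insert.prems unfolding chain_system_def by auto
    have finE: "finite E" using E(1) finX by (metis finite_elements)
    have notin: "s k \<notin> s ` N" "s k \<notin> t ` N" "t k \<notin> s ` N" "t k \<notin> t ` N" "s k \<noteq> t k"
      using inj dj insert.hyps by auto
    define L where "L = (\<lambda>u w. chain_label s t (insert k N) d l (u(k := w)))"
    have Lsk: "L u w (s k) = d w" for u w
      using inv_into_f_f[OF inj(1), of k] by (simp add: L_def chain_label_def)
    have Ltk: "L u w (t k) = w" for u w
      using inv_into_f_f[OF inj(2), of k] notin by (auto simp: L_def chain_label_def)
    have L: "L u w x = chain_label s t N d l u x" if "x \<noteq> s k" "x \<noteq> t k" for u w x
    proof -
      consider j where "j \<in> N" "x = s j" | j where "j \<in> N" "x = t j" "x \<notin> s ` N"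
        | "x \<notin> s ` N" "x \<notin> t ` N" by blast
      then show ?thesis
      proof cases
        case 1
        then have "inv_into (insert k N) s x = j" "inv_into N s x = j" "j \<noteq> k"
          using inj insert.hyps by (auto simp: inj_on_insert intro!: inv_into_f_eq)
        then show ?thesis using 1 by (auto simp: L_def chain_label_def)
      next
        case 2
        then have "inv_into (insert k N) t x = j" "inv_into N t x = j" "j \<noteq> k"
          using inj insert.hyps by (auto simp: inj_on_insert intro!: inv_into_f_eq)
        then show ?thesis using 2 that by (auto simp: L_def chain_label_def)
      next
        case 3
        then show ?thesis using that by (auto simp: L_def chain_label_def)
      qed
    qed
    have sum: "(\<Sum>u\<in>PiE (insert k N) (\<lambda>_. D). \<Prod>e\<in>E. edge_val b (chain_label s t (insert k N) d l u) e) =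
      (\<Sum>u\<in>PiE N (\<lambda>_. D). \<Sum>w\<in>D. \<Prod>e\<in>E. edge_val b (L u w) e)"
      unfolding L_def by (rule sum_PiE_insert[OF insert.hyps(2)])
    from insert.prems insert.hyps(2) show ?case
    proof (cases rule: chain_cases)
      case loop
      let ?X = "X - {s k, t k}" and ?E = "E - {{s k, t k}}"
      note ch = chains_loop[OF insert.prems insert.hyps(2) loop]
      let ?C' = "?X // (chain_rel ?E s t N)\<^sup>*" and ?Q' = "outer ?X s t N"
      note IH = insert.IH[OF ch(1)]
      have Q: "?Q' = ?Q" unfolding outer_def by auto
      have p: "partition_on ?X ?C'" by (rule partition_chains[OF ch(1)])
      have new: "{s k, t k} \<notin> ?C'" using p unfolding partition_on_def by blast
      have new_Q: "{s k, t k} \<inter> ?Q = {}" unfolding outer_def by auto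
      have fin: "finite ?C'" using finX unfolding quotient_def by simp
      have "{c \<in> ?C. c \<inter> ?Q = {}} = insert {s k, t k} {c \<in> ?C'. c \<inter> ?Q = {}}"
        unfolding ch(2) using new_Q by blast
      then have card: "card {c \<in> ?C. c \<inter> ?Q = {}} = Suc (card {c \<in> ?C'. c \<inter> ?Q' = {}})"
        using new fin unfolding Q by simp
      have open_eq: "{c \<in> ?C. c \<inter> ?Q \<noteq> {}} = {c \<in> ?C'. c \<inter> ?Q' \<noteq> {}}"
        unfolding ch(2) Q using new_Q by blast
      have "(\<Prod>e\<in>E. edge_val b (L u w) e) = (\<Prod>e\<in>?E. edge_val b (chain_label s t N d l u) e)"
        if "w \<in> D" for u w
      proof -
        have "(\<Prod>e\<in>E. edge_val b (L u w) e) = edge_val b (L u w) {s k, t k} * (\<Prod>e\<in>?E. edge_val b (L u w) e)"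
          by (rule prod.remove[OF finE loop])
        also have "edge_val b (L u w) {s k, t k} = 1"
          using edge_val_pair[of b, OF b_sym notin(5)] Lsk Ltk assms(4)[OF that] by simp
        also have "(\<Prod>e\<in>?E. edge_val b (L u w) e) = (\<Prod>e\<in>?E. edge_val b (chain_label s t N d l u) e)"
        proof (intro prod.cong refl edge_val_cong)
          fix e x assume "e \<in> ?E" "x \<in> e"
          then show "L u w x = chain_label s t N d l u x"
            using L edge_eqI[OF E(1) loop, of e x] by blast
        qed
        finally show ?thesis by simp
      qed
      then have "(\<Sum>u\<in>PiE N (\<lambda>_. D). \<Sum>w\<in>D. \<Prod>e\<in>E. edge_val b (L u w) e) =
          of_nat (card D) * (\<Sum>u\<in>PiE N (\<lambda>_. D). \<Prod>e\<in>?E. edge_val b (chain_label s t N d l u) e)"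
        by (simp add: sum_distrib_left)
      moreover have "\<forall>c\<in>?C. c \<inter> ?Q = {} \<or> card (c \<inter> ?Q) = 2"
        using IH new_Q unfolding ch(2) Q by blast
      ultimately show ?thesis
        unfolding sum card open_eq using IH Q by (simp add: mult.assoc)
    next
      case (join a a')
      let ?X = "X - {s k, t k}" and ?Rest = "E - {{s k, a}, {t k, a'}}"
      let ?E = "insert {a, a'} ?Rest"
      note ch = chains_join[OF insert.prems insert.hyps(2) join]
      let ?C' = "?X // (chain_rel ?E s t N)\<^sup>*" and ?Q' = "outer ?X s t N"
      (* the chains before and after the contraction correspond under h *)
      define h where "h = (\<lambda>c. if a \<in> c then c \<union> {s k, t k} else c)"
      have C: "?C = h ` ?C'" unfolding h_def by (rule ch(5))
      note IH = insert.IH[OF ch(1)]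
      have Q: "?Q' = ?Q" unfolding outer_def by auto
      have p: "partition_on ?X ?C'" by (rule partition_chains[OF ch(1)])
      have hQ: "h c \<inter> ?Q = c \<inter> ?Q" for c unfolding outer_def h_def by auto
      have "h c - {s k, t k} = c" if "c \<in> ?C'" for c
        using that p unfolding partition_on_def h_def by auto
      then have inj_h: "inj_on h ?C'" by (rule inj_on_inverseI)
      have "{c \<in> ?C. c \<inter> ?Q = {}} = h ` {c \<in> ?C'. c \<inter> ?Q' = {}}"
        unfolding C Q using hQ by auto
      then have card: "card {c \<in> ?C. c \<inter> ?Q = {}} = card {c \<in> ?C'. c \<inter> ?Q' = {}}"
        by (simp add: card_image inj_on_subset[OF inj_h])
      have "{c \<in> ?C. c \<inter> ?Q \<noteq> {}} = h ` {c \<in> ?C'. c \<inter> ?Q' \<noteq> {}}"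
        unfolding C Q using hQ by auto
      then have open_eq: "(\<Prod>c\<in>{c \<in> ?C. c \<inter> ?Q \<noteq> {}}. edge_val b l (c \<inter> ?Q)) =
          (\<Prod>c\<in>{c \<in> ?C'. c \<inter> ?Q' \<noteq> {}}. edge_val b l (c \<inter> ?Q'))"
        using hQ by (simp add: prod.reindex inj_on_subset[OF inj_h] Q)
      have ne: "{s k, a} \<noteq> {t k, a'}" using join(3) notin(5) by (auto simp: doubleton_eq_iff)
      have a: "a \<noteq> s k" "a \<noteq> t k" "a' \<noteq> s k" "a' \<noteq> t k" using ch(2,3) by auto
      have new: "{a, a'} \<notin> ?Rest"
      proof
        assume "{a, a'} \<in> ?Rest"
        then have "{a, a'} \<in> E" by (rule DiffD1)
        then have "{s k, a} = {a, a'}" by (rule edge_eqI[OF E(1) join(1), of _ a]) simp_all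
        then show False using a by (auto simp: doubleton_eq_iff)
      qed
      have "(\<Sum>w\<in>D. \<Prod>e\<in>E. edge_val b (L u w) e) = (\<Prod>e\<in>?E. edge_val b (chain_label s t N d l u) e)" for u
      proof -
        let ?l = "chain_label s t N d l u"
        have rest: "(\<Prod>e\<in>?Rest. edge_val b (L u w) e) = (\<Prod>e\<in>?Rest. edge_val b ?l e)" for w
        proof (intro prod.cong refl edge_val_cong)
          fix e x assume "e \<in> ?Rest" "x \<in> e"
          then show "L u w x = ?l x"
            using L edge_eqI[OF E(1) join(1), of e x] edge_eqI[OF E(1) join(2), of e x] by blast
        qed
        have "(\<Prod>e\<in>E. edge_val b (L u w) e) = b (?l a) (d w) * b w (?l a') * (\<Prod>e\<in>?Rest. edge_val b ?l e)" for w
        proof -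
          have "(\<Prod>e\<in>E. edge_val b (L u w) e) = edge_val b (L u w) {s k, a} *
              (\<Prod>e\<in>E - {{s k, a}}. edge_val b (L u w) e)"
            by (rule prod.remove[OF finE join(1)])
          also have "(\<Prod>e\<in>E - {{s k, a}}. edge_val b (L u w) e) = edge_val b (L u w) {t k, a'} *
              (\<Prod>e\<in>E - {{s k, a}} - {{t k, a'}}. edge_val b (L u w) e)"
            by (rule prod.remove) (use finE join(2) ne in auto)
          also have "E - {{s k, a}} - {{t k, a'}} = ?Rest" by auto
          also have "edge_val b (L u w) {s k, a} = b (?l a) (d w)"
            using edge_val_pair[of b, OF b_sym a(1)[symmetric], of "L u w"] Lsk L[OF a(1,2)] b_sym by metis
          also have "edge_val b (L u w) {t k, a'} = b w (?l a')"
            using edge_val_pair[of b, OF b_sym a(4)[symmetric], of "L u w"] Ltk L[OF a(3,4)] by metis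
          finally show ?thesis unfolding rest by (simp only: mult.assoc)
        qed
        then have "(\<Sum>w\<in>D. \<Prod>e\<in>E. edge_val b (L u w) e) = b (?l a) (?l a') * (\<Prod>e\<in>?Rest. edge_val b ?l e)"
          by (simp flip: sum_distrib_right add: contract)
        also have "b (?l a) (?l a') = edge_val b ?l {a, a'}"
          using edge_val_pair[of b, OF b_sym ch(4)] by simp
        finally show ?thesis using finE new by simp
      qed
      moreover have "\<forall>c\<in>?C. c \<inter> ?Q = {} \<or> card (c \<inter> ?Q) = 2"
        using IH hQ unfolding C Q by auto
      ultimately show ?thesis
        unfolding sum card open_eq using IH by simp
    qed
  qed
qed

section \<open>Ribbon graphs up to isomorphism\<close>

lemma permutes_map_sum:
  assumes "p permutes A" "q permutes B"
  shows "map_sum p q permutes (A <+> B)"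
proof -
  have "inj (map_sum p q)"
    by (intro sum.inj_map permutes_inj[OF assms(1)] permutes_inj[OF assms(2)])
  moreover have "surj (map_sum p q)"
    unfolding surj_def
  proof
    fix y
    show "\<exists>x. y = map_sum p q x"
    proof (cases y)
      case (Inl a)
      then show ?thesis using permutes_inverses(1)[OF assms(1), of a] by (intro exI[of _ "Inl (inv p a)"]) simp
    next
      case (Inr a)
      then show ?thesis using permutes_inverses(1)[OF assms(2), of a] by (intro exI[of _ "Inr (inv q a)"]) simp
    qed
  qed
  moreover have "map_sum p q x = x" if "x \<notin> A <+> B" for x
    using that permutes_not_in[OF assms(1)] permutes_not_in[OF assms(2)] by (cases x) auto
  ultimately show ?thesis unfolding permutes_def by (simp flip: bij_iff add: bij_def)
qed

lemma partition_on_Un_disjoint: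
  assumes "partition_on A P" "partition_on B Q" "A \<inter> B = {}"
  shows "partition_on (A \<union> B) (P \<union> Q)"
proof (rule partition_onI)
  show "\<Union>(P \<union> Q) = A \<union> B" using assms unfolding partition_on_def by blast
  show "{} \<notin> P \<union> Q" using assms unfolding partition_on_def by blast
  have "disjnt p q" if "p \<in> P" "q \<in> Q" for p q
    using that assms unfolding partition_on_def disjnt_def by blast
  then show "disjnt p q" if "p \<in> P \<union> Q" "q \<in> P \<union> Q" "p \<noteq> q" for p q
    using that assms disjnt_sym unfolding partition_on_def disjoint_def disjnt_def by (metis Un_iff)
qed

lemma partition_on_image:
  assumes "partition_on A P" "inj_on f A"
  shows "partition_on (f ` A) ((`) f ` P)"
proof -
  have "(`) f ` P - {{}} = (`) f ` P" using assms(1) unfolding partition_on_def by auto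
  then show ?thesis using partition_on_inj_image[OF assms] by simp
qed

lemma ribbon_graphD:
  assumes "ribbon_graph G"
  shows "finite (halfs G)" "nxt G permutes halfs G" "partition_on (flags G) (edges G)"
    "\<And>e. e \<in> edges G \<Longrightarrow> card e = 2" "\<And>e. e \<in> edges G \<Longrightarrow> e \<subseteq> flags G" "finite (flags G)" "finite (edges G)"
proof -
  show *: "finite (halfs G)" "nxt G permutes halfs G" and p: "partition_on (flags G) (edges G)"
    and "\<And>e. e \<in> edges G \<Longrightarrow> card e = 2"
    using assms unfolding ribbon_graph_def by auto
  show "\<And>e. e \<in> edges G \<Longrightarrow> e \<subseteq> flags G" using p unfolding partition_on_def by blast
  show "finite (flags G)" using * unfolding flags_def by simp
  then show "finite (edges G)" using finite_elements p by blast
qed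

lemma HalfEdge_in_flags [simp]: "HalfEdge h \<in> flags G \<longleftrightarrow> h \<in> halfs G"
  and InEnd_in_flags [simp]: "InEnd i \<in> flags G \<longleftrightarrow> i < ins G"
  and OutEnd_in_flags [simp]: "OutEnd i \<in> flags G \<longleftrightarrow> i < outs G"
  by (auto simp: flags_def)

lemma inj_map_flag:
  assumes "inj_on f (halfs G)"
  shows "inj_on (map_flag f) (flags G)"
proof (rule inj_onI)
  fix x y assume "x \<in> flags G" "y \<in> flags G" "map_flag f x = map_flag f y"
  then show "x = y" using inj_onD[OF assms] by (cases x; cases y) auto
qed

lemma ribbon_graphI_image:
  assumes G: "ribbon_graph G" and j: "inj_on j (flags G)" and "flags H = j ` flags G"
    and "edges H = (`) j ` edges G" and "finite (halfs H)" "nxt H permutes halfs H"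
  shows "ribbon_graph H"
proof -
  have "card (j ` e) = 2" if "e \<in> edges G" for e
    using ribbon_graphD(4,5)[OF G that] j by (simp add: card_image inj_on_subset)
  then show ?thesis
    using assms partition_on_image[OF ribbon_graphD(3)[OF G] j] unfolding ribbon_graph_def by auto
qed

lemma rgraph_isoE:
  assumes "rgraph_iso G H"
  obtains \<phi> where "bij_betw \<phi> (halfs G) (halfs H)" "\<forall>h\<in>halfs G. \<phi> (nxt G h) = nxt H (\<phi> h)"
    "edges H = (`) (map_flag \<phi>) ` edges G" "ins G = ins H" "outs G = outs H" "circles G = circles H"
  using assms unfolding rgraph_iso_def by blast

lemma rgraph_isoI:
  assumes "bij_betw \<phi> (halfs G) (halfs H)" "\<And>h. h \<in> halfs G \<Longrightarrow> \<phi> (nxt G h) = nxt H (\<phi> h)"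
    "edges H = (`) (map_flag \<phi>) ` edges G" "ins G = ins H" "outs G = outs H" "circles G = circles H"
  shows "rgraph_iso G H"
  using assms unfolding rgraph_iso_def by blast

definition transport :: "('h \<Rightarrow> 'g) \<Rightarrow> 'h rgraph \<Rightarrow> 'g rgraph" where
  "transport f G = \<lparr>ins = ins G, outs = outs G, halfs = f ` halfs G,
     nxt = (\<lambda>x. if x \<in> f ` halfs G then f (nxt G (inv_into (halfs G) f x)) else x),
     edges = (\<lambda>e. map_flag f ` e) ` edges G, circles = circles G\<rparr>"

lemma permutes_conjugate:
  assumes "p permutes A" "inj_on f A"
  shows "(\<lambda>x. if x \<in> f ` A then f (p (inv_into A f x)) else x) permutes f ` A"
proof (rule bij_imp_permutes)
  have b: "bij_betw f A (f ` A)" using assms(2) by (rule inj_on_imp_bij_betw)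
  have "bij_betw (f \<circ> p \<circ> inv_into A f) (f ` A) (f ` A)"
    using bij_betw_trans[OF bij_betw_trans[OF bij_betw_inv_into[OF b] permutes_imp_bij[OF assms(1)]] b]
    by (simp add: comp_assoc)
  then show "bij_betw (\<lambda>x. if x \<in> f ` A then f (p (inv_into A f x)) else x) (f ` A) (f ` A)"
    by (rule bij_betw_cong[THEN iffD1, rotated]) auto
qed auto

lemma transport:
  assumes "ribbon_graph G" "inj_on f (halfs G)"
  shows "ribbon_graph (transport f G)" "rgraph_iso G (transport f G)"
proof -
  show "ribbon_graph (transport f G)"
  proof (rule ribbon_graphI_image[OF assms(1)])
    show "inj_on (map_flag f) (flags G)" using assms(2) by (rule inj_map_flag)
    show "flags (transport f G) = map_flag f ` flags G"
      by (auto simp: flags_def transport_def image_Un image_image)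
    show "nxt (transport f G) permutes halfs (transport f G)"
      using permutes_conjugate[OF ribbon_graphD(2)[OF assms(1)] assms(2)] by (simp add: transport_def)
  qed (use ribbon_graphD[OF assms(1)] in \<open>auto simp: transport_def\<close>)
  show "rgraph_iso G (transport f G)"
  proof (rule rgraph_isoI)
    show "bij_betw f (halfs G) (halfs (transport f G))"
      using inj_on_imp_bij_betw[OF assms(2)] by (simp add: transport_def)
  qed (use assms(2) in \<open>auto simp: transport_def\<close>)
qed

lemma ribbon_graph_relabel:
  assumes "ribbon_graph G" "bij f"
  shows "ribbon_graph (relabel f G)" "rgraph_iso G (relabel f G)"
proof -
  have inj: "inj_on f (halfs G)" using assms(2) by (simp add: bij_def inj_on_def)
  have "relabel f G = transport f G"
  proof -
    have "(f \<circ> nxt G \<circ> inv f) x = (if x \<in> f ` halfs G then f (nxt G (inv_into (halfs G) f x)) else x)" for x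
    proof (cases "x \<in> f ` halfs G")
      case True
      then obtain y where y: "y \<in> halfs G" "x = f y" by blast
      then show ?thesis using inj assms(2) by (simp add: bij_def)
    next
      case False
      have x: "x = f (inv f x)" using assms(2) by (simp add: bij_def surj_f_inv_f)
      then have "inv f x \<notin> halfs G" using False by (metis image_eqI)
      then show ?thesis using False permutes_not_in[OF ribbon_graphD(2)[OF assms(1)]] x by simp
    qed
    then show ?thesis unfolding relabel_def transport_def by auto
  qed
  then show "ribbon_graph (relabel f G)" "rgraph_iso G (relabel f G)"
    using transport[OF assms(1) inj] by simp_all
qed

text \<open>
  Juxtaposition and gluing change the type of the half-edges. Since a ribbon graph has finitely many
  of them, it is isomorphic to one on natural numbers (\<open>cls_some\<close>), which makes the class available
  for every type.
\<close>
definition cls :: "'h rgraph \<Rightarrow> ribbon" where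
  "cls G = abs_ribbon (SOME H. ribbon_graph H \<and> rgraph_iso G H)"

lemma cls_some:
  fixes G :: "'h rgraph"
  assumes "ribbon_graph G"
  shows "\<exists>H :: nat rgraph. ribbon_graph H \<and> rgraph_iso G H \<and> cls G = abs_ribbon H"
proof -
  obtain f :: "'h \<Rightarrow> nat" where "inj_on f (halfs G)"
    using finite_imp_inj_to_nat_seg[OF ribbon_graphD(1)[OF assms]] by blast
  then have "\<exists>H :: nat rgraph. ribbon_graph H \<and> rgraph_iso G H"
    using transport[OF assms] by blast
  then show ?thesis unfolding cls_def by (metis (mono_tags, lifting) someI_ex)
qed

lemma abs_ribbon_eqI:
  assumes "ribbon_graph G" "ribbon_graph H" "rgraph_iso G H"
  shows "abs_ribbon G = abs_ribbon H"
  using assms Quotient3_rel_abs[OF Quotient3_ribbon, of G H] by blast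

lemma cls_eqI:
  assumes "ribbon_graph G" "ribbon_graph H" "rgraph_iso G H"
  shows "cls G = cls H"
proof -
  obtain G' :: "nat rgraph" where G': "ribbon_graph G'" "rgraph_iso G G'" "cls G = abs_ribbon G'"
    using cls_some[OF assms(1)] by blast
  obtain H' :: "nat rgraph" where H': "ribbon_graph H'" "rgraph_iso H H'" "cls H = abs_ribbon H'"
    using cls_some[OF assms(2)] by blast
  have "rgraph_iso G' H'"
    by (rule rgraph_iso_trans[OF rgraph_iso_trans[OF rgraph_iso_sym[OF G'(2) assms(1)] assms(3)] H'(2)])
  then show ?thesis using abs_ribbon_eqI G' H' by metis
qed

lemma cls_nat: "ribbon_graph G \<Longrightarrow> cls G = abs_ribbon G"
  using cls_some[of G] abs_ribbon_eqI[of G] by metis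

lemma ribbon_graph_rep: "ribbon_graph (rep_ribbon A)"
  using Quotient3_rep_reflp[OF Quotient3_ribbon] by blast

lemma cls_rep: "cls (rep_ribbon A) = A"
  by (simp add: cls_nat[OF ribbon_graph_rep] Quotient3_abs_rep[OF Quotient3_ribbon])

lemma rep_cls_iso:
  assumes "ribbon_graph G"
  shows "rgraph_iso (rep_ribbon (cls G)) G"
proof -
  obtain G' :: "nat rgraph" where G': "ribbon_graph G'" "rgraph_iso G G'" "cls G = abs_ribbon G'"
    using cls_some[OF assms] by blast
  have "rgraph_iso (rep_ribbon (abs_ribbon G')) G'"
    using Quotient3_rep_abs[OF Quotient3_ribbon, of G'] G'(1) rgraph_iso_refl by blast
  then show ?thesis using rgraph_iso_trans[OF _ rgraph_iso_sym[OF G'(2) assms]] G'(3) by simp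
qed

lemma ribbon_ins_cls: "ribbon_graph G \<Longrightarrow> ribbon_ins (cls G) = ins G"
  and ribbon_outs_cls: "ribbon_graph G \<Longrightarrow> ribbon_outs (cls G) = outs G"
  using rep_cls_iso unfolding ribbon_ins_def ribbon_outs_def rgraph_iso_def by metis+

subsection \<open>Juxtaposition\<close>

abbreviation left_flag :: "'h flag \<Rightarrow> ('h + 'g) flag" where
  "left_flag \<equiv> map_flag Inl"

definition right_flag :: "'h rgraph \<Rightarrow> 'g flag \<Rightarrow> ('h + 'g) flag" where
  "right_flag G = shift_flag (ins G) (outs G) \<circ> map_flag Inr"

lemma right_flag_simps [simp]:
  "right_flag G (HalfEdge h) = HalfEdge (Inr h)"
  "right_flag G (InEnd i) = InEnd (ins G + i)"
  "right_flag G (OutEnd i) = OutEnd (outs G + i)"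
  by (simp_all add: right_flag_def)

lemma inj_left_flag: "inj_on left_flag A"
  by (intro inj_onI) (metis flag.inj_map_strong Inl_inject)

lemma inj_right_flag: "inj_on (right_flag G) A"
proof (rule inj_onI)
  fix x y assume "right_flag G x = right_flag G y"
  then show "x = y" by (cases x; cases y) auto
qed

lemma edges_juxtapose:
  "edges (juxtapose G F) = (`) left_flag ` edges G \<union> (`) (right_flag G) ` edges F"
  by (simp add: juxtapose_def right_flag_def image_comp comp_def image_image)

lemma juxtapose_simps [simp]:
  "ins (juxtapose G F) = ins G + ins F" "outs (juxtapose G F) = outs G + outs F"
  "halfs (juxtapose G F) = halfs G <+> halfs F" "nxt (juxtapose G F) = map_sum (nxt G) (nxt F)"
  "circles (juxtapose G F) = circles G + circles F"
  by (simp_all add: juxtapose_def)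

lemma image_add_lessThan_Un: "{..<m + n} = {..<m} \<union> (\<lambda>i. m + i) ` {..<n::nat}"
proof -
  have "x \<in> (\<lambda>i. m + i) ` {..<n}" if "x < m + n" "\<not> x < m" for x
    using that by (intro image_eqI[of _ _ "x - m"]) auto
  then show ?thesis by auto
qed

lemma flags_juxtapose:
  "flags (juxtapose G F) = left_flag ` flags G \<union> right_flag G ` flags F"
  by (auto simp: flags_def image_Un image_image image_add_lessThan_Un Plus_def)

lemma flags_juxtapose_disjoint: "left_flag ` flags G \<inter> right_flag G ` flags F = {}"
  by (auto simp: flags_def)

lemma ribbon_graph_juxtapose:
  assumes "ribbon_graph G" "ribbon_graph F"
  shows "ribbon_graph (juxtapose G F)"
  unfolding ribbon_graph_def
proof (intro conjI ballI)
  note G = ribbon_graphD[OF assms(1)] and F = ribbon_graphD[OF assms(2)]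
  show "finite (halfs (juxtapose G F))" using G(1) F(1) by simp
  show "nxt (juxtapose G F) permutes halfs (juxtapose G F)"
    using permutes_map_sum[OF G(2) F(2)] by simp
  show "partition_on (flags (juxtapose G F)) (edges (juxtapose G F))"
    unfolding flags_juxtapose edges_juxtapose
    by (intro partition_on_Un_disjoint flags_juxtapose_disjoint partition_on_image
        G(3) F(3) inj_left_flag inj_right_flag)
  show "card e = 2" if "e \<in> edges (juxtapose G F)" for e
    using that G(4) F(4) by (auto simp: edges_juxtapose card_image inj_left_flag inj_right_flag)
qed

lemma image_map_sum_Plus: "map_sum f g ` (A <+> B) = f ` A <+> g ` B"
  by (simp add: Plus_def image_Un image_image)

lemma inj_on_map_sum_Plus:
  assumes "inj_on f A" "inj_on g B"
  shows "inj_on (map_sum f g) (A <+> B)"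
proof (rule inj_onI)
  fix x y assume "x \<in> A <+> B" "y \<in> A <+> B" "map_sum f g x = map_sum f g y"
  then show "x = y" using assms[THEN inj_onD] by (cases x; cases y) auto
qed

lemma bij_betw_map_sum:
  assumes "bij_betw f A A'" "bij_betw g B B'"
  shows "bij_betw (map_sum f g) (A <+> B) (A' <+> B')"
  using assms by (simp add: bij_betw_def inj_on_map_sum_Plus image_map_sum_Plus)

lemma juxtapose_iso:
  assumes "rgraph_iso G G'" "rgraph_iso F F'"
  shows "rgraph_iso (juxtapose G F) (juxtapose G' F')"
proof -
  obtain \<phi> where \<phi>: "bij_betw \<phi> (halfs G) (halfs G')" "\<forall>h\<in>halfs G. \<phi> (nxt G h) = nxt G' (\<phi> h)"
    "edges G' = (`) (map_flag \<phi>) ` edges G" "ins G = ins G'" "outs G = outs G'" "circles G = circles G'"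
    using assms(1) by (rule rgraph_isoE)
  obtain \<psi> where \<psi>: "bij_betw \<psi> (halfs F) (halfs F')" "\<forall>h\<in>halfs F. \<psi> (nxt F h) = nxt F' (\<psi> h)"
    "edges F' = (`) (map_flag \<psi>) ` edges F" "ins F = ins F'" "outs F = outs F'" "circles F = circles F'"
    using assms(2) by (rule rgraph_isoE)
  have l: "left_flag (map_flag \<phi> x) = map_flag (map_sum \<phi> \<psi>) (left_flag x)" for x
    by (cases x) auto
  have r: "right_flag G' (map_flag \<psi> x) = map_flag (map_sum \<phi> \<psi>) (right_flag G x)" for x
    using \<phi>(4,5) by (cases x) auto
  show ?thesis
  proof (rule rgraph_isoI)
    show "bij_betw (map_sum \<phi> \<psi>) (halfs (juxtapose G F)) (halfs (juxtapose G' F'))"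
      using bij_betw_map_sum[OF \<phi>(1) \<psi>(1)] by simp
    show "edges (juxtapose G' F') = (`) (map_flag (map_sum \<phi> \<psi>)) ` edges (juxtapose G F)"
      unfolding edges_juxtapose \<phi>(3) \<psi>(3) image_Un image_image l r ..
  qed (use \<phi> \<psi> in auto)
qed

lemma cls_juxtapose:
  assumes "ribbon_graph G" "ribbon_graph F"
  shows "ribbon_tensor (cls G) (cls F) = cls (juxtapose G F)"
proof -
  let ?J = "juxtapose (rep_ribbon (cls G)) (rep_ribbon (cls F))"
  have J: "ribbon_graph ?J" by (intro ribbon_graph_juxtapose ribbon_graph_rep)
  note R = ribbon_graph_relabel[OF J bij_sum_encode]
  have "ribbon_tensor (cls G) (cls F) = cls (relabel sum_encode ?J)"
    unfolding ribbon_tensor_def using cls_nat[OF R(1)] by simp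
  also have "\<dots> = cls ?J" using cls_eqI[OF J R(1) R(2)] by simp
  also have "\<dots> = cls (juxtapose G F)"
    by (intro cls_eqI J ribbon_graph_juxtapose assms juxtapose_iso rep_cls_iso)
  finally show ?thesis .
qed

subsection \<open>Gluing\<close>

abbreviation sum_edges :: "'h rgraph \<Rightarrow> 'g rgraph \<Rightarrow> ('h flag + 'g flag) set set" where
  "sum_edges G F \<equiv> (`) Inl ` edges G \<union> (`) Inr ` edges F"

abbreviation out_glued :: "nat \<Rightarrow> 'h flag + 'g flag" where
  "out_glued i \<equiv> Inr (OutEnd i)"

abbreviation in_glued :: "nat \<Rightarrow> 'h flag + 'g flag" where
  "in_glued i \<equiv> Inl (InEnd i)"

definition unglued :: "'h rgraph \<Rightarrow> 'g rgraph \<Rightarrow> ('h flag + 'g flag) set" where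
  "unglued G F = outer (flags G <+> flags F) out_glued in_glued {..<outs F}"

lemma chains_eq:
  "chains G F = (flags G <+> flags F) // (chain_rel (sum_edges G F) out_glued in_glued {..<outs F})\<^sup>*"
proof -
  have "glue_rel G F = chain_rel (sum_edges G F) out_glued in_glued {..<outs F}"
    unfolding glue_rel_def chain_rel_def by (auto; blast)
  then show ?thesis unfolding chains_def by simp
qed

lemma chain_system_glue:
  assumes "ribbon_graph G" "ribbon_graph F" "ins G = outs F"
  shows "chain_system (flags G <+> flags F) (sum_edges G F) out_glued in_glued {..<outs F}"
  unfolding chain_system_def
proof (intro conjI)
  note G = ribbon_graphD[OF assms(1)] and F = ribbon_graphD[OF assms(2)]
  show "finite (flags G <+> flags F)" using G(6) F(6) by simp
  show "partition_on (flags G <+> flags F) (sum_edges G F)"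
    unfolding Plus_def
    by (intro partition_on_Un_disjoint partition_on_image G(3) F(3)) auto
  show "\<forall>e\<in>sum_edges G F. card e = 2" using G(4) F(4) by (auto simp: card_image)
  show "out_glued ` {..<outs F} \<union> in_glued ` {..<outs F} \<subseteq> flags G <+> flags F"
    using assms(3) by (auto simp: flags_def)
qed (auto simp: inj_on_def)

lemma chain_ends_eq:
  assumes "c \<subseteq> flags G <+> flags F" "ins G = outs F"
  shows "chain_ends c = (the \<circ> outer_flag) ` (c \<inter> unglued G F)"
proof -
  have "x \<in> unglued G F \<longleftrightarrow> outer_flag x \<noteq> None" if "x \<in> c" for x
    using that assms by (cases x rule: outer_flag.cases) (auto simp: unglued_def outer_def flags_def)
  then show ?thesis
    unfolding chain_ends_def Option.these_def by (force simp: image_iff)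
qed

lemma unglued_eq:
  assumes "ins G = outs F"
  shows "unglued G F = Inl ` (HalfEdge ` halfs G \<union> OutEnd ` {..<outs G}) \<union>
    Inr ` (HalfEdge ` halfs F \<union> InEnd ` {..<ins F})"
  using assms unfolding unglued_def outer_def flags_def by auto

lemma inj_outer_flag:
  assumes "ins G = outs F"
  shows "inj_on (the \<circ> outer_flag) (unglued G F)"
  unfolding unglued_eq[OF assms] by (rule inj_onI) auto

lemma glue_simps [simp]:
  "ins (glue G F) = ins F" "outs (glue G F) = outs G"
  "halfs (glue G F) = halfs G <+> halfs F" "nxt (glue G F) = map_sum (nxt G) (nxt F)"
  by (simp_all add: glue_def)

lemma flags_glue:
  assumes "ins G = outs F"
  shows "flags (glue G F) = (the \<circ> outer_flag) ` unglued G F"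
  unfolding unglued_eq[OF assms] by (auto simp: flags_def image_Un image_image Plus_def)

lemma partition_on_chains:
  assumes "ribbon_graph G" "ribbon_graph F" "ins G = outs F"
  shows "partition_on (flags G <+> flags F) (chains G F)"
  unfolding chains_eq by (rule partition_chains[OF chain_system_glue[OF assms]])

lemma chain_subset:
  assumes "ribbon_graph G" "ribbon_graph F" "ins G = outs F" "c \<in> chains G F"
  shows "c \<subseteq> flags G <+> flags F"
  using partition_on_chains[OF assms(1-3)] assms(4) unfolding partition_on_def by blast

text \<open>
  Only the combinatorial half of \<open>chain_state_sum\<close> matters here, so it is applied to the constant
  form 1 on a one-point set.
\<close>
lemma card_chain_unglued:
  assumes "ribbon_graph G" "ribbon_graph F" "ins G = outs F" "c \<in> chains G F"
  shows "c \<inter> unglued G F = {} \<or> card (c \<inter> unglued G F) = 2"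
proof -
  from chain_state_sum[OF chain_system_glue[OF assms(1-3)], where b = "\<lambda>_ _. 1::int" and D = "{()}" and d = id]
  show ?thesis using assms(4) unfolding chains_eq unglued_def by simp
qed

lemma chain_ends_chain:
  assumes "ribbon_graph G" "ribbon_graph F" "ins G = outs F" "c \<in> chains G F"
  shows "chain_ends c = (the \<circ> outer_flag) ` (c \<inter> unglued G F)"
  using chain_ends_eq[OF chain_subset[OF assms] assms(3)] .

lemma edges_glue:
  assumes "ribbon_graph G" "ribbon_graph F" "ins G = outs F"
  shows "edges (glue G F) = (\<lambda>c. (the \<circ> outer_flag) ` (c \<inter> unglued G F)) ` {c \<in> chains G F. c \<inter> unglued G F \<noteq> {}}"
  using chain_ends_chain[OF assms] unfolding glue_def by (auto 0 3 simp: image_iff)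

lemma circles_glue:
  assumes "ribbon_graph G" "ribbon_graph F" "ins G = outs F"
  shows "circles (glue G F) = circles G + circles F + card {c \<in> chains G F. c \<inter> unglued G F = {}}"
proof -
  have "{c \<in> chains G F. chain_ends c = {}} = {c \<in> chains G F. c \<inter> unglued G F = {}}"
    using chain_ends_chain[OF assms] by auto
  then show ?thesis by (simp add: glue_def)
qed

lemma inj_on_open_chains:
  assumes "ribbon_graph G" "ribbon_graph F" "ins G = outs F"
  shows "inj_on (\<lambda>c. (the \<circ> outer_flag) ` (c \<inter> unglued G F)) {c \<in> chains G F. c \<inter> unglued G F \<noteq> {}}"
proof (rule inj_onI)
  fix c c'
  assume c: "c \<in> {c \<in> chains G F. c \<inter> unglued G F \<noteq> {}}"
    and c': "c' \<in> {c \<in> chains G F. c \<inter> unglued G F \<noteq> {}}"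
    and eq: "(the \<circ> outer_flag) ` (c \<inter> unglued G F) = (the \<circ> outer_flag) ` (c' \<inter> unglued G F)"
  have "c \<inter> unglued G F = c' \<inter> unglued G F"
    using eq by (simp only: inj_on_image_eq_iff[OF inj_outer_flag[OF assms(3)] Int_lower2 Int_lower2])
  then obtain x where x: "x \<in> c" "x \<in> c'" using c by blast
  show "c = c'" by (rule edge_eqI[OF partition_on_chains[OF assms] _ _ x]) (use c c' in simp_all)
qed

lemma ribbon_graph_glue:
  assumes "ribbon_graph G" "ribbon_graph F" "ins G = outs F"
  shows "ribbon_graph (glue G F)"
  unfolding ribbon_graph_def
proof (intro conjI ballI)
  note G = ribbon_graphD[OF assms(1)] and F = ribbon_graphD[OF assms(2)]
  show "finite (halfs (glue G F))" using G(1) F(1) by simp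
  show "nxt (glue G F) permutes halfs (glue G F)"
    using permutes_map_sum[OF G(2) F(2)] by simp
  have "edges (glue G F) = (`) (the \<circ> outer_flag) ` ((\<inter>) (unglued G F) ` chains G F - {{}})"
    unfolding edges_glue[OF assms] by (auto simp: Int_commute)
  moreover have "unglued G F \<inter> (flags G <+> flags F) = unglued G F"
    unfolding unglued_def outer_def by blast
  ultimately show "partition_on (flags (glue G F)) (edges (glue G F))"
    unfolding flags_glue[OF assms(3)]
    using partition_on_image[OF _ inj_outer_flag[OF assms(3)]] partition_on_restrict[OF partition_on_chains[OF assms], of "unglued G F"]
    by simp
  fix e assume "e \<in> edges (glue G F)"
  then obtain c where c: "c \<in> chains G F" "c \<inter> unglued G F \<noteq> {}"
      and e: "e = (the \<circ> outer_flag) ` (c \<inter> unglued G F)"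
    unfolding edges_glue[OF assms] by blast
  have "card e = card (c \<inter> unglued G F)"
    unfolding e by (rule card_image[OF inj_on_subset[OF inj_outer_flag[OF assms(3)] Int_lower2]])
  then show "card e = 2" using card_chain_unglued[OF assms c(1)] c(2) by simp
qed

lemma rtrancl_map_prod:
  assumes "(x, y) \<in> R\<^sup>*" "map_prod f f ` R \<subseteq> S"
  shows "(f x, f y) \<in> S\<^sup>*"
  using assms(1)
proof induction
  case (step y z)
  then have "(f y, f z) \<in> S" using assms(2) by force
  then show ?case using step by simp
qed simp

lemma quotient_rtrancl_image:
  assumes R: "sym R" "R \<subseteq> X \<times> X" and f: "inj_on f X"
  shows "f ` X // (map_prod f f ` R)\<^sup>* = (`) f ` (X // R\<^sup>*)"
proof (rule quotient_rtrancl_eqI)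
  have p: "partition_on X (X // R\<^sup>*)" by (rule partition_quotient_rtrancl[OF R])
  then show "partition_on (f ` X) ((`) f ` (X // R\<^sup>*))" using f by (rule partition_on_image)
  show "y \<in> c" if c: "c \<in> (`) f ` (X // R\<^sup>*)" "x \<in> c" "(x, y) \<in> map_prod f f ` R" for c x y
  proof -
    obtain u where u: "u \<in> X" "c = f ` (R\<^sup>* `` {u})" using c(1) by (elim imageE quotientE) simp
    obtain v where v: "(u, v) \<in> R\<^sup>*" "x = f v" using c(2) unfolding u by auto
    obtain v' w where w: "(v', w) \<in> R" "x = f v'" "y = f w" using c(3) by auto
    have "v \<in> X" using v(1) u(1) R(2) by (induction) auto
    then have "v = v'" using w v(2) R(2) f by (auto simp: inj_on_def)
    then have "(u, w) \<in> R\<^sup>*" using v w by auto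
    then show ?thesis using u w by auto
  qed
  show "\<exists>r. \<forall>y\<in>c. (r, y) \<in> (map_prod f f ` R)\<^sup>*" if c: "c \<in> (`) f ` (X // R\<^sup>*)" for c
  proof -
    obtain u where u: "u \<in> X" "c = f ` (R\<^sup>* `` {u})" using c by (elim imageE quotientE) simp
    then have "\<forall>y\<in>c. (f u, y) \<in> (map_prod f f ` R)\<^sup>*" using rtrancl_map_prod[OF _ subset_refl] by auto
    then show ?thesis by blast
  qed
  show "sym (map_prod f f ` R)" using R(1) unfolding sym_def by auto
qed

lemma image_flags_iso:
  assumes "\<phi> ` halfs G = halfs G'" "ins G = ins G'" "outs G = outs G'"
  shows "map_flag \<phi> ` flags G = flags G'"
  unfolding flags_def assms(1)[symmetric] assms(2,3)[symmetric]
  by (auto simp: image_Un image_image)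

lemma map_prod_link:
  "map_prod f f ` {(x, y). \<exists>e\<in>E. x \<in> e \<and> y \<in> e} = {(x, y). \<exists>e\<in>(`) f ` E. x \<in> e \<and> y \<in> e}"
  by (auto simp: image_iff) blast?

text \<open>
  The composition of classes is computed on representatives. It is well defined because
  isomorphisms of the two factors induce a bijection between their flags which carries the gluing
  relation of one pair to that of the other, hence chains to chains.
\<close>
lemma glue_iso:
  assumes "rgraph_iso G G'" "rgraph_iso F F'" and rg: "ribbon_graph G" "ribbon_graph F" "ins G = outs F"
  shows "rgraph_iso (glue G F) (glue G' F')"
proof -
  obtain \<phi> where \<phi>: "bij_betw \<phi> (halfs G) (halfs G')" "\<forall>h\<in>halfs G. \<phi> (nxt G h) = nxt G' (\<phi> h)"
    "edges G' = (`) (map_flag \<phi>) ` edges G" "ins G = ins G'" "outs G = outs G'" "circles G = circles G'"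
    using assms(1) by (rule rgraph_isoE)
  obtain \<psi> where \<psi>: "bij_betw \<psi> (halfs F) (halfs F')" "\<forall>h\<in>halfs F. \<psi> (nxt F h) = nxt F' (\<psi> h)"
    "edges F' = (`) (map_flag \<psi>) ` edges F" "ins F = ins F'" "outs F = outs F'" "circles F = circles F'"
    using assms(2) by (rule rgraph_isoE)
  let ?f = "map_sum (map_flag \<phi>) (map_flag \<psi>)"
  let ?R = "chain_rel (sum_edges G F) out_glued in_glued {..<outs F}"
  let ?R' = "chain_rel (sum_edges G' F') out_glued in_glued {..<outs F'}"
  have X: "flags G' <+> flags F' = ?f ` (flags G <+> flags F)"
    unfolding image_map_sum_Plus
    using image_flags_iso[of \<phi> G G'] image_flags_iso[of \<psi> F F'] \<phi> \<psi> by (simp add: bij_betw_def)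
  have inj: "inj_on ?f (flags G <+> flags F)"
    by (intro inj_on_map_sum_Plus inj_map_flag bij_betw_imp_inj_on[OF \<phi>(1)] bij_betw_imp_inj_on[OF \<psi>(1)])
  have E: "sum_edges G' F' = (`) ?f ` sum_edges G F"
    unfolding \<phi>(3) \<psi>(3) by (simp add: image_Un image_image)
  have R: "?R' = map_prod ?f ?f ` ?R"
  proof -
    have "map_prod ?f ?f ` {(out_glued i, in_glued i) | i. i \<in> {..<outs F}} = {(out_glued i, in_glued i) | i. i \<in> {..<outs F}}"
      "map_prod ?f ?f ` {(in_glued i, out_glued i) | i. i \<in> {..<outs F}} = {(in_glued i, out_glued i) | i. i \<in> {..<outs F}}"
      by (force simp: image_iff)+
    then show ?thesis unfolding chain_rel_def E image_Un map_prod_link \<psi>(5) by simp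
  qed
  have C: "chains G' F' = (`) ?f ` chains G F"
    unfolding chains_eq X R
    by (rule quotient_rtrancl_image[OF sym_chain_rel chain_rel_subset[OF chain_system_glue[OF rg]] inj])
  have of: "outer_flag (?f x) = map_option (map_flag (map_sum \<phi> \<psi>)) (outer_flag x)" for x
    by (cases x rule: outer_flag.cases) auto
  have ends: "chain_ends (?f ` c) = map_flag (map_sum \<phi> \<psi>) ` chain_ends c" for c
    unfolding chain_ends_def Option.these_def image_image of by (force simp: image_iff)
  have inj_C: "inj_on ((`) ?f) (chains G F)"
    using chain_subset[OF rg] inj by (meson inj_on_image_eq_iff inj_onI)
  show ?thesis
  proof (rule rgraph_isoI)
    show "bij_betw (map_sum \<phi> \<psi>) (halfs (glue G F)) (halfs (glue G' F'))"
      using bij_betw_map_sum[OF \<phi>(1) \<psi>(1)] by simp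
    show "edges (glue G' F') = (`) (map_flag (map_sum \<phi> \<psi>)) ` edges (glue G F)"
    proof -
      have "(`) m ` (A - {{}}) = (`) m ` A - {{}}" for m :: "('a + 'c) flag \<Rightarrow> ('b + 'd) flag" and A by auto
      moreover have "chain_ends ` chains G' F' = (`) (map_flag (map_sum \<phi> \<psi>)) ` chain_ends ` chains G F"
        by (simp add: C image_image ends)
      ultimately show ?thesis by (simp add: glue_def)
    qed
    have "{c \<in> chains G' F'. chain_ends c = {}} = (`) ?f ` {c \<in> chains G F. chain_ends c = {}}"
      unfolding C by (auto simp: ends)
    then have "card {c \<in> chains G' F'. chain_ends c = {}} = card {c \<in> chains G F. chain_ends c = {}}"
      using inj_on_subset[OF inj_C] by (simp add: card_image)
    then show "circles (glue G F) = circles (glue G' F')"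
      using \<phi>(6) \<psi>(6) by (simp add: glue_def)
  qed (use \<phi> \<psi> in auto)
qed

lemma cls_glue:
  assumes "ribbon_graph G" "ribbon_graph F" "ins G = outs F"
  shows "ribbon_comp (cls G) (cls F) = cls (glue G F)"
proof -
  let ?G = "rep_ribbon (cls G)" and ?F = "rep_ribbon (cls F)"
  have iso: "rgraph_iso ?G G" "rgraph_iso ?F F" using rep_cls_iso assms(1,2) by blast+
  then have io: "ins ?G = outs ?F" using assms(3) unfolding rgraph_iso_def by simp
  have J: "ribbon_graph (glue ?G ?F)" by (intro ribbon_graph_glue ribbon_graph_rep io)
  note R = ribbon_graph_relabel[OF J bij_sum_encode]
  have "ribbon_comp (cls G) (cls F) = cls (relabel sum_encode (glue ?G ?F))"
    unfolding ribbon_comp_def using cls_nat[OF R(1)] by simp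
  also have "\<dots> = cls (glue ?G ?F)" using cls_eqI[OF J R(1) R(2)] by simp
  also have "\<dots> = cls (glue G F)"
    by (intro cls_eqI J ribbon_graph_glue assms glue_iso iso ribbon_graph_rep io)
  finally show ?thesis .
qed

section \<open>Linear maps between tensor powers\<close>

(* tensors are functions; their sums are not to be expanded pointwise *)
declare plus_fun_apply [simp del] zero_fun_apply [simp del]

lemma linear_mapsD:
  assumes "f \<in> linear_maps sA A sB B"
  shows "x \<in> A \<Longrightarrow> f x \<in> B" "x \<in> A \<Longrightarrow> y \<in> A \<Longrightarrow> f (x + y) = f x + f y"
    "x \<in> A \<Longrightarrow> f (sA c x) = sB c (f x)" "x \<notin> A \<Longrightarrow> f x = 0"
  using assms unfolding linear_maps_def by blast+

lemma linear_maps_zero: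
  assumes "f \<in> linear_maps sA A sB B" "0 \<in> A"
  shows "f 0 = 0"
  using linear_mapsD(2)[OF assms(1) assms(2) assms(2)] by simp

lemma linear_maps_sum:
  assumes "f \<in> linear_maps sA A sB B" "0 \<in> A" "\<And>x y. x \<in> A \<Longrightarrow> y \<in> A \<Longrightarrow> x + y \<in> A"
    and "\<And>i. i \<in> I \<Longrightarrow> g i \<in> A"
  shows "f (\<Sum>i\<in>I. g i) = (\<Sum>i\<in>I. f (g i)) \<and> (\<Sum>i\<in>I. g i) \<in> A"
  using assms(4)
  by (induction I rule: infinite_finite_induct)
    (simp_all add: linear_maps_zero[OF assms(1,2)] assms(2,3) linear_mapsD(2)[OF assms(1)])

lemma pure_in_tensor_power: "length xs = p \<Longrightarrow> pure_tensor scale xs \<in> tensor_power scale p"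
  unfolding tensor_power_def by (auto intro: tensor.span_base)

lemma tensor_power_zero: "0 \<in> tensor_power scale p"
  and tensor_power_add: "t \<in> tensor_power scale p \<Longrightarrow> s \<in> tensor_power scale p \<Longrightarrow> t + s \<in> tensor_power scale p"
  and tensor_power_scale: "t \<in> tensor_power scale p \<Longrightarrow> tensor_scale c t \<in> tensor_power scale p"
  and tensor_power_sum: "(\<And>i. i \<in> I \<Longrightarrow> g i \<in> tensor_power scale p) \<Longrightarrow> (\<Sum>i\<in>I. g i) \<in> tensor_power scale p"
  unfolding tensor_power_def
  by (rule tensor.span_zero tensor.span_add tensor.span_scale tensor.span_sum; assumption)+

lemma tensor_power_induct [consumes 1, case_names zero step]:
  assumes "t \<in> tensor_power scale p" "P 0"
    and "\<And>c xs t. length xs = p \<Longrightarrow> t \<in> tensor_power scale p \<Longrightarrow> P t \<Longrightarrow>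
      P (tensor_scale c (pure_tensor scale xs) + t)"
  shows "P t"
proof -
  have "t \<in> tensor_power scale p \<and> P t"
    using assms(1) unfolding tensor_power_def
  proof (induction rule: tensor.span_induct_alt)
    case base
    then show ?case using assms(2) by (simp add: tensor.span_zero)
  next
    case (step c x y)
    then obtain xs where "x = pure_tensor scale xs" "length xs = p" by blast
    then show ?case
      using step assms(3)[of xs y c] by (auto simp: tensor_power_def intro: tensor.span_add tensor.span_scale tensor.span_base)
  qed
  then show ?thesis ..
qed

lemma linear_maps_tensor_sum:
  assumes "f \<in> linear_maps tensor_scale (tensor_power scale p) sB B"
    and "\<And>i. i \<in> I \<Longrightarrow> g i \<in> tensor_power scale p"
  shows "f (\<Sum>i\<in>I. tensor_scale (c i) (g i)) = (\<Sum>i\<in>I. sB (c i) (f (g i)))"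
  using linear_maps_sum[OF assms(1) tensor_power_zero tensor_power_add, of I "\<lambda>i. tensor_scale (c i) (g i)"]
    assms(2) linear_mapsD(3)[OF assms(1)] by (simp add: tensor_power_scale)

lemma tensor_map_eqI:
  assumes f: "f \<in> linear_maps tensor_scale (tensor_power scale p) sB B"
    and g: "g \<in> linear_maps tensor_scale (tensor_power scale p) sB B'"
    and eq: "\<And>xs. length xs = p \<Longrightarrow> f (pure_tensor scale xs) = g (pure_tensor scale xs)"
  shows "f = g"
proof
  fix t
  show "f t = g t"
  proof (cases "t \<in> tensor_power scale p")
    case True
    then show ?thesis
    proof (induction rule: tensor_power_induct)
      case zero
      show ?case using linear_maps_zero[OF f tensor_power_zero] linear_maps_zero[OF g tensor_power_zero] by simp
    next
      case (step c xs t)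
      have p: "pure_tensor scale xs \<in> tensor_power scale p" using step(1) by (rule pure_in_tensor_power)
      show ?case
        using eq[OF step(1)] step(3)
          linear_mapsD(2)[OF f tensor_power_scale[OF p] step(2)] linear_mapsD(3)[OF f p]
          linear_mapsD(2)[OF g tensor_power_scale[OF p] step(2)] linear_mapsD(3)[OF g p]
        by simp
    qed
  next
    case False
    then show ?thesis using linear_mapsD(4)[OF f] linear_mapsD(4)[OF g] by simp
  qed
qed

lemma tensor_homD:
  assumes "f \<in> tensor_hom scale p q"
  shows "t \<in> tensor_power scale p \<Longrightarrow> f t \<in> tensor_power scale q" "f t \<in> tensor_power scale q" "f 0 = 0"
    "t \<notin> tensor_power scale p \<Longrightarrow> f t = 0"
proof -
  note f = assms[unfolded tensor_hom_def]
  show "t \<in> tensor_power scale p \<Longrightarrow> f t \<in> tensor_power scale q"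
    "t \<notin> tensor_power scale p \<Longrightarrow> f t = 0"
    using linear_mapsD[OF f] by auto
  then show "f t \<in> tensor_power scale q" using tensor_power_zero by (cases "t \<in> tensor_power scale p") auto
  show "f 0 = 0" by (rule linear_maps_zero[OF f tensor_power_zero])
qed

text \<open>
  Arbitrary functionals on forms need not be linear, but those in the span of the evaluations are,
  at least on multilinear forms. This is what makes \<open>tensor_mult\<close> linear in its second factor.
\<close>
lemma tensor_eval_linear:
  assumes "s \<in> tensor_power scale q" "multilinear_form scale M" "multilinear_form scale N"
  shows "s (\<lambda>x. M x + N x) = s M + s N" "s (\<lambda>x. c * M x) = c * s M"
proof -
  have ml: "multilinear_form scale (\<lambda>x. M x + N x)" "multilinear_form scale (\<lambda>x. c * M x)"
    using assms(2,3) unfolding multilinear_form_def by (auto simp: algebra_simps)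
  show "s (\<lambda>x. M x + N x) = s M + s N"
    using assms(1) by (induction rule: tensor_power_induct)
      (auto simp: tensor_scale_def pure_tensor_def assms ml algebra_simps plus_fun_apply zero_fun_apply)
  show "s (\<lambda>x. c * M x) = c * s M"
    using assms(1) by (induction rule: tensor_power_induct)
      (auto simp: tensor_scale_def pure_tensor_def assms ml algebra_simps plus_fun_apply zero_fun_apply)
qed

lemma multilinear_form_append:
  assumes "multilinear_form scale M"
  shows "multilinear_form scale (\<lambda>ys. M (us @ ys))" "multilinear_form scale (\<lambda>ys. M (ys @ us))"
proof -
  show "multilinear_form scale (\<lambda>ys. M (us @ ys))"
    using assms unfolding multilinear_form_def by (metis append.assoc)
  show "multilinear_form scale (\<lambda>ys. M (ys @ us))"
    using assms unfolding multilinear_form_def by simp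
qed

lemma tensor_mult_pure_left:
  assumes "s \<in> tensor_power scale q"
  shows "tensor_mult scale (pure_tensor scale xs) s =
    (\<lambda>M. if multilinear_form scale M then s (\<lambda>ys. M (xs @ ys)) else 0)"
proof -
  have "multilinear_form scale (\<lambda>us. s (\<lambda>ys. M (us @ ys)))" if M: "multilinear_form scale M" for M
    unfolding multilinear_form_def
  proof (intro conjI allI)
    fix us x y vs c
    have ml: "multilinear_form scale (\<lambda>ys. M ((us @ [x] @ vs) @ ys))"
      "multilinear_form scale (\<lambda>ys. M ((us @ [y] @ vs) @ ys))"
      using multilinear_form_append(1)[OF M] by blast+
    show "s (\<lambda>ys. M ((us @ [x + y] @ vs) @ ys)) =
      s (\<lambda>ys. M ((us @ [x] @ vs) @ ys)) + s (\<lambda>ys. M ((us @ [y] @ vs) @ ys))"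
      unfolding tensor_eval_linear(1)[OF assms ml, symmetric]
      using M unfolding multilinear_form_def by simp
    show "s (\<lambda>ys. M ((us @ [scale c x] @ vs) @ ys)) = c * s (\<lambda>ys. M ((us @ [x] @ vs) @ ys))"
      unfolding tensor_eval_linear(2)[OF assms ml(1) ml(1), symmetric]
      using M unfolding multilinear_form_def by simp
  qed
  then show ?thesis unfolding tensor_mult_def pure_tensor_def by auto
qed

lemma tensor_mult_left:
  "tensor_mult scale (t + t') s = tensor_mult scale t s + tensor_mult scale t' s"
  "tensor_mult scale (tensor_scale c t) s = tensor_scale c (tensor_mult scale t s)"
  "tensor_mult scale 0 s = 0"
  by (auto simp: tensor_mult_def tensor_scale_def fun_eq_iff plus_fun_apply zero_fun_apply)

lemma tensor_mult_right:
  assumes "t \<in> tensor_power scale p" "s \<in> tensor_power scale q" "s' \<in> tensor_power scale q"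
  shows "tensor_mult scale t (s + s') = tensor_mult scale t s + tensor_mult scale t s'"
    "tensor_mult scale t (tensor_scale c s) = tensor_scale c (tensor_mult scale t s)"
proof -
  have 1: "tensor_mult scale (pure_tensor scale xs) (s + s') =
      tensor_mult scale (pure_tensor scale xs) s + tensor_mult scale (pure_tensor scale xs) s'" for xs
    unfolding tensor_mult_pure_left[OF assms(2)] tensor_mult_pure_left[OF assms(3)]
      tensor_mult_pure_left[OF tensor_power_add[OF assms(2,3)]]
    by (auto simp: fun_eq_iff plus_fun_apply)
  have 2: "tensor_mult scale (pure_tensor scale xs) (tensor_scale c s) =
      tensor_scale c (tensor_mult scale (pure_tensor scale xs) s)" for xs
    unfolding tensor_mult_pure_left[OF assms(2)] tensor_mult_pure_left[OF tensor_power_scale[OF assms(2)]]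
    by (auto simp: tensor_scale_def fun_eq_iff)
  show "tensor_mult scale t (s + s') = tensor_mult scale t s + tensor_mult scale t s'"
    using assms(1)
    by (induction rule: tensor_power_induct) (simp_all add: tensor_mult_left 1 tensor.scale_right_distrib)
  show "tensor_mult scale t (tensor_scale c s) = tensor_scale c (tensor_mult scale t s)"
    using assms(1)
    by (induction rule: tensor_power_induct)
      (simp_all add: tensor_mult_left 2 tensor.scale_right_distrib tensor.scale_left_commute)
qed

lemma tensor_mult_zero_right:
  assumes "t \<in> tensor_power scale p"
  shows "tensor_mult scale t 0 = 0"
  using tensor_mult_right(1)[OF assms tensor_power_zero tensor_power_zero] by simp

lemma tensor_mult_sum:
  assumes "\<And>i. i \<in> I \<Longrightarrow> t i \<in> tensor_power scale p" "\<And>j. j \<in> J \<Longrightarrow> s j \<in> tensor_power scale q"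
  shows "tensor_mult scale (\<Sum>i\<in>I. tensor_scale (c i) (t i)) (\<Sum>j\<in>J. tensor_scale (c' j) (s j)) =
    (\<Sum>i\<in>I. \<Sum>j\<in>J. tensor_scale (c i * c' j) (tensor_mult scale (t i) (s j)))"
proof -
  have r: "tensor_mult scale t' (\<Sum>j\<in>J. tensor_scale (c' j) (s j)) =
      (\<Sum>j\<in>J. tensor_scale (c' j) (tensor_mult scale t' (s j)))"
    if t': "t' \<in> tensor_power scale p" for t'
    using assms(2)
  proof (induction J rule: infinite_finite_induct)
    case (insert j J)
    have "(\<Sum>j\<in>J. tensor_scale (c' j) (s j)) \<in> tensor_power scale q"
      by (intro tensor_power_sum tensor_power_scale insert.prems) simp
    then show ?case
      using insert t' by (simp add: tensor_mult_right[OF t', of _ q] tensor_power_scale)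
  qed (simp_all add: tensor_mult_zero_right[OF t'])
  have l: "tensor_mult scale (\<Sum>i\<in>I. tensor_scale (c i) (t i)) s' =
      (\<Sum>i\<in>I. tensor_scale (c i) (tensor_mult scale (t i) s'))" for s'
    by (induction I rule: infinite_finite_induct) (simp_all add: tensor_mult_left)
  show ?thesis
    unfolding l using assms(1) by (simp add: r tensor.scale_sum_right)
qed

lemma tensor_mult_in:
  assumes "t \<in> tensor_power scale p" "s \<in> tensor_power scale q"
  shows "tensor_mult scale t s \<in> tensor_power scale (p + q)"
  using assms(1)
proof (induction rule: tensor_power_induct)
  case zero
  show ?case by (simp add: tensor_mult_left tensor_power_zero)
next
  case (step c xs t)
  have "tensor_mult scale (pure_tensor scale xs) s \<in> tensor_power scale (p + q)"
    using assms(2)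
  proof (induction rule: tensor_power_induct)
    case zero
    show ?case using tensor_mult_zero_right[OF pure_in_tensor_power[OF step(1), of scale]] by (simp add: tensor_power_zero)
  next
    case (step d ys s)
    have pxs: "pure_tensor scale xs \<in> tensor_power scale p" by (rule pure_in_tensor_power) (rule \<open>length xs = p\<close>)
    have pys: "pure_tensor scale ys \<in> tensor_power scale q" using step(1) by (rule pure_in_tensor_power)
    show ?case
      using step \<open>length xs = p\<close>
      by (simp add: tensor_mult_right[OF pxs tensor_power_scale[OF pys] step(2)] tensor_mult_right(2)[OF pxs pys pys]
          tensor_mult_pure tensor_power_add tensor_power_scale pure_in_tensor_power)
  qed
  then show ?case
    using step by (simp add: tensor_mult_left tensor_power_add tensor_power_scale)
qed

text \<open>
  A tensor product of two linear maps may be recognised on pure tensors.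
\<close>
lemma tensor_bilinear_eqI:
  assumes lin: "h \<in> linear_maps tensor_scale (tensor_power scale (p + p')) tensor_scale B"
    and f: "f \<in> tensor_hom scale p q" and g: "g \<in> tensor_hom scale p' q'"
    and eq: "\<And>xs ys. length xs = p \<Longrightarrow> length ys = p' \<Longrightarrow>
      h (pure_tensor scale (xs @ ys)) = tensor_mult scale (f (pure_tensor scale xs)) (g (pure_tensor scale ys))"
    and t: "t \<in> tensor_power scale p" and s: "s \<in> tensor_power scale p'"
  shows "h (tensor_mult scale t s) = tensor_mult scale (f t) (g s)"
proof -
  note F = f[unfolded tensor_hom_def] and G = g[unfolded tensor_hom_def]
  have 1: "h (tensor_mult scale (pure_tensor scale xs) s) = tensor_mult scale (f (pure_tensor scale xs)) (g s)"
    if xs: "length xs = p" for xs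
    using s
  proof (induction rule: tensor_power_induct)
    case zero
    have "f (pure_tensor scale xs) \<in> tensor_power scale q" by (rule tensor_homD(2)[OF f])
    then show ?case
      using linear_maps_zero[OF lin tensor_power_zero] tensor_homD(3)[OF g]
        tensor_mult_zero_right[OF pure_in_tensor_power[OF xs, of scale]] by (simp add: tensor_mult_zero_right)
  next
    case (step c ys s)
    have px: "pure_tensor scale xs \<in> tensor_power scale p" using xs by (rule pure_in_tensor_power)
    have py: "pure_tensor scale ys \<in> tensor_power scale p'" using step(1) by (rule pure_in_tensor_power)
    have pxy: "pure_tensor scale (xs @ ys) \<in> tensor_power scale (p + p')" using step(1) xs by (simp add: pure_in_tensor_power)
    have "tensor_mult scale (pure_tensor scale xs) (tensor_scale c (pure_tensor scale ys) + s) =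
        tensor_scale c (pure_tensor scale (xs @ ys)) + tensor_mult scale (pure_tensor scale xs) s"
      by (simp add: tensor_mult_right[OF px tensor_power_scale[OF py] step(2)] tensor_mult_right(2)[OF px py py] tensor_mult_pure)
    then have "h (tensor_mult scale (pure_tensor scale xs) (tensor_scale c (pure_tensor scale ys) + s)) =
        tensor_scale c (h (pure_tensor scale (xs @ ys))) + h (tensor_mult scale (pure_tensor scale xs) s)"
      using linear_mapsD(2)[OF lin tensor_power_scale[OF pxy] tensor_mult_in[OF px step(2)]] linear_mapsD(3)[OF lin pxy]
      by simp
    moreover have "g (tensor_scale c (pure_tensor scale ys) + s) = tensor_scale c (g (pure_tensor scale ys)) + g s"
      using linear_mapsD(2)[OF G tensor_power_scale[OF py] step(2)] linear_mapsD(3)[OF G py] by simp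
    ultimately show ?case
      using step(3) eq[OF xs step(1)]
        tensor_mult_right(1)[OF tensor_homD(2)[OF f] tensor_power_scale[OF tensor_homD(2)[OF g]] tensor_homD(2)[OF g]]
        tensor_mult_right(2)[OF tensor_homD(2)[OF f] tensor_homD(2)[OF g] tensor_homD(2)[OF g]]
      by simp
  qed
  show ?thesis
    using t
  proof (induction rule: tensor_power_induct)
    case zero
    show ?case
      using linear_maps_zero[OF lin tensor_power_zero] tensor_homD(3)[OF f] by (simp add: tensor_mult_left)
  next
    case (step c xs t)
    have px: "pure_tensor scale xs \<in> tensor_power scale p" using step(1) by (rule pure_in_tensor_power)
    have "h (tensor_mult scale (tensor_scale c (pure_tensor scale xs) + t) s) =
        tensor_scale c (h (tensor_mult scale (pure_tensor scale xs) s)) + h (tensor_mult scale t s)"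
      using linear_mapsD(2)[OF lin tensor_power_scale[OF tensor_mult_in[OF px s]] tensor_mult_in[OF step(2) s]]
        linear_mapsD(3)[OF lin tensor_mult_in[OF px s]]
      by (simp add: tensor_mult_left)
    moreover have "f (tensor_scale c (pure_tensor scale xs) + t) = tensor_scale c (f (pure_tensor scale xs)) + f t"
      using linear_mapsD(2)[OF F tensor_power_scale[OF px] step(2)] linear_mapsD(3)[OF F px] by simp
    ultimately show ?case using 1[OF step(1)] step(3) by (simp add: tensor_mult_left)
  qed
qed

section \<open>Actions of the PROP as families indexed by graphs\<close>

lemma prop_R_singleI: "ribbon_ins A = p \<Longrightarrow> ribbon_outs A = q \<Longrightarrow> Poly_Mapping.single A c \<in> prop_R p q"
  unfolding prop_R_def by simp

lemma prop_R_zero: "0 \<in> prop_R p q" unfolding prop_R_def by simp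

lemma prop_R_add: "f \<in> prop_R p q \<Longrightarrow> g \<in> prop_R p q \<Longrightarrow> f + g \<in> prop_R p q"
  unfolding prop_R_def using Poly_Mapping.keys_add[of f g] by blast

lemma lookup_prop_scale: "Poly_Mapping.lookup (prop_scale c f) A = c * Poly_Mapping.lookup f A"
  unfolding prop_scale_def by (simp add: map.rep_eq when_def)

lemma keys_prop_scale: "Poly_Mapping.keys (prop_scale c f) \<subseteq> Poly_Mapping.keys f"
  by (auto simp: in_keys_iff lookup_prop_scale)

lemma prop_scale_single: "prop_scale c (Poly_Mapping.single A d) = Poly_Mapping.single A (c * d)"
  by (rule poly_mapping_eqI) (simp add: lookup_prop_scale lookup_single when_def)

lemma prop_R_eq_sum: "f = (\<Sum>A\<in>Poly_Mapping.keys f. prop_scale (Poly_Mapping.lookup f A) (Poly_Mapping.single A (1::'k::field)))"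
  by (rule poly_mapping_eqI)
    (simp add: lookup_sum lookup_prop_scale lookup_single when_def in_keys_iff if_distrib cong: if_cong)

lemma linear_maps_prop_sum:
  assumes "Z \<in> linear_maps prop_scale (prop_R p q) sB B" and "f \<in> prop_R p q"
  shows "Z f = (\<Sum>A\<in>Poly_Mapping.keys f. sB (Poly_Mapping.lookup f A) (Z (Poly_Mapping.single A 1)))"
proof -
  have s: "Poly_Mapping.single A 1 \<in> prop_R p q" if "A \<in> Poly_Mapping.keys f" for A
    using that assms(2) unfolding prop_R_def by simp
  have ps: "prop_scale (Poly_Mapping.lookup f A) (Poly_Mapping.single A 1) \<in> prop_R p q" if "A \<in> Poly_Mapping.keys f" for A
    using that assms(2) unfolding prop_R_def by (simp add: prop_scale_single)
  have "Z (\<Sum>A\<in>Poly_Mapping.keys f. prop_scale (Poly_Mapping.lookup f A) (Poly_Mapping.single A 1)) =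
      (\<Sum>A\<in>Poly_Mapping.keys f. Z (prop_scale (Poly_Mapping.lookup f A) (Poly_Mapping.single A 1)))"
    using linear_maps_sum[OF assms(1) prop_R_zero prop_R_add,
      where I = "Poly_Mapping.keys f" and g = "\<lambda>A. prop_scale (Poly_Mapping.lookup f A) (Poly_Mapping.single A 1)"] ps
    by simp
  then show ?thesis
    using linear_mapsD(3)[OF assms(1) s] by (simp flip: prop_R_eq_sum)
qed

lemma bilinear_ext_single:
  "bilinear_ext m (Poly_Mapping.single A 1) (Poly_Mapping.single B 1) = Poly_Mapping.single (m A B) (1::'k::field)"
  unfolding bilinear_ext_def by simp

definition prop_extension ::
  "(ribbon \<Rightarrow> ('k::field, 'v) tensor \<Rightarrow> ('k, 'v) tensor) \<Rightarrow> nat \<Rightarrow> nat \<Rightarrow> (ribbon \<Rightarrow>\<^sub>0 'k) \<Rightarrow>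
   ('k, 'v) tensor \<Rightarrow> ('k, 'v) tensor" where
  "prop_extension W p q f = (if f \<in> prop_R p q
     then (\<lambda>t. \<Sum>A\<in>Poly_Mapping.keys f. tensor_scale (Poly_Mapping.lookup f A) (W A t)) else 0)"

lemma hom_scale_apply: "hom_scale c f t = tensor_scale c (f t)"
  by (simp add: hom_scale_def)

lemma sum_fun_apply: "(\<Sum>i\<in>I. f i) t = (\<Sum>i\<in>I. f i t)"
  by (induction I rule: infinite_finite_induct) (auto simp: plus_fun_apply zero_fun_apply)

locale graph_family =
  fixes scale :: "'k::field \<Rightarrow> 'v::ab_group_add \<Rightarrow> 'v" and W :: "ribbon \<Rightarrow> ('k, 'v) tensor \<Rightarrow> ('k, 'v) tensor"
  assumes W_hom: "W A \<in> tensor_hom scale (ribbon_ins A) (ribbon_outs A)"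
begin

lemma prop_extension_superset:
  assumes "f \<in> prop_R p q" "finite S" "Poly_Mapping.keys f \<subseteq> S"
  shows "prop_extension W p q f t = (\<Sum>A\<in>S. tensor_scale (Poly_Mapping.lookup f A) (W A t))"
proof -
  have "prop_extension W p q f t = (\<Sum>A\<in>Poly_Mapping.keys f. tensor_scale (Poly_Mapping.lookup f A) (W A t))"
    using assms(1) by (simp add: prop_extension_def)
  also have "\<dots> = (\<Sum>A\<in>S. tensor_scale (Poly_Mapping.lookup f A) (W A t))"
    using assms(2,3) by (intro sum.mono_neutral_left) (auto simp: in_keys_iff)
  finally show ?thesis .
qed

lemma prop_extension_hom:
  assumes "f \<in> prop_R p q"
  shows "prop_extension W p q f \<in> tensor_hom scale p q"
proof -
  have W: "W A \<in> linear_maps tensor_scale (tensor_power scale p) tensor_scale (tensor_power scale q)"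
    if "A \<in> Poly_Mapping.keys f" for A
    using W_hom[of A] that assms unfolding prop_R_def tensor_hom_def by auto
  show ?thesis
    unfolding tensor_hom_def linear_maps_def mem_Collect_eq
  proof (intro conjI ballI allI impI)
    fix t assume t: "t \<in> tensor_power scale p"
    show "prop_extension W p q f t \<in> tensor_power scale q"
      using linear_mapsD(1)[OF W t] assms unfolding prop_extension_def
      by (auto intro!: tensor_power_sum tensor_power_scale)
    show "prop_extension W p q f (t + s) = prop_extension W p q f t + prop_extension W p q f s"
      if "s \<in> tensor_power scale p" for s
      using linear_mapsD(2)[OF W t that] assms unfolding prop_extension_def
      by (simp add: tensor.scale_right_distrib sum.distrib)
    show "prop_extension W p q f (tensor_scale c t) = tensor_scale c (prop_extension W p q f t)" for c
      using linear_mapsD(3)[OF W t] assms unfolding prop_extension_def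
      by (simp add: tensor.scale_sum_right mult.commute)
  next
    fix t assume "t \<notin> tensor_power scale p"
    then show "prop_extension W p q f t = 0"
      using linear_mapsD(4)[OF W] assms unfolding prop_extension_def by simp
  qed
qed

lemma prop_extension_linear:
  "prop_extension W p q \<in> linear_maps prop_scale (prop_R p q) hom_scale (tensor_hom scale p q)"
  unfolding linear_maps_def mem_Collect_eq
proof (intro conjI ballI allI impI)
  fix f :: "ribbon \<Rightarrow>\<^sub>0 'k" assume f: "f \<in> prop_R p q"
  show "prop_extension W p q f \<in> tensor_hom scale p q" using f by (rule prop_extension_hom)
  show "prop_extension W p q (f + g) = prop_extension W p q f + prop_extension W p q g" if g: "g \<in> prop_R p q" for g
  proof
    fix t
    let ?S = "Poly_Mapping.keys f \<union> Poly_Mapping.keys g"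
    show "prop_extension W p q (f + g) t = (prop_extension W p q f + prop_extension W p q g) t"
      using prop_extension_superset[OF f, of ?S t] prop_extension_superset[OF g, of ?S t]
        prop_extension_superset[OF prop_R_add[OF f g], of ?S t] Poly_Mapping.keys_add[of f g]
      by (simp add: lookup_add tensor.scale_left_distrib sum.distrib plus_fun_apply)
  qed
  show "prop_extension W p q (prop_scale c f) = hom_scale c (prop_extension W p q f)" for c
  proof
    fix t
    have "prop_scale c f \<in> prop_R p q" using f keys_prop_scale unfolding prop_R_def by blast
    then show "prop_extension W p q (prop_scale c f) t = hom_scale c (prop_extension W p q f) t"
      using prop_extension_superset[OF f, of "Poly_Mapping.keys f" t]
        prop_extension_superset[of "prop_scale c f" p q "Poly_Mapping.keys f" t] keys_prop_scale[of c f]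
      by (simp add: lookup_prop_scale hom_scale_apply tensor.scale_sum_right)
  qed
qed (simp add: prop_extension_def)

lemma prop_extension_single:
  assumes "ribbon_ins A = p" "ribbon_outs A = q"
  shows "prop_extension W p q (Poly_Mapping.single A c) t = tensor_scale c (W A t)"
  using prop_extension_superset[OF prop_R_singleI[OF assms], of "{A}" c t] by simp

lemma prop_extension_bilinear_ext:
  assumes "\<And>A B. A \<in> Poly_Mapping.keys g \<Longrightarrow> B \<in> Poly_Mapping.keys f \<Longrightarrow> ribbon_ins (m A B) = p \<and> ribbon_outs (m A B) = q"
  shows "prop_extension W p q (bilinear_ext m g f) t =
    (\<Sum>A\<in>Poly_Mapping.keys g. \<Sum>B\<in>Poly_Mapping.keys f.
       tensor_scale (Poly_Mapping.lookup g A * Poly_Mapping.lookup f B) (W (m A B) t))"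
proof -
  note lin = linear_maps_sum[OF prop_extension_linear prop_R_zero prop_R_add]
  let ?s = "\<lambda>A B. Poly_Mapping.single (m A B) (Poly_Mapping.lookup g A * Poly_Mapping.lookup f B)"
  have s: "?s A B \<in> prop_R p q" if "A \<in> Poly_Mapping.keys g" "B \<in> Poly_Mapping.keys f" for A B
    by (rule prop_R_singleI) (use assms[OF that] in simp_all)
  have inner: "prop_extension W p q (\<Sum>B\<in>Poly_Mapping.keys f. ?s A B) =
      (\<Sum>B\<in>Poly_Mapping.keys f. prop_extension W p q (?s A B)) \<and> (\<Sum>B\<in>Poly_Mapping.keys f. ?s A B) \<in> prop_R p q"
    if "A \<in> Poly_Mapping.keys g" for A
    using lin[where I = "Poly_Mapping.keys f" and g = "?s A"] s[OF that] by blast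
  have "prop_extension W p q (bilinear_ext m g f) =
      (\<Sum>A\<in>Poly_Mapping.keys g. prop_extension W p q (\<Sum>B\<in>Poly_Mapping.keys f. ?s A B))"
    unfolding bilinear_ext_def using lin[where I = "Poly_Mapping.keys g" and g = "\<lambda>A. \<Sum>B\<in>Poly_Mapping.keys f. ?s A B"] inner by blast
  also have "\<dots> = (\<Sum>A\<in>Poly_Mapping.keys g. \<Sum>B\<in>Poly_Mapping.keys f. prop_extension W p q (?s A B))"
    using inner by simp
  finally show ?thesis
    using assms by (simp add: sum_fun_apply prop_extension_single)
qed

end

text \<open>
  Composition and tensor product of the PROP are bilinear, so an action is the same as a family of
  maps indexed by isomorphism classes that satisfies the axioms on single graphs.
\<close>
lemma R_actionI:
  fixes scale :: "'k::field \<Rightarrow> 'v::ab_group_add \<Rightarrow> 'v"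
  assumes hom: "\<And>A. W A \<in> tensor_hom scale (ribbon_ins A) (ribbon_outs A)"
    and comp: "\<And>A B. ribbon_ins A = ribbon_outs B \<Longrightarrow> W (ribbon_comp A B) = W A \<circ> W B"
    and tens: "\<And>A B t s. t \<in> tensor_power scale (ribbon_ins A) \<Longrightarrow> s \<in> tensor_power scale (ribbon_ins B) \<Longrightarrow>
      W (ribbon_tensor A B) (tensor_mult scale t s) = tensor_mult scale (W A t) (W B s)"
    and id: "\<And>p t. t \<in> tensor_power scale p \<Longrightarrow> W (abs_ribbon (id_graph p)) t = t"
    and cross: "\<And>x y. W (abs_ribbon crossing_graph) (pure_tensor scale [x, y]) = pure_tensor scale [y, x]"
  shows "R_action scale (prop_extension W)"
proof -
  interpret graph_family scale W by unfold_locales (rule hom)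
  have type_comp: "ribbon_ins (ribbon_comp A B) = ribbon_ins B \<and> ribbon_outs (ribbon_comp A B) = ribbon_outs A"
    if "ribbon_ins A = ribbon_outs B" for A B
  proof -
    have "ribbon_graph (glue (rep_ribbon A) (rep_ribbon B))"
      using that by (intro ribbon_graph_glue ribbon_graph_rep) (simp add: ribbon_ins_def ribbon_outs_def)
    moreover have "ribbon_comp A B = cls (glue (rep_ribbon A) (rep_ribbon B))"
      using cls_glue[OF ribbon_graph_rep ribbon_graph_rep, of A B] that
      by (simp add: cls_rep ribbon_ins_def ribbon_outs_def)
    ultimately show ?thesis
      using ribbon_ins_cls ribbon_outs_cls by (metis glue_simps(1,2) ribbon_ins_def ribbon_outs_def)
  qed
  have type_tens: "ribbon_ins (ribbon_tensor A B) = ribbon_ins A + ribbon_ins B \<and>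
      ribbon_outs (ribbon_tensor A B) = ribbon_outs A + ribbon_outs B" for A B
    using cls_juxtapose[OF ribbon_graph_rep ribbon_graph_rep, of A B]
      ribbon_ins_cls[OF ribbon_graph_juxtapose[OF ribbon_graph_rep ribbon_graph_rep], of A B]
      ribbon_outs_cls[OF ribbon_graph_juxtapose[OF ribbon_graph_rep ribbon_graph_rep], of A B]
    by (simp add: cls_rep) (simp add: ribbon_ins_def ribbon_outs_def)
  have W': "W A \<in> linear_maps tensor_scale (tensor_power scale (ribbon_ins A)) tensor_scale (tensor_power scale (ribbon_outs A))" for A
    using hom unfolding tensor_hom_def .
  show ?thesis
    unfolding R_action_def
  proof (intro conjI allI ballI)
    show "prop_extension W p q \<in> linear_maps prop_scale (prop_R p q) hom_scale (tensor_hom scale p q)" for p q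
      by (rule prop_extension_linear)
    show "prop_extension W p r (prop_comp g f) = prop_extension W q r g \<circ> prop_extension W p q f"
      if g: "g \<in> prop_R q r" and f: "f \<in> prop_R p q" for p q r g f
    proof
      fix t
      have A: "ribbon_ins A = q" "ribbon_outs A = r" if "A \<in> Poly_Mapping.keys g" for A
        using that g unfolding prop_R_def by auto
      have B: "ribbon_ins B = p" "ribbon_outs B = q" if "B \<in> Poly_Mapping.keys f" for B
        using that f unfolding prop_R_def by auto
      have WB: "W B t \<in> tensor_power scale q" if "B \<in> Poly_Mapping.keys f" for B
        using tensor_homD(2)[OF hom[of B], of t] B[OF that] by simp
      have "prop_extension W p r (prop_comp g f) t = (\<Sum>A\<in>Poly_Mapping.keys g. \<Sum>B\<in>Poly_Mapping.keys f.
         tensor_scale (Poly_Mapping.lookup g A * Poly_Mapping.lookup f B) (W (ribbon_comp A B) t))"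
        by (rule prop_extension_bilinear_ext) (use type_comp A B in simp)
      also have "\<dots> = (\<Sum>A\<in>Poly_Mapping.keys g. \<Sum>B\<in>Poly_Mapping.keys f.
         tensor_scale (Poly_Mapping.lookup g A) (tensor_scale (Poly_Mapping.lookup f B) (W A (W B t))))"
        using A B by (simp add: comp)
      also have "\<dots> = (\<Sum>A\<in>Poly_Mapping.keys g. tensor_scale (Poly_Mapping.lookup g A)
         (W A (\<Sum>B\<in>Poly_Mapping.keys f. tensor_scale (Poly_Mapping.lookup f B) (W B t))))"
        using linear_maps_tensor_sum[OF W', of "Poly_Mapping.keys f" "\<lambda>B. W B t"] A WB
        by (simp add: tensor.scale_sum_right)
      also have "\<dots> = (prop_extension W q r g \<circ> prop_extension W p q f) t"
        using f g by (simp add: prop_extension_def)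
      finally show "prop_extension W p r (prop_comp g f) t = (prop_extension W q r g \<circ> prop_extension W p q f) t" .
    qed
    show "prop_extension W (p + p') (q + q') (prop_tensor g f) (tensor_mult scale t s) =
        tensor_mult scale (prop_extension W p q g t) (prop_extension W p' q' f s)"
      if g: "g \<in> prop_R p q" and f: "f \<in> prop_R p' q'" and t: "t \<in> tensor_power scale p" and s: "s \<in> tensor_power scale p'"
      for p q p' q' g f t s
    proof -
      have A: "ribbon_ins A = p" "ribbon_outs A = q" if "A \<in> Poly_Mapping.keys g" for A
        using that g unfolding prop_R_def by auto
      have B: "ribbon_ins B = p'" "ribbon_outs B = q'" if "B \<in> Poly_Mapping.keys f" for B
        using that f unfolding prop_R_def by auto
      have "prop_extension W (p + p') (q + q') (prop_tensor g f) (tensor_mult scale t s) =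
        (\<Sum>A\<in>Poly_Mapping.keys g. \<Sum>B\<in>Poly_Mapping.keys f.
         tensor_scale (Poly_Mapping.lookup g A * Poly_Mapping.lookup f B) (W (ribbon_tensor A B) (tensor_mult scale t s)))"
        by (rule prop_extension_bilinear_ext) (use type_tens A B in simp)
      also have "\<dots> = (\<Sum>A\<in>Poly_Mapping.keys g. \<Sum>B\<in>Poly_Mapping.keys f.
         tensor_scale (Poly_Mapping.lookup g A * Poly_Mapping.lookup f B) (tensor_mult scale (W A t) (W B s)))"
        using A B t s by (simp add: tens)
      also have "\<dots> = tensor_mult scale (prop_extension W p q g t) (prop_extension W p' q' f s)"
      proof -
        have "W A t \<in> tensor_power scale q" if "A \<in> Poly_Mapping.keys g" for A
          using tensor_homD(2)[OF hom[of A], of t] A[OF that] by simp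
        moreover have "W B s \<in> tensor_power scale q'" if "B \<in> Poly_Mapping.keys f" for B
          using tensor_homD(2)[OF hom[of B], of s] B[OF that] by simp
        ultimately show ?thesis
          using f g tensor_mult_sum[of "Poly_Mapping.keys g" "\<lambda>A. W A t" scale q "Poly_Mapping.keys f" "\<lambda>B. W B s" q']
          by (simp add: prop_extension_def)
      qed
      finally show ?thesis .
    qed
    show "prop_extension W p p (basis_elt (id_graph p)) t = t" if "t \<in> tensor_power scale p" for p t
    proof -
      have "ribbon_ins (abs_ribbon (id_graph p)) = p" "ribbon_outs (abs_ribbon (id_graph p)) = p"
        using ribbon_ins_cls[OF ribbon_graph_id[of p]] ribbon_outs_cls[OF ribbon_graph_id[of p]]
        unfolding cls_nat[OF ribbon_graph_id] by (simp_all add: id_graph_def)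
      then show ?thesis by (simp add: basis_elt_def prop_extension_single id that)
    qed
    show "prop_extension W 2 2 (basis_elt crossing_graph) (pure_tensor scale [x, y]) = pure_tensor scale [y, x]" for x y
    proof -
      have "ribbon_ins (abs_ribbon crossing_graph) = 2" "ribbon_outs (abs_ribbon crossing_graph) = 2"
        using ribbon_ins_cls[OF ribbon_graph_crossing] ribbon_outs_cls[OF ribbon_graph_crossing]
        unfolding cls_nat[OF ribbon_graph_crossing] by (simp_all add: crossing_graph_def)
      then show ?thesis by (simp add: basis_elt_def prop_extension_single cross)
    qed
  qed
qed

section \<open>Cycles of permutations and vertices\<close>

lemma support_intertwine:
  assumes "\<And>n. (q ^^ n) (f h) = f ((p ^^ n) h)" and "\<And>n. f ((p ^^ n) h) = f h \<longleftrightarrow> (p ^^ n) h = h"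
  shows "support q (f h) = map f (support p h)"
proof -
  have "least_power q (f h) = least_power p h"
    unfolding least_power_def using assms by simp
  then show ?thesis using assms(1) by simp
qed

definition vertices :: "('h \<Rightarrow> 'h) \<Rightarrow> 'h set \<Rightarrow> 'h set set" where
  "vertices p H = (\<lambda>h. set (support p h)) ` H"

text \<open>
  The half-edges of a vertex are listed in cyclic order from an arbitrary one on; for a cyclically
  invariant \<open>M\<close> the choice has no effect (\<open>vertex_val_eq\<close>).
\<close>
definition vertex_val :: "('v list \<Rightarrow> 'k) \<Rightarrow> ('h \<Rightarrow> 'v) \<Rightarrow> ('h \<Rightarrow> 'h) \<Rightarrow> 'h set \<Rightarrow> 'k" where
  "vertex_val M a p v = M (map a (support p (SOME h. h \<in> v)))"

text \<open>
  Listing a cycle from another of its elements rotates the list; together with \<open>cyclic_rotate\<close> this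
  is where cyclic invariance makes the value of a vertex well defined.
\<close>
lemma support_in_rotate:
  assumes "permutation p" "h' \<in> set (support p h)"
  shows "\<exists>k. support p h' = rotate k (support p h)"
proof -
  let ?n = "least_power p h"
  obtain k where k: "k < ?n" "h' = (p ^^ k) h" using assms(2) by auto
  have n: "?n > 0" using least_power_of_permutation(2)[OF assms(1)] .
  have inj: "inj (p ^^ k)" using assms(1) by (simp add: permutation inj_fn bij_is_inj)
  have "(p ^^ m) h' = h' \<longleftrightarrow> (p ^^ m) h = h" for m
  proof -
    have "(p ^^ m) h' = (p ^^ k) ((p ^^ m) h)" unfolding k(2) by (metis add.commute funpow_add comp_apply)
    then show ?thesis using inj unfolding k(2) by (simp add: inj_eq)
  qed
  then have n': "least_power p h' = ?n" unfolding least_power_def by simp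
  have "support p h' = rotate k (support p h)"
  proof (rule nth_equalityI)
    show "length (support p h') = length (rotate k (support p h))" using n' by simp
    fix i assume "i < length (support p h')"
    then have i: "i < ?n" using n' by simp
    have "(p ^^ (k + i)) h = (p ^^ ((k + i) mod ?n)) h"
    proof -
      have "(p ^^ (k + i)) h = (p ^^ ((k + i) mod ?n)) ((p ^^ ((k + i) - (k + i) mod ?n)) h)"
        by (metis add_diff_inverse_nat funpow_add mod_less_eq_dividend not_le comp_apply)
      also have "(p ^^ ((k + i) - (k + i) mod ?n)) h = h"
        using least_power_dvd[OF assms(1)] by (metis dvd_minus_mod)
      finally show ?thesis .
    qed
    moreover have "(p ^^ i) h' = (p ^^ (k + i)) h" unfolding k(2) by (metis add.commute funpow_add comp_apply)
    ultimately show "support p h' ! i = rotate k (support p h) ! i"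
      using i n' n by (simp add: nth_rotate)
  qed
  then show ?thesis ..
qed

lemma support_self: "permutation p \<Longrightarrow> h \<in> set (support p h)"
  using least_power_of_permutation(2)[of p h] by (force simp: image_iff)

lemma cyclic_rotate:
  assumes "\<And>xs x. M (xs @ [x]) = M (x # xs)"
  shows "M (rotate k xs) = M xs"
proof (induction k)
  case (Suc k)
  have "M (rotate1 ys) = M ys" for ys
    using assms by (cases ys) auto
  then show ?case using Suc by simp
qed simp

lemma vertex_val_eq:
  assumes "permutation p" "\<And>xs x. M (xs @ [x]) = M (x # xs)"
  shows "vertex_val M a p (set (support p h)) = M (map a (support p h))"
proof -
  have "(SOME h'. h' \<in> set (support p h)) \<in> set (support p h)"
    using support_self[OF assms(1)] by (rule someI)
  then obtain k where "support p (SOME h'. h' \<in> set (support p h)) = rotate k (support p h)"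
    using support_in_rotate[OF assms(1)] by blast
  then show ?thesis
    unfolding vertex_val_def by (metis cyclic_rotate[of M, OF assms(2)] rotate_map)
qed

lemma finite_vertices: "finite H \<Longrightarrow> finite (vertices p H)"
  unfolding vertices_def by simp

lemma permutation_nxt: "ribbon_graph G \<Longrightarrow> permutation (nxt G)"
  using ribbon_graphD(1,2) unfolding permutation_permutes by blast

text \<open>
  A bijection that respects the cyclic orders respects the product over the vertices. It is used for
  isomorphisms and for the two inclusions into a disjoint union.
\<close>
lemma vertex_prod_intertwine:
  assumes p: "permutation p" and q: "permutation q" and f: "inj_on f H" and H: "p permutes H"
    and eq: "\<And>h. h \<in> H \<Longrightarrow> q (f h) = f (p h)" and M: "\<And>xs x. M (xs @ [x]) = M (x # xs)"
  shows "(\<Prod>v\<in>vertices q (f ` H). vertex_val M a q v) = (\<Prod>v\<in>vertices p H. vertex_val M (a \<circ> f) p v)"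
proof -
  have in_H: "(p ^^ n) h \<in> H" if "h \<in> H" for n h
    using permutes_in_image[OF permutes_funpow[OF H]] that by blast
  have pow: "(q ^^ n) (f h) = f ((p ^^ n) h)" if "h \<in> H" for n h
    by (induction n) (use eq in_H that in auto)
  have supp: "support q (f h) = map f (support p h)" if "h \<in> H" for h
    by (rule support_intertwine) (use pow in_H that f in \<open>auto simp: inj_on_eq_iff\<close>)
  have sub: "v \<subseteq> H" if "v \<in> vertices p H" for v
    using that in_H unfolding vertices_def by auto
  have "vertices q (f ` H) = (`) f ` vertices p H"
    unfolding vertices_def image_image by (intro image_cong refl) (use supp in \<open>simp add: image_image\<close>)
  moreover have "inj_on ((`) f) (vertices p H)"
    using f sub by (meson inj_on_image_eq_iff inj_onI)
  moreover have "vertex_val M a q (f ` v) = vertex_val M (a \<circ> f) p v" if v: "v \<in> vertices p H" for v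
  proof -
    obtain h where h: "h \<in> H" "v = set (support p h)" using v unfolding vertices_def by blast
    have "f ` v = set (support q (f h))" by (simp only: supp[OF h(1)] h(2) set_map)
    then have "vertex_val M a q (f ` v) = M (map a (support q (f h)))"
      using vertex_val_eq[OF q M] by simp
    also have "\<dots> = M (map (a \<circ> f) (support p h))" unfolding supp[OF h(1)] by (simp add: comp_assoc)
    also have "\<dots> = vertex_val M (a \<circ> f) p v" unfolding h(2) using vertex_val_eq[OF p M] by simp
    finally show ?thesis .
  qed
  ultimately show ?thesis by (simp add: prod.reindex)
qed

section \<open>The state sum\<close>

text \<open>
  A cyclic algebra structure in coordinates: the form as a function of two vectors, and all the
  tensors together as one function \<open>M\<close> on lists.
\<close>
locale cyclic_structure = finite_dimensional_vector_space scale Basis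
  for scale :: "'k::field \<Rightarrow> 'v::ab_group_add \<Rightarrow> 'v" and Basis :: "'v set" +
  fixes b :: "'v \<Rightarrow> 'v \<Rightarrow> 'k" and M :: "'v list \<Rightarrow> 'k"
  assumes b_add: "b (x + y) z = b x z + b y z" and b_scale: "b (scale c x) z = c * b x z"
    and b_sym: "b x y = b y x" and b_nondegenerate: "(\<And>y. b x y = 0) \<Longrightarrow> x = 0"
    and M_multilinear: "multilinear_form scale M" and M_cyclic: "M (xs @ [x]) = M (x # xs)"
begin

lemma b_zero: "b 0 z = 0" using b_scale[of 0 0 z] by simp

lemma b_sum: "b (\<Sum>i\<in>I. f i) z = (\<Sum>i\<in>I. b (f i) z)"
  by (induction I rule: infinite_finite_induct) (simp_all add: b_zero b_add)

lemma b_scale': "b z (scale c x) = c * b z x"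
  using b_scale[of c x z] by (simp add: b_sym[of z])

lemma b_sum': "b z (\<Sum>i\<in>I. f i) = (\<Sum>i\<in>I. b z (f i))"
  by (subst b_sym, subst b_sum) (intro sum.cong refl b_sym)

lemma basis_combination: "\<exists>c. x = (\<Sum>u\<in>Basis. scale (c u) u)"
proof -
  have "x \<in> span Basis" by (simp add: span_Basis)
  then show ?thesis unfolding span_finite[OF finite_Basis] by blast
qed

text \<open>
  Non-degeneracy says that sending \<open>x\<close> to the vector with coordinates \<open>b x e\<close> is injective; in
  finite dimension it is then surjective, and preimages of the basis vectors form the dual basis.
\<close>
lemma dual_exists: "\<exists>d. \<forall>u\<in>Basis. \<forall>v\<in>Basis. b (d u) v = (if u = v then 1 else 0)"
proof -
  define f where "f = (\<lambda>x. \<Sum>e\<in>Basis. scale (b x e) e)"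
  have coeff: "c = c'" if "(\<Sum>e\<in>Basis. scale (g e) e) = (\<Sum>e\<in>Basis. scale (g' e) e)"
    "e \<in> Basis" "c = g e" "c' = g' e" for g g' e c c'
  proof -
    have "(\<Sum>e\<in>Basis. scale (g e - g' e) e) = 0"
      using that(1) by (simp add: scale_left_diff_distrib sum_subtractf)
    then show ?thesis using independentD[OF independent_Basis finite_Basis subset_refl _ that(2)] that(3,4) by force
  qed
  have lin: "Vector_Spaces.linear scale scale f"
  proof (unfold_locales)
    show "f (x + y) = f x + f y" for x y
      unfolding f_def by (simp add: b_add scale_left_distrib sum.distrib)
    show "f (scale c x) = scale c (f x)" for c x
      unfolding f_def by (simp add: b_scale scale_sum_right)
  qed
  have "inj f"
  proof (rule injI)
    fix x y assume "f x = f y"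
    then have eq: "b x e = b y e" if "e \<in> Basis" for e
      using coeff[OF _ that] unfolding f_def by blast
    have "b (x - y) z = 0" for z
    proof -
      obtain c where z: "z = (\<Sum>u\<in>Basis. scale (c u) u)" using basis_combination by blast
      have "b x' z = (\<Sum>u\<in>Basis. c u * b x' u)" for x'
        unfolding z by (simp add: b_sum' b_scale')
      then have "b x z = b y z" using eq by simp
      moreover have "b x z = b (x - y) z + b y z" using b_add[of "x - y" y z] by simp
      ultimately show ?thesis by simp
    qed
    then have "x - y = 0" by (rule b_nondegenerate)
    then show "x = y" by simp
  qed
  then have "surj f" by (rule linear_inj_imp_surj[OF lin])
  then obtain d where d: "\<And>u. f (d u) = u" by (metis surjD)
  have "b (d u) v = (if u = v then 1 else 0)" if "u \<in> Basis" "v \<in> Basis" for u v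
  proof (rule coeff[OF _ that(2)])
    have "(\<Sum>e\<in>Basis. scale (if u = e then 1 else 0) e) = u"
      using that(1) by (simp add: if_distrib[of "\<lambda>c. scale c _"] finite_Basis cong: if_cong)
    then show "(\<Sum>e\<in>Basis. scale (b (d u) e) e) = (\<Sum>e\<in>Basis. scale (if u = e then 1 else 0) e)"
      using d[of u] unfolding f_def by simp
  qed auto
  then show ?thesis by blast
qed

definition dual :: "'v \<Rightarrow> 'v" where
  "dual = (SOME d. \<forall>u\<in>Basis. \<forall>v\<in>Basis. b (d u) v = (if u = v then 1 else 0))"

lemma b_dual: "u \<in> Basis \<Longrightarrow> v \<in> Basis \<Longrightarrow> b (dual u) v = (if u = v then 1 else 0)"
  using someI_ex[OF dual_exists] unfolding dual_def by blast

lemma dual_expansion: "x = (\<Sum>u\<in>Basis. scale (b x (dual u)) u)"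
proof -
  obtain c where x: "x = (\<Sum>u\<in>Basis. scale (c u) u)" using basis_combination by blast
  have "b x (dual v) = c v" if "v \<in> Basis" for v
  proof -
    have "b x (dual v) = (\<Sum>u\<in>Basis. c u * (if v = u then 1 else 0))"
      unfolding x b_sum b_scale using b_dual[OF that] b_sym[of _ "dual v"] by (intro sum.cong) auto
    then show ?thesis using that by (simp add: finite_Basis if_distrib cong: if_cong)
  qed
  then show ?thesis using x by simp
qed

text \<open>
  The two sides of a sum over dual bases cancel: this is the rule for erasing a gluing point.
\<close>
lemma b_contract: "(\<Sum>w\<in>Basis. b x (dual w) * b w y) = b x y"
proof -
  have "b x y = b (\<Sum>u\<in>Basis. scale (b x (dual u)) u) y" using dual_expansion[of x] by simp
  then show ?thesis by (simp add: b_sum b_scale)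
qed

lemma multilinear_expansion:
  assumes "multilinear_form scale N"
  shows "N xs = (\<Sum>u\<in>PiE {..<length xs} (\<lambda>_. Basis).
    (\<Prod>i<length xs. b (xs ! i) (dual (u i))) * N (map u [0..<length xs]))"
  using assms
proof (induction xs arbitrary: N rule: rev_induct)
  case Nil
  then show ?case by simp
next
  case (snoc x xs)
  let ?p = "length xs"
  have add: "N (xs @ [y + z]) = N (xs @ [y]) + N (xs @ [z])" and sc: "N (xs @ [scale c y]) = c * N (xs @ [y])" for y z c
    using snoc.prems unfolding multilinear_form_def by (metis append_Nil2)+
  have z: "N (xs @ [0]) = 0" using sc[of 0 0] by simp
  have sm: "N (xs @ [\<Sum>u\<in>I. scale (c u) u]) = (\<Sum>u\<in>I. c u * N (xs @ [u]))" for I c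
    by (induction I rule: infinite_finite_induct) (simp_all add: z add sc)
  have "N (xs @ [x]) = (\<Sum>w\<in>Basis. b x (dual w) * N (xs @ [w]))"
    by (subst dual_expansion[of x]) (rule sm)
  also have "\<dots> = (\<Sum>w\<in>Basis. b x (dual w) * (\<Sum>u\<in>PiE {..<?p} (\<lambda>_. Basis).
      (\<Prod>i<?p. b (xs ! i) (dual (u i))) * N (map u [0..<?p] @ [w])))"
    using snoc.IH[OF multilinear_form_append(2)[OF snoc.prems]] by simp
  also have "\<dots> = (\<Sum>u\<in>PiE {..<?p} (\<lambda>_. Basis). \<Sum>w\<in>Basis.
      (\<Prod>i<?p. b (xs ! i) (dual (u i))) * b x (dual w) * N (map u [0..<?p] @ [w]))"
    by (subst sum.swap) (simp add: sum_distrib_left mult_ac)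
  also have "\<dots> = (\<Sum>u\<in>PiE {..<?p} (\<lambda>_. Basis). \<Sum>w\<in>Basis.
      (\<Prod>i<Suc ?p. b ((xs @ [x]) ! i) (dual ((u(?p := w)) i))) * N (map (u(?p := w)) [0..<Suc ?p]))"
    by (intro sum.cong refl) (simp add: nth_append)
  also have "\<dots> = (\<Sum>u\<in>PiE {..<Suc ?p} (\<lambda>_. Basis).
      (\<Prod>i<Suc ?p. b ((xs @ [x]) ! i) (dual (u i))) * N (map u [0..<Suc ?p]))"
    unfolding lessThan_Suc by (subst sum_PiE_insert) simp_all
  finally show ?case by simp
qed

text \<open>
  A pure tensor is an evaluation functional, so this is the previous expansion for all multilinear
  forms at once.
\<close>
lemma pure_tensor_expansion:
  "pure_tensor scale xs = (\<Sum>u\<in>PiE {..<length xs} (\<lambda>_. Basis).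
    tensor_scale (\<Prod>i<length xs. b (xs ! i) (dual (u i))) (pure_tensor scale (map u [0..<length xs])))"
proof
  fix N
  show "pure_tensor scale xs N = (\<Sum>u\<in>PiE {..<length xs} (\<lambda>_. Basis).
    tensor_scale (\<Prod>i<length xs. b (xs ! i) (dual (u i))) (pure_tensor scale (map u [0..<length xs]))) N"
    unfolding sum_fun_apply tensor_scale_def pure_tensor_def
    using multilinear_expansion[of N xs] by simp
qed

text \<open>
  A half-edge coloured by the basis vector \<open>a h\<close> carries the dual vector; the endpoints carry the
  given vectors \<open>x i\<close> and \<open>y j\<close>.
\<close>
definition flag_label :: "(nat \<Rightarrow> 'v) \<Rightarrow> (nat \<Rightarrow> 'v) \<Rightarrow> ('h \<Rightarrow> 'v) \<Rightarrow> 'h flag \<Rightarrow> 'v" where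
  "flag_label x y a f = (case f of HalfEdge h \<Rightarrow> dual (a h) | InEnd i \<Rightarrow> x i | OutEnd j \<Rightarrow> y j)"

lemma flag_label_simps [simp]:
  "flag_label x y a (HalfEdge h) = dual (a h)" "flag_label x y a (InEnd i) = x i" "flag_label x y a (OutEnd i) = y i"
  by (simp_all add: flag_label_def)

abbreviation states :: "'h set \<Rightarrow> ('h \<Rightarrow> 'v) set" where
  "states H \<equiv> PiE H (\<lambda>_. Basis)"

definition vertex_weight :: "'h rgraph \<Rightarrow> ('h \<Rightarrow> 'v) \<Rightarrow> 'k" where
  "vertex_weight G a = (\<Prod>v\<in>vertices (nxt G) (halfs G). vertex_val M a (nxt G) v)"

definition edge_weight :: "'h rgraph \<Rightarrow> ('h flag \<Rightarrow> 'v) \<Rightarrow> 'k" where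
  "edge_weight G l = (\<Prod>e\<in>edges G. edge_val b l e)"

text \<open>
  The state sum. It is the matrix coefficient of the map assigned to \<open>G\<close>: evaluated on inputs \<open>x\<close>
  and paired with the vectors \<open>y\<close> at the outputs. Each edge contributes \<open>b\<close> of the labels at its
  ends, each vertex \<open>M\<close> of the colours around it, and each circle the dimension.
\<close>
definition amplitude :: "'h rgraph \<Rightarrow> (nat \<Rightarrow> 'v) \<Rightarrow> (nat \<Rightarrow> 'v) \<Rightarrow> 'k" where
  "amplitude G x y = of_nat (card Basis) ^ circles G *
    (\<Sum>a\<in>states (halfs G). vertex_weight G a * edge_weight G (flag_label x y a))"

lemma edge_weight_cong:
  assumes "ribbon_graph G" "\<And>f. f \<in> flags G \<Longrightarrow> l f = l' f"
  shows "edge_weight G l = edge_weight G l'"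
  unfolding edge_weight_def using ribbon_graphD(5)[OF assms(1)] assms(2)
  by (intro prod.cong refl edge_val_cong) blast

lemma amplitude_cong:
  assumes "ribbon_graph G" "\<And>i. i < ins G \<Longrightarrow> x i = x' i" "\<And>j. j < outs G \<Longrightarrow> y j = y' j"
  shows "amplitude G x y = amplitude G x' y'"
proof -
  have "edge_weight G (flag_label x y a) = edge_weight G (flag_label x' y' a)" for a
    by (rule edge_weight_cong[OF assms(1)]) (use assms(2,3) in \<open>auto simp: flags_def\<close>)
  then show ?thesis unfolding amplitude_def by simp
qed

text \<open>
  Every flag lies on exactly one edge, so its label enters the product exactly once.
\<close>
lemma edge_weight_linear:
  assumes "ribbon_graph G" "f \<in> flags G"
  shows "\<exists>g r. \<forall>v. edge_weight G (l(f := v)) = b v g * r"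
proof -
  note G = ribbon_graphD[OF assms(1)]
  obtain f' where f': "{f, f'} \<in> edges G" "f \<noteq> f'"
    using edge_partner[OF G(3) _ assms(2)] G(4) by blast
  have "edge_weight G (l(f := v)) = b v (l f') * (\<Prod>e\<in>edges G - {{f, f'}}. edge_val b l e)" for v
  proof -
    have "edge_weight G (l(f := v)) = edge_val b (l(f := v)) {f, f'} * (\<Prod>e\<in>edges G - {{f, f'}}. edge_val b (l(f := v)) e)"
      unfolding edge_weight_def by (rule prod.remove[OF G(7) f'(1)])
    moreover have "(\<Prod>e\<in>edges G - {{f, f'}}. edge_val b (l(f := v)) e) = (\<Prod>e\<in>edges G - {{f, f'}}. edge_val b l e)"
    proof (intro prod.cong refl edge_val_cong)
      fix e x assume e: "e \<in> edges G - {{f, f'}}" "x \<in> e"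
      then have "x \<noteq> f" using edge_eqI[OF G(3) f'(1), of e f] by blast
      then show "(l(f := v)) x = l x" by simp
    qed
    ultimately show ?thesis using edge_val_pair[of b, OF b_sym f'(2)] f'(2) by simp
  qed
  then show ?thesis by blast
qed

lemma amplitude_linear:
  assumes "ribbon_graph G" "i < ins G"
  shows "amplitude G (x(i := v + w)) y = amplitude G (x(i := v)) y + amplitude G (x(i := w)) y"
    "amplitude G (x(i := scale c v)) y = c * amplitude G (x(i := v)) y"
proof -
  have i: "InEnd i \<in> flags G" using assms(2) by simp
  have l: "flag_label (x(i := v)) y a = (flag_label x y a)(InEnd i := v)" for v and a :: "'a \<Rightarrow> 'v"
    by (auto simp: flag_label_def fun_eq_iff split: flag.splits)
  have add: "edge_weight G (flag_label (x(i := v + w)) y a) =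
      edge_weight G (flag_label (x(i := v)) y a) + edge_weight G (flag_label (x(i := w)) y a)" for a
    using edge_weight_linear[OF assms(1) i, of "flag_label x y a"] unfolding l by (auto simp: b_add algebra_simps)
  have sc: "edge_weight G (flag_label (x(i := scale c v)) y a) = c * edge_weight G (flag_label (x(i := v)) y a)" for a
    using edge_weight_linear[OF assms(1) i, of "flag_label x y a"] unfolding l by (auto simp: b_scale algebra_simps)
  show "amplitude G (x(i := v + w)) y = amplitude G (x(i := v)) y + amplitude G (x(i := w)) y"
    unfolding amplitude_def add by (simp add: algebra_simps sum.distrib)
  show "amplitude G (x(i := scale c v)) y = c * amplitude G (x(i := v)) y"
    unfolding amplitude_def sc by (simp add: algebra_simps sum_distrib_left)
qed

lemma amplitude_iso:
  assumes G: "ribbon_graph G" and H: "ribbon_graph H" and "rgraph_iso G H"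
  shows "amplitude G = amplitude H"
proof (intro ext)
  fix x y
  obtain \<phi> where \<phi>: "bij_betw \<phi> (halfs G) (halfs H)" "\<forall>h\<in>halfs G. \<phi> (nxt G h) = nxt H (\<phi> h)"
    "edges H = (`) (map_flag \<phi>) ` edges G" "ins G = ins H" "outs G = outs H" "circles G = circles H"
    using assms(3) by (rule rgraph_isoE)
  have inj: "inj_on \<phi> (halfs G)" and img: "halfs H = \<phi> ` halfs G" using \<phi>(1) by (auto simp: bij_betw_def)
  let ?r = "\<lambda>a. restrict (a \<circ> \<phi>) (halfs G)"
  have bij: "bij_betw ?r (states (halfs H)) (states (halfs G))"
  proof (rule bij_betw_byWitness[where f' = "\<lambda>a. restrict (a \<circ> inv_into (halfs G) \<phi>) (halfs H)"])
    show "\<forall>a\<in>states (halfs H). restrict (?r a \<circ> inv_into (halfs G) \<phi>) (halfs H) = a"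
    proof
      fix a assume a: "a \<in> states (halfs H)"
      show "restrict (?r a \<circ> inv_into (halfs G) \<phi>) (halfs H) = a"
        by (rule extensionalityI[of _ "halfs H"])
          (use a in \<open>auto simp: img inv_into_into f_inv_into_f PiE_def\<close>)
    qed
    show "\<forall>a\<in>states (halfs G). ?r (restrict (a \<circ> inv_into (halfs G) \<phi>) (halfs H)) = a"
    proof
      fix a assume a: "a \<in> states (halfs G)"
      show "?r (restrict (a \<circ> inv_into (halfs G) \<phi>) (halfs H)) = a"
        by (rule extensionalityI[of _ "halfs G"]) (use a inj in \<open>auto simp: img PiE_def\<close>)
    qed
    show "?r ` states (halfs H) \<subseteq> states (halfs G)" using img by auto
    show "(\<lambda>a. restrict (a \<circ> inv_into (halfs G) \<phi>) (halfs H)) ` states (halfs G) \<subseteq> states (halfs H)"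
      using img by (auto simp: inv_into_into)
  qed
  have inj_edges: "inj_on ((`) (map_flag \<phi>)) (edges G)"
    using inj_map_flag[OF inj] ribbon_graphD(5)[OF G] by (meson inj_on_image_eq_iff inj_onI)
  have "vertex_weight H a * edge_weight H (flag_label x y a) = vertex_weight G (?r a) * edge_weight G (flag_label x y (?r a))" for a
  proof -
    have "vertex_weight H a = (\<Prod>v\<in>vertices (nxt G) (halfs G). vertex_val M (a \<circ> \<phi>) (nxt G) v)"
      unfolding vertex_weight_def img
      by (rule vertex_prod_intertwine[OF permutation_nxt[OF G] permutation_nxt[OF H] inj ribbon_graphD(2)[OF G] _ M_cyclic])
        (use \<phi>(2) in auto)
    also have "\<dots> = vertex_weight G (?r a)"
      unfolding vertex_weight_def
    proof (rule prod.cong[OF refl])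
      fix v assume "v \<in> vertices (nxt G) (halfs G)"
      then obtain h where h: "h \<in> halfs G" "v = set (support (nxt G) h)" unfolding vertices_def by blast
      have "set (support (nxt G) h) \<subseteq> halfs G"
        using permutes_in_image[OF permutes_funpow[OF ribbon_graphD(2)[OF G]]] h(1) by auto
      then show "vertex_val M (a \<circ> \<phi>) (nxt G) v = vertex_val M (?r a) (nxt G) v"
        unfolding h(2) vertex_val_eq[OF permutation_nxt[OF G] M_cyclic]
        by (intro arg_cong[where f = M] map_cong refl) auto
    qed
    finally have v: "vertex_weight H a = vertex_weight G (?r a)" .
    have "edge_weight H (flag_label x y a) = (\<Prod>e\<in>edges G. edge_val b (flag_label x y a) (map_flag \<phi> ` e))"
      unfolding edge_weight_def \<phi>(3) by (simp add: prod.reindex[OF inj_edges])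
    also have "\<dots> = edge_weight G (flag_label x y a \<circ> map_flag \<phi>)"
      unfolding edge_weight_def
      by (intro prod.cong refl edge_val_image b_sym ribbon_graphD(4)[OF G] inj_on_subset[OF inj_map_flag[OF inj] ribbon_graphD(5)[OF G]])
    also have "\<dots> = edge_weight G (flag_label x y (?r a))"
      by (rule edge_weight_cong[OF G]) (auto simp: flags_def)
    finally show ?thesis using v by simp
  qed
  then show "amplitude G x y = amplitude H x y"
    unfolding amplitude_def \<phi>(6) by (simp add: sum.reindex_bij_betw[OF bij, symmetric])
qed

lemma sum_states_Plus:
  fixes g :: "('h + 'g \<Rightarrow> 'v) \<Rightarrow> 'k"
  shows "(\<Sum>a\<in>states (A <+> B). g a) = (\<Sum>a\<in>states A. \<Sum>a'\<in>states B. g (case_sum a a'))"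
proof -
  have "bij_betw (\<lambda>(a, a'). case_sum a a') (states A \<times> states B) (states (A <+> B))"
  proof (rule bij_betw_byWitness[where f' = "\<lambda>a. (a \<circ> Inl, a \<circ> Inr)"])
    show "\<forall>p\<in>states A \<times> states B. (\<lambda>a. (a \<circ> Inl, a \<circ> Inr)) ((\<lambda>(a, a'). case_sum a a') p) = p"
      by (auto simp: comp_def)
    show "\<forall>a\<in>states (A <+> B). (\<lambda>(a, a'). case_sum a a') (a \<circ> Inl, a \<circ> Inr) = a"
      by (auto simp: fun_eq_iff split: sum.splits)
    show "(\<lambda>(a, a'). case_sum a a') ` (states A \<times> states B) \<subseteq> states (A <+> B)"
      by (auto simp: PiE_def extensional_def Plus_def inj_image_mem_iff split: sum.splits)
    show "(\<lambda>a. (a \<circ> Inl, a \<circ> Inr)) ` states (A <+> B) \<subseteq> states A \<times> states B"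
      by (auto simp: PiE_def extensional_def Plus_def inj_image_mem_iff)
  qed
  then show ?thesis
    by (simp add: sum.reindex_bij_betw[symmetric] sum.cartesian_product case_prod_unfold)
qed

lemma vertex_prod_map_sum:
  assumes p: "permutation p" "p permutes A" and q: "permutation q" "q permutes B" and fin: "finite A" "finite B"
  shows "(\<Prod>v\<in>vertices (map_sum p q) (A <+> B). vertex_val M (case_sum a a') (map_sum p q) v) =
    (\<Prod>v\<in>vertices p A. vertex_val M a p v) * (\<Prod>v\<in>vertices q B. vertex_val M a' q v)"
proof -
  have perm: "permutation (map_sum p q)"
    unfolding permutation_permutes
    by (intro exI[of _ "A <+> B"] conjI permutes_map_sum[OF p(2) q(2)]) (simp add: fin)
  have l: "(\<Prod>v\<in>vertices (map_sum p q) (Inl ` A). vertex_val M (case_sum a a') (map_sum p q) v) =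
      (\<Prod>v\<in>vertices p A. vertex_val M (case_sum a a' \<circ> Inl) p v)"
    by (rule vertex_prod_intertwine[OF p(1) perm _ p(2) _ M_cyclic]) auto
  have r: "(\<Prod>v\<in>vertices (map_sum p q) (Inr ` B). vertex_val M (case_sum a a') (map_sum p q) v) =
      (\<Prod>v\<in>vertices q B. vertex_val M (case_sum a a' \<circ> Inr) q v)"
    by (rule vertex_prod_intertwine[OF q(1) perm _ q(2) _ M_cyclic]) auto
  have pl: "(map_sum p q ^^ n) (Inl h) = Inl ((p ^^ n) h)" for n h by (induction n) auto
  have pr: "(map_sum p q ^^ n) (Inr h) = Inr ((q ^^ n) h)" for n h by (induction n) auto
  have U: "vertices (map_sum p q) (A <+> B) = vertices (map_sum p q) (Inl ` A) \<union> vertices (map_sum p q) (Inr ` B)"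
    unfolding vertices_def Plus_def image_Un ..
  have vl: "v \<subseteq> range Inl" if "v \<in> vertices (map_sum p q) (Inl ` A)" for v
    using that by (auto simp: vertices_def pl)
  have vne: "v \<noteq> {}" if v0: "v \<in> vertices (map_sum p q) (Inl ` A)" for v
  proof -
    obtain h where v: "v = set (support (map_sum p q) h)" using v0 unfolding vertices_def by (elim imageE)
    have "h \<in> v" unfolding v by (rule support_self[OF perm])
    then show ?thesis by blast
  qed
  have vr: "v \<subseteq> range Inr" if "v \<in> vertices (map_sum p q) (Inr ` B)" for v
    using that by (auto simp: vertices_def pr)
  have "vertices (map_sum p q) (Inl ` A) \<inter> vertices (map_sum p q) (Inr ` B) = {}"
  proof (rule equals0I)
    fix v assume v: "v \<in> vertices (map_sum p q) (Inl ` A) \<inter> vertices (map_sum p q) (Inr ` B)"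
    then obtain x where "x \<in> v" using vne by blast
    then have "x \<in> range Inl" "x \<in> range Inr" using v vl vr by blast+
    then show False by auto
  qed
  then show ?thesis
    unfolding U using fin by (subst prod.union_disjoint) (simp_all add: finite_vertices l r comp_def)
qed

lemma prod_edge_val_image:
  assumes "inj f" "\<And>e. e \<in> E \<Longrightarrow> card e = 2"
  shows "(\<Prod>e\<in>(`) f ` E. edge_val b l e) = (\<Prod>e\<in>E. edge_val b (l \<circ> f) e)"
proof -
  have "inj_on ((`) f) E" using assms(1) by (auto simp: inj_on_def inj_image_eq_iff)
  then have "(\<Prod>e\<in>(`) f ` E. edge_val b l e) = (\<Prod>e\<in>E. edge_val b l (f ` e))"
    by (rule prod.reindex_cong) simp_all
  also have "\<dots> = (\<Prod>e\<in>E. edge_val b (l \<circ> f) e)"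
    by (intro prod.cong refl edge_val_image b_sym assms(2) inj_on_subset[OF assms(1)]) simp_all
  finally show ?thesis .
qed

lemma edge_weight_juxtapose:
  assumes G: "ribbon_graph G" and F: "ribbon_graph F"
  shows "edge_weight (juxtapose G F) l = edge_weight G (l \<circ> left_flag) * edge_weight F (l \<circ> right_flag G)"
proof -
  note RG = ribbon_graphD[OF G] and RF = ribbon_graphD[OF F]
  have "(`) left_flag ` edges G \<inter> (`) (right_flag G) ` edges F = {}"
  proof -
    have "left_flag ` e \<noteq> right_flag G ` e'" if "e \<in> edges G" "e' \<in> edges F" for e e'
    proof -
      have "e \<noteq> {}" using RG(3) that unfolding partition_on_def by blast
      then show ?thesis using flags_juxtapose_disjoint[of G F] RG(5)[OF that(1)] RF(5)[OF that(2)] by blast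
    qed
    then show ?thesis by blast
  qed
  then have "edge_weight (juxtapose G F) l =
      (\<Prod>e\<in>(`) left_flag ` edges G. edge_val b l e) * (\<Prod>e\<in>(`) (right_flag G) ` edges F. edge_val b l e)"
    unfolding edge_weight_def edges_juxtapose using RG(7) RF(7) by (intro prod.union_disjoint) auto
  also have "(\<Prod>e\<in>(`) left_flag ` edges G. edge_val b l e) = edge_weight G (l \<circ> left_flag)"
    unfolding edge_weight_def using RG(4) by (rule prod_edge_val_image[OF inj_left_flag])
  also have "(\<Prod>e\<in>(`) (right_flag G) ` edges F. edge_val b l e) = edge_weight F (l \<circ> right_flag G)"
    unfolding edge_weight_def using RF(4) by (rule prod_edge_val_image[OF inj_right_flag])
  finally show ?thesis .
qed

lemma vertex_weight_sum:
  assumes "ribbon_graph G" "ribbon_graph F" "nxt H = map_sum (nxt G) (nxt F)" "halfs H = halfs G <+> halfs F"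
  shows "vertex_weight H (case_sum a a') = vertex_weight G a * vertex_weight F a'"
  unfolding vertex_weight_def assms(3,4)
  by (intro vertex_prod_map_sum permutation_nxt ribbon_graphD(1,2) assms(1,2))

lemma amplitude_juxtapose:
  assumes G: "ribbon_graph G" and F: "ribbon_graph F"
  shows "amplitude (juxtapose G F) x y =
    amplitude G x y * amplitude F (\<lambda>i. x (ins G + i)) (\<lambda>j. y (outs G + j))"
proof -
  have l: "flag_label x y (case_sum a a') \<circ> left_flag = flag_label x y a" for a a'
    by (auto simp: fun_eq_iff flag_label_def split: flag.splits)
  have r: "flag_label x y (case_sum a a') \<circ> right_flag G = flag_label (\<lambda>i. x (ins G + i)) (\<lambda>j. y (outs G + j)) a'" for a a'
    by (auto simp: fun_eq_iff flag_label_def split: flag.splits)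
  show ?thesis
    unfolding amplitude_def
    by (simp add: sum_states_Plus vertex_weight_sum[OF G F] edge_weight_juxtapose[OF G F] l r power_add
        sum_product mult_ac)
qed

text \<open>
  For fixed colours of the half-edges, \<open>chain_state_sum\<close> performs the sum over the labels of the glued
  endpoints: open chains become the edges of the glued graph, closed chains its new circles.
\<close>
lemma amplitude_glue:
  assumes G: "ribbon_graph G" and F: "ribbon_graph F" and io: "ins G = outs F"
  shows "amplitude (glue G F) x y = (\<Sum>u\<in>states {..<outs F}. amplitude F x (dual \<circ> u) * amplitude G u y)"
proof -
  note RG = ribbon_graphD[OF G] and RF = ribbon_graphD[OF F]
  let ?N = "{..<outs F}" and ?Q = "unglued G F"
  let ?closed = "{c \<in> chains G F. c \<inter> ?Q = {}}" and ?open = "{c \<in> chains G F. c \<inter> ?Q \<noteq> {}}"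
  let ?dim = "of_nat (card Basis) :: 'k"
  have glued: "(\<Sum>u\<in>states ?N. edge_weight F (flag_label x (dual \<circ> u) a') * edge_weight G (flag_label u y a)) =
    ?dim ^ card ?closed * edge_weight (glue G F) (flag_label x y (case_sum a a'))" for a a'
  proof -
    (* the zeros are placeholders: the glued endpoints are relabelled by the colours u *)
    define l where "l = case_sum (flag_label (\<lambda>_. 0) y a) (flag_label x (\<lambda>_. 0) a')"
    let ?l = "chain_label out_glued in_glued ?N dual l"
    note inj = chain_system_glue[OF G F io, unfolded chain_system_def, THEN conjunct2, THEN conjunct2,
      THEN conjunct2, THEN conjunct2]
    have out_val: "?l u (out_glued i) = dual (u i)" and in_val: "?l u (in_glued i) = u i" if "i < outs F" for u i
      using that inv_into_f_f[OF inj[THEN conjunct1], of i] inv_into_f_f[OF inj[THEN conjunct2, THEN conjunct1], of i]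
      by (auto simp: chain_label_def)
    have other: "?l u f = l f" if "f \<notin> out_glued ` ?N" "f \<notin> in_glued ` ?N" for u f
      using that by (simp add: chain_label_def)
    have lG: "edge_weight G (?l u \<circ> Inl) = edge_weight G (flag_label u y a)" for u
    proof (rule edge_weight_cong[OF G])
      fix f assume "f \<in> flags G"
      then show "(?l u \<circ> Inl) f = flag_label u y a f"
        by (cases f) (use in_val io other[of "Inl f" u] in \<open>auto simp: l_def\<close>)
    qed
    have lF: "edge_weight F (?l u \<circ> Inr) = edge_weight F (flag_label x (dual \<circ> u) a')" for u
    proof (rule edge_weight_cong[OF F])
      fix f assume "f \<in> flags F"
      then show "(?l u \<circ> Inr) f = flag_label x (dual \<circ> u) a' f"
        by (cases f) (use out_val other[of "Inr f" u] in \<open>auto simp: l_def\<close>)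
    qed
    have split: "(\<Prod>e\<in>sum_edges G F. edge_val b m e) = edge_weight G (m \<circ> Inl) * edge_weight F (m \<circ> Inr)" for m
    proof -
      have "(`) Inl ` edges G \<inter> (`) Inr ` edges F = {}"
      proof -
        have "Inl ` e \<noteq> Inr ` e'" if "e \<in> edges G" for e e'
        proof -
          have "e \<noteq> {}" using RG(3) that unfolding partition_on_def by blast
          then show ?thesis by auto
        qed
        then show ?thesis by blast
      qed
      then have "(\<Prod>e\<in>sum_edges G F. edge_val b m e) =
          (\<Prod>e\<in>(`) Inl ` edges G. edge_val b m e) * (\<Prod>e\<in>(`) Inr ` edges F. edge_val b m e)"
        using RG(7) RF(7) by (intro prod.union_disjoint) auto
      also have "(\<Prod>e\<in>(`) Inl ` edges G. edge_val b m e) = edge_weight G (m \<circ> Inl)"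
        unfolding edge_weight_def using RG(4) by (rule prod_edge_val_image[OF inj_Inl])
      also have "(\<Prod>e\<in>(`) Inr ` edges F. edge_val b m e) = edge_weight F (m \<circ> Inr)"
        unfolding edge_weight_def using RF(4) by (rule prod_edge_val_image[OF inj_Inr])
      finally show ?thesis .
    qed
    have loop: "b (dual w) w = 1" if "w \<in> Basis" for w
      using b_dual that by simp
    have "(\<Prod>c\<in>?open. edge_val b l (c \<inter> ?Q)) = edge_weight (glue G F) (flag_label x y (case_sum a a'))"
    proof -
      let ?fl = "flag_label x y (case_sum a a')"
      have "edge_weight (glue G F) ?fl = (\<Prod>c\<in>?open. edge_val b ?fl ((the \<circ> outer_flag) ` (c \<inter> ?Q)))"
        unfolding edge_weight_def edges_glue[OF G F io]
        by (rule prod.reindex_cong[OF inj_on_open_chains[OF G F io] refl refl])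
      also have "\<dots> = (\<Prod>c\<in>?open. edge_val b l (c \<inter> ?Q))"
      proof (rule prod.cong[OF refl])
        fix c assume "c \<in> ?open"
        then have "card (c \<inter> ?Q) = 2" using card_chain_unglued[OF G F io] by blast
        then have "edge_val b ?fl ((the \<circ> outer_flag) ` (c \<inter> ?Q)) = edge_val b (?fl \<circ> (the \<circ> outer_flag)) (c \<inter> ?Q)"
          by (rule edge_val_image[of b, OF b_sym _ inj_on_subset[OF inj_outer_flag[OF io] Int_lower2]])
        also have "\<dots> = edge_val b l (c \<inter> ?Q)"
          by (rule edge_val_cong) (auto simp: unglued_eq[OF io] l_def)
        finally show "edge_val b ?fl ((the \<circ> outer_flag) ` (c \<inter> ?Q)) = edge_val b l (c \<inter> ?Q)" .
      qed
      finally show ?thesis by simp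
    qed
    moreover have "(\<Sum>u\<in>states ?N. \<Prod>e\<in>sum_edges G F. edge_val b (?l u) e) =
        ?dim ^ card ?closed * (\<Prod>c\<in>?open. edge_val b l (c \<inter> ?Q))"
      using chain_state_sum[where b = b and d = dual and D = Basis and l = l,
          OF chain_system_glue[OF G F io] b_sym b_contract loop, THEN conjunct2]
      unfolding chains_eq unglued_def .
    ultimately show ?thesis unfolding split lG lF by (simp add: mult.commute)
  qed
  have "(\<Sum>u\<in>states ?N. amplitude F x (dual \<circ> u) * amplitude G u y) =
      (\<Sum>u\<in>states ?N. \<Sum>a\<in>states (halfs G). \<Sum>a'\<in>states (halfs F). ?dim ^ (circles G + circles F) *
         (vertex_weight G a * vertex_weight F a' *
         (edge_weight F (flag_label x (dual \<circ> u) a') * edge_weight G (flag_label u y a))))"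
    unfolding amplitude_def
    by (subst sum.swap, simp add: sum_product sum_distrib_left power_add mult_ac)
  also have "\<dots> = (\<Sum>a\<in>states (halfs G). \<Sum>a'\<in>states (halfs F). ?dim ^ (circles G + circles F) *
      (vertex_weight G a * vertex_weight F a' *
       (\<Sum>u\<in>states ?N. edge_weight F (flag_label x (dual \<circ> u) a') * edge_weight G (flag_label u y a))))"
    by (subst sum.swap, intro sum.cong refl, subst sum.swap) (simp add: sum_distrib_left)
  also have "\<dots> = (\<Sum>a\<in>states (halfs G). \<Sum>a'\<in>states (halfs F). ?dim ^ (circles G + circles F) *
      (vertex_weight G a * vertex_weight F a' *
       (?dim ^ card ?closed * edge_weight (glue G F) (flag_label x y (case_sum a a')))))"
    by (simp only: glued)
  also have "\<dots> = amplitude (glue G F) x y"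
    unfolding amplitude_def circles_glue[OF G F io]
    by (simp add: sum_states_Plus vertex_weight_sum[OF G F] power_add sum_distrib_left mult_ac)
  finally show ?thesis by simp
qed

text \<open>
  The output is expanded in the basis: its coefficient at a pure tensor of basis vectors is the
  amplitude with the dual basis vectors at the outgoing endpoints.
\<close>
definition state_vector :: "'h rgraph \<Rightarrow> (nat \<Rightarrow> 'v) \<Rightarrow> ('k, 'v) tensor" where
  "state_vector G x = (\<Sum>u\<in>states {..<outs G}.
     tensor_scale (amplitude G x (dual \<circ> u)) (pure_tensor scale (map u [0..<outs G])))"

definition evaluation :: "'h rgraph \<Rightarrow> ('k, 'v) tensor \<Rightarrow> ('k, 'v) tensor" where
  "evaluation G = (THE f. f \<in> linear_maps tensor_scale (tensor_power scale (ins G)) tensor_scale UNIV \<and>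
     (\<forall>xs. length xs = ins G \<longrightarrow> f (pure_tensor scale xs) = state_vector G ((!) xs)))"

lemma state_vector_in: "state_vector G x \<in> tensor_power scale (outs G)"
  unfolding state_vector_def by (intro tensor_power_sum tensor_power_scale pure_in_tensor_power) simp

lemma state_vector_cong:
  assumes "ribbon_graph G" "\<And>i. i < ins G \<Longrightarrow> x i = x' i"
  shows "state_vector G x = state_vector G x'"
proof -
  have "amplitude G x y = amplitude G x' y" for y using assms by (intro amplitude_cong) auto
  then show ?thesis unfolding state_vector_def by simp
qed

lemma evaluation:
  assumes "ribbon_graph G"
  shows "evaluation G \<in> tensor_hom scale (ins G) (outs G)"
    and "length xs = ins G \<Longrightarrow> evaluation G (pure_tensor scale xs) = state_vector G ((!) xs)"
proof -
  have upd: "(!) (xs @ [v] @ ys) = ((!) (xs @ [0] @ ys))(length xs := v)" for xs ys and v :: 'v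
    by (auto simp: fun_eq_iff nth_append nth_Cons split: nat.splits)
  have "\<exists>!f. f \<in> linear_maps tensor_scale (tensor_power scale (ins G)) tensor_scale UNIV \<and>
     (\<forall>xs. length xs = ins G \<longrightarrow> f (pure_tensor scale xs) = state_vector G ((!) xs))"
  proof (rule tensor_power_universal[OF vector_space_tensor_scale])
    fix xs ys :: "'v list" and v w :: 'v and c :: 'k
    assume "length xs + 1 + length ys = ins G"
    then have "length xs < ins G" by simp
    note lin = amplitude_linear[OF assms this]
    define x0 where "x0 = (!) (xs @ [0] @ ys)"
    have upd0: "(!) (xs @ [v] @ ys) = x0(length xs := v)" for v unfolding x0_def by (rule upd)
    show "state_vector G ((!) (xs @ [v + w] @ ys)) = state_vector G ((!) (xs @ [v] @ ys)) + state_vector G ((!) (xs @ [w] @ ys))"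
      unfolding upd0 state_vector_def lin by (simp add: tensor.scale_left_distrib sum.distrib)
    show "state_vector G ((!) (xs @ [scale c v] @ ys)) = tensor_scale c (state_vector G ((!) (xs @ [v] @ ys)))"
      unfolding upd0 state_vector_def lin by (simp add: tensor.scale_sum_right)
  qed
  from theI'[OF this]
  have f: "evaluation G \<in> linear_maps tensor_scale (tensor_power scale (ins G)) tensor_scale UNIV"
    and e: "\<And>xs. length xs = ins G \<Longrightarrow> evaluation G (pure_tensor scale xs) = state_vector G ((!) xs)"
    unfolding evaluation_def by blast+
  show "length xs = ins G \<Longrightarrow> evaluation G (pure_tensor scale xs) = state_vector G ((!) xs)" by (rule e)
  have "evaluation G t \<in> tensor_power scale (outs G)" if "t \<in> tensor_power scale (ins G)" for t
    using that
  proof (induction rule: tensor_power_induct)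
    case zero
    show ?case using linear_maps_zero[OF f tensor_power_zero] by (simp add: tensor_power_zero)
  next
    case (step c xs t)
    note p = pure_in_tensor_power[OF step(1), of scale]
    show ?case
      using step(3) linear_mapsD(2)[OF f tensor_power_scale[OF p] step(2)] linear_mapsD(3)[OF f p]
      by (simp add: e[OF step(1)] state_vector_in tensor_power_add tensor_power_scale)
  qed
  then show "evaluation G \<in> tensor_hom scale (ins G) (outs G)"
    using f unfolding tensor_hom_def linear_maps_def by blast
qed

lemma evaluation_iso:
  assumes "ribbon_graph G" "ribbon_graph H" "rgraph_iso G H"
  shows "evaluation G = evaluation H"
proof -
  have io: "ins G = ins H" "outs G = outs H" using assms(3) unfolding rgraph_iso_def by auto
  have "state_vector G = state_vector H"
    unfolding state_vector_def io amplitude_iso[OF assms] ..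
  then show ?thesis unfolding evaluation_def io by simp
qed

lemma evaluation_glue:
  assumes G: "ribbon_graph G" and F: "ribbon_graph F" and io: "ins G = outs F"
  shows "evaluation (glue G F) = evaluation G \<circ> evaluation F"
proof (rule tensor_map_eqI)
  have H: "ribbon_graph (glue G F)" by (rule ribbon_graph_glue[OF assms])
  note eG = evaluation[OF G, unfolded io] and eF = evaluation[OF F]
  note G' = eG(1)[unfolded tensor_hom_def] and F' = eF(1)[unfolded tensor_hom_def]
  show "evaluation (glue G F) \<in> linear_maps tensor_scale (tensor_power scale (ins F)) tensor_scale (tensor_power scale (outs G))"
    using evaluation(1)[OF H] unfolding tensor_hom_def by simp
  show "evaluation G \<circ> evaluation F \<in> linear_maps tensor_scale (tensor_power scale (ins F)) tensor_scale (tensor_power scale (outs G))"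
    unfolding linear_maps_def mem_Collect_eq comp_apply
    using linear_mapsD[OF F'] linear_mapsD[OF G'] linear_maps_zero[OF G' tensor_power_zero] by simp
  fix xs :: "'v list" assume xs: "length xs = ins F"
  let ?S = "states {..<outs F}" and ?S' = "states {..<outs G}"
  have u: "state_vector G ((!) (map u [0..<outs F])) = state_vector G u" for u
    by (rule state_vector_cong[OF G]) (simp add: io)
  have "(evaluation G \<circ> evaluation F) (pure_tensor scale xs) =
      evaluation G (\<Sum>u\<in>?S. tensor_scale (amplitude F ((!) xs) (dual \<circ> u)) (pure_tensor scale (map u [0..<outs F])))"
    using eF(2)[OF xs] by (simp add: state_vector_def)
  also have "\<dots> = (\<Sum>u\<in>?S. tensor_scale (amplitude F ((!) xs) (dual \<circ> u)) (state_vector G u))"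
    using linear_maps_tensor_sum[OF G', of ?S "\<lambda>u. pure_tensor scale (map u [0..<outs F])"]
    by (simp add: pure_in_tensor_power eG(2) u)
  also have "\<dots> = (\<Sum>w\<in>?S'. \<Sum>u\<in>?S. tensor_scale (amplitude F ((!) xs) (dual \<circ> u) * amplitude G u (dual \<circ> w))
      (pure_tensor scale (map w [0..<outs G])))"
    unfolding state_vector_def by (subst sum.swap) (simp add: tensor.scale_sum_right)
  also have "\<dots> = state_vector (glue G F) ((!) xs)"
    unfolding state_vector_def by (simp add: amplitude_glue[OF assms] tensor.scale_sum_left)
  finally show "evaluation (glue G F) (pure_tensor scale xs) = (evaluation G \<circ> evaluation F) (pure_tensor scale xs)"
    using evaluation(2)[OF H] xs by simp
qed

lemma sum_states_add:
  fixes g :: "(nat \<Rightarrow> 'v) \<Rightarrow> 'a::comm_monoid_add"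
  shows "(\<Sum>w\<in>states {..<p + q}. g w) =
    (\<Sum>u\<in>states {..<p}. \<Sum>u'\<in>states {..<q}. g (\<lambda>i. if i < p then u i else u' (i - p)))"
proof -
  let ?j = "\<lambda>(u, u') i. if i < p then u i else u' (i - p)"
  have "bij_betw ?j (states {..<p} \<times> states {..<q}) (states {..<p + q})"
  proof (rule bij_betw_byWitness[where f' = "\<lambda>w. (restrict w {..<p}, \<lambda>j. w (p + j))"])
    show "\<forall>z\<in>states {..<p} \<times> states {..<q}. (\<lambda>w. (restrict w {..<p}, \<lambda>j. w (p + j))) (?j z) = z"
      by (auto simp: fun_eq_iff PiE_def extensional_def restrict_def)
    show "\<forall>w\<in>states {..<p + q}. ?j (restrict w {..<p}, \<lambda>j. w (p + j)) = w"
      by (auto simp: fun_eq_iff)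
    show "?j ` (states {..<p} \<times> states {..<q}) \<subseteq> states {..<p + q}"
      by (auto simp: PiE_def extensional_def Pi_def)
    show "(\<lambda>w. (restrict w {..<p}, \<lambda>j. w (p + j))) ` states {..<p + q} \<subseteq> states {..<p} \<times> states {..<q}"
      by (auto simp: PiE_def extensional_def Pi_def)
  qed
  then show ?thesis
    by (simp add: sum.reindex_bij_betw[symmetric] sum.cartesian_product case_prod_unfold)
qed

lemma evaluation_juxtapose:
  assumes G: "ribbon_graph G" and F: "ribbon_graph F"
    and t: "t \<in> tensor_power scale (ins G)" and s: "s \<in> tensor_power scale (ins F)"
  shows "evaluation (juxtapose G F) (tensor_mult scale t s) = tensor_mult scale (evaluation G t) (evaluation F s)"
proof (rule tensor_bilinear_eqI[OF _ evaluation(1)[OF G] evaluation(1)[OF F] _ t s])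
  have H: "ribbon_graph (juxtapose G F)" by (rule ribbon_graph_juxtapose[OF G F])
  show "evaluation (juxtapose G F) \<in> linear_maps tensor_scale (tensor_power scale (ins G + ins F)) tensor_scale
      (tensor_power scale (outs G + outs F))"
    using evaluation(1)[OF H] unfolding tensor_hom_def by simp
  fix xs ys :: "'v list" assume xs: "length xs = ins G" and ys: "length ys = ins F"
  let ?w = "\<lambda>u u' i. if i < outs G then u i else u' (i - outs G)"
  have amp: "amplitude (juxtapose G F) ((!) (xs @ ys)) (dual \<circ> ?w u u') =
      amplitude G ((!) xs) (dual \<circ> u) * amplitude F ((!) ys) (dual \<circ> u')" for u u'
    unfolding amplitude_juxtapose[OF G F]
    by (intro arg_cong2[where f = "(*)"] amplitude_cong G F) (auto simp: xs nth_append)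
  have map: "map (?w u u') [0..<outs G + outs F] = map u [0..<outs G] @ map u' [0..<outs F]" for u u' :: "nat \<Rightarrow> 'v"
    by (rule nth_equalityI) (auto simp: nth_append)
  have "evaluation (juxtapose G F) (pure_tensor scale (xs @ ys)) = state_vector (juxtapose G F) ((!) (xs @ ys))"
    using evaluation(2)[OF H] xs ys by simp
  also have "\<dots> = (\<Sum>u\<in>states {..<outs G}. \<Sum>u'\<in>states {..<outs F}.
      tensor_scale (amplitude G ((!) xs) (dual \<circ> u) * amplitude F ((!) ys) (dual \<circ> u'))
        (tensor_mult scale (pure_tensor scale (map u [0..<outs G])) (pure_tensor scale (map u' [0..<outs F]))))"
    unfolding state_vector_def juxtapose_simps sum_states_add amp map tensor_mult_pure ..
  also have "\<dots> = tensor_mult scale (state_vector G ((!) xs)) (state_vector F ((!) ys))"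
    unfolding state_vector_def
    by (rule tensor_mult_sum[symmetric, of _ _ scale "outs G" _ _ "outs F"]) (simp_all add: pure_in_tensor_power)
  finally show "evaluation (juxtapose G F) (pure_tensor scale (xs @ ys)) =
      tensor_mult scale (evaluation G (pure_tensor scale xs)) (evaluation F (pure_tensor scale ys))"
    using evaluation(2)[OF G xs] evaluation(2)[OF F ys] by simp
qed

end

section \<open>From cyclic algebras to actions\<close>

context cyclic_structure
begin

lemma amplitude_no_vertices:
  assumes "halfs G = {}" "circles G = 0"
  shows "amplitude G x y = edge_weight G (flag_label x y (\<lambda>_. undefined))"
  using assms by (simp add: amplitude_def vertex_weight_def vertices_def)

lemma edge_weight_indexed:
  assumes "edges G = (\<lambda>i. {s i, t i}) ` I" "inj_on (\<lambda>i. {s i, t i}) I" "\<And>i. i \<in> I \<Longrightarrow> s i \<noteq> t i"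
  shows "edge_weight G l = (\<Prod>i\<in>I. b (l (s i)) (l (t i)))"
  unfolding edge_weight_def assms(1) prod.reindex[OF assms(2)] comp_def
  by (intro prod.cong refl edge_val_pair b_sym assms(3))

lemma amplitude_id: "amplitude (id_graph p) x y = (\<Prod>i<p. b (x i) (y i))"
proof -
  have "edges (id_graph p) = (\<lambda>i. {InEnd i, OutEnd i}) ` {..<p}" by (auto simp: id_graph_def)
  then have "edge_weight (id_graph p) l = (\<Prod>i<p. b (l (InEnd i)) (l (OutEnd i)))" for l
    by (rule edge_weight_indexed) (auto simp: inj_on_def doubleton_eq_iff)
  then show ?thesis by (subst amplitude_no_vertices) (simp_all add: id_graph_def)
qed

lemma evaluation_id:
  assumes "t \<in> tensor_power scale p"
  shows "evaluation (id_graph p) t = t"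
proof -
  have io: "ins (id_graph p) = p" "outs (id_graph p) = p" by (simp_all add: id_graph_def)
  note e = evaluation[OF ribbon_graph_id[of p], unfolded io]
  let ?i = "\<lambda>t. if t \<in> tensor_power scale p then t else 0"
  have "evaluation (id_graph p) = ?i"
  proof (rule tensor_map_eqI[OF e(1)[unfolded tensor_hom_def]])
    show "?i \<in> linear_maps tensor_scale (tensor_power scale p) tensor_scale (tensor_power scale p)"
      unfolding linear_maps_def by (simp add: tensor_power_add tensor_power_scale)
    fix xs :: "'v list" assume xs: "length xs = p"
    have "state_vector (id_graph p) ((!) xs) = pure_tensor scale xs"
      unfolding state_vector_def amplitude_id io by (subst (2) pure_tensor_expansion) (simp add: xs)
    then show "evaluation (id_graph p) (pure_tensor scale xs) = ?i (pure_tensor scale xs)"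
      using e(2)[OF xs] xs by (simp add: pure_in_tensor_power)
  qed
  then show ?thesis using assms by simp
qed

lemma amplitude_crossing: "amplitude crossing_graph x y = b (x 0) (y 1) * b (x 1) (y 0)"
proof -
  have "edge_weight crossing_graph l = b (l (InEnd 0)) (l (OutEnd 1)) * b (l (InEnd 1)) (l (OutEnd 0))" for l
    unfolding edge_weight_def crossing_graph_def
    by (simp add: edge_val_pair[of b, OF b_sym] doubleton_eq_iff)
  then show ?thesis by (subst amplitude_no_vertices) (simp_all add: crossing_graph_def)
qed

lemma evaluation_crossing: "evaluation crossing_graph (pure_tensor scale [x, y]) = pure_tensor scale [y, x]"
proof -
  have io: "ins crossing_graph = 2" "outs crossing_graph = 2" by (simp_all add: crossing_graph_def)
  have "evaluation crossing_graph (pure_tensor scale [x, y]) = state_vector crossing_graph ((!) [x, y])"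
    using evaluation(2)[OF ribbon_graph_crossing, of "[x, y]"] io by simp
  also have "\<dots> = pure_tensor scale [y, x]"
    unfolding state_vector_def amplitude_crossing io
    by (subst (2) pure_tensor_expansion) (simp add: numeral_2_eq_2 lessThan_Suc mult.commute)
  finally show ?thesis .
qed

lemma evaluation_coupling: "evaluation coupling_graph (pure_tensor scale [x, y]) = tensor_scale (b x y) (pure_tensor scale [])"
proof -
  have io: "ins coupling_graph = 2" "outs coupling_graph = 0" by (simp_all add: coupling_graph_def)
  have "edge_weight coupling_graph l = b (l (InEnd 0)) (l (InEnd 1))" for l
    unfolding edge_weight_def coupling_graph_def
    by (simp add: edge_val_pair[of b, OF b_sym])
  then have "amplitude coupling_graph x y = b (x 0) (x 1)" for x y
    by (subst amplitude_no_vertices) (simp_all add: coupling_graph_def)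
  then have "state_vector coupling_graph ((!) [x, y]) = tensor_scale (b x y) (pure_tensor scale [])"
    unfolding state_vector_def io by simp
  then show ?thesis using evaluation(2)[OF ribbon_graph_coupling, of "[x, y]"] io by simp
qed

end

text \<open>
  The only vertex of the star graph, read in its cyclic order from half-edge 0 on.
\<close>
lemma support_star:
  assumes "r \<ge> 1"
  shows "support (nxt (star_graph r)) 0 = [0..<r]"
proof -
  let ?f = "nxt (star_graph r)"
  have f: "?f i = (if i < r then Suc i mod r else i)" for i by (simp add: star_graph_def)
  have pow: "(?f ^^ k) 0 = k" if "k < r" for k
    using that by (induction k) (simp_all add: f)
  have "(?f ^^ r) 0 = ?f ((?f ^^ (r - 1)) 0)" using assms by (cases r) simp_all
  also have "\<dots> = 0" using assms by (simp add: pow f)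
  finally have r0: "(?f ^^ r) 0 = 0" .
  have "least_power ?f 0 = r"
    unfolding least_power_def
  proof (rule Least_equality)
    show "(?f ^^ r) 0 = 0 \<and> 0 < r" using r0 assms by simp
    show "r \<le> n" if "(?f ^^ n) 0 = 0 \<and> 0 < n" for n
      using that pow[of n] by (cases "n < r") auto
  qed
  then show ?thesis using pow by (auto intro: map_idI)
qed

context cyclic_structure
begin

lemma evaluation_star:
  assumes "r \<ge> 1" "length xs = r"
  shows "evaluation (star_graph r) (pure_tensor scale xs) = tensor_scale (M xs) (pure_tensor scale [])"
proof -
  have io: "ins (star_graph r) = r" "outs (star_graph r) = 0" and h: "halfs (star_graph r) = {..<r}"
    and c: "circles (star_graph r) = 0"
    by (simp_all add: star_graph_def)
  note perm = permutation_nxt[OF ribbon_graph_star[of r]]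
  have orbit: "set (support (nxt (star_graph r)) k) = {..<r}" if "k < r" for k
  proof -
    have "k \<in> set (support (nxt (star_graph r)) 0)" unfolding support_star[OF assms(1)] using that by simp
    then obtain j where "support (nxt (star_graph r)) k = rotate j (support (nxt (star_graph r)) 0)"
      using support_in_rotate[OF perm] by blast
    then show ?thesis unfolding support_star[OF assms(1)] by (simp only: set_rotate) auto
  qed
  have "vertices (nxt (star_graph r)) {..<r} = (\<lambda>_. {..<r}) ` {..<r}"
    unfolding vertices_def by (intro image_cong refl orbit) simp
  also have "\<dots> = {set (support (nxt (star_graph r)) 0)}"
    using orbit[of 0] assms(1) image_constant[of 0 "{..<r}" "{..<r}"] by (simp only: lessThan_iff)
  finally have "vertices (nxt (star_graph r)) {..<r} = {set (support (nxt (star_graph r)) 0)}" .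
  note vs = this
  have val: "vertex_val M a (nxt (star_graph r)) (set (support (nxt (star_graph r)) 0)) = M (map a [0..<r])" for a
    by (rule trans[OF vertex_val_eq[OF perm M_cyclic]]) (simp only: support_star[OF assms(1)])
  have v: "vertex_weight (star_graph r) a = M (map a [0..<r])" for a
    unfolding vertex_weight_def h vs by (subst prod.insert) (simp_all only: finite.emptyI empty_iff not_False_eq_True prod.empty val mult_1_right)
  have "edges (star_graph r) = (\<lambda>i. {HalfEdge i, InEnd i}) ` {..<r}" by (auto simp: star_graph_def)
  then have e: "edge_weight (star_graph r) l = (\<Prod>i<r. b (l (HalfEdge i)) (l (InEnd i)))" for l
    by (rule edge_weight_indexed) (auto simp: inj_on_def doubleton_eq_iff)
  have "amplitude (star_graph r) ((!) xs) y = (\<Sum>a\<in>states {..<r}. M (map a [0..<r]) * (\<Prod>i<r. b (dual (a i)) (xs ! i)))" for y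
    unfolding amplitude_def h c v e by simp
  also have "\<dots> = M xs"
    using multilinear_expansion[OF M_multilinear, of xs] assms(2) by (simp add: mult.commute b_sym[of "dual _"])
  finally have "state_vector (star_graph r) ((!) xs) = tensor_scale (M xs) (pure_tensor scale [])"
    unfolding state_vector_def io by simp
  then show ?thesis using evaluation(2)[OF ribbon_graph_star[of r], of xs] io assms(2) by simp
qed

lemma evaluation_cls: "ribbon_graph G \<Longrightarrow> evaluation (rep_ribbon (cls G)) = evaluation G"
  by (intro evaluation_iso ribbon_graph_rep rep_cls_iso)

theorem R_action_state_sum: "R_action scale (prop_extension (\<lambda>A. evaluation (rep_ribbon A)))"
proof (rule R_actionI)
  show "evaluation (rep_ribbon A) \<in> tensor_hom scale (ribbon_ins A) (ribbon_outs A)" for A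
    unfolding ribbon_ins_def ribbon_outs_def by (rule evaluation(1)[OF ribbon_graph_rep])
  show "evaluation (rep_ribbon (ribbon_comp A B)) = evaluation (rep_ribbon A) \<circ> evaluation (rep_ribbon B)"
    if "ribbon_ins A = ribbon_outs B" for A B
  proof -
    note g = ribbon_graph_rep[of A] ribbon_graph_rep[of B] that[unfolded ribbon_ins_def ribbon_outs_def]
    have "ribbon_comp A B = cls (glue (rep_ribbon A) (rep_ribbon B))"
      using cls_glue[OF g] by (simp add: cls_rep)
    then show ?thesis using evaluation_cls[OF ribbon_graph_glue[OF g]] evaluation_glue[OF g] by simp
  qed
  show "evaluation (rep_ribbon (ribbon_tensor A B)) (tensor_mult scale t s) =
      tensor_mult scale (evaluation (rep_ribbon A) t) (evaluation (rep_ribbon B) s)"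
    if "t \<in> tensor_power scale (ribbon_ins A)" "s \<in> tensor_power scale (ribbon_ins B)" for A B t s
  proof -
    note g = ribbon_graph_rep[of A] ribbon_graph_rep[of B]
    have "ribbon_tensor A B = cls (juxtapose (rep_ribbon A) (rep_ribbon B))"
      using cls_juxtapose[OF g] by (simp add: cls_rep)
    then show ?thesis
      using evaluation_cls[OF ribbon_graph_juxtapose[OF g]] evaluation_juxtapose[OF g that[unfolded ribbon_ins_def]] by simp
  qed
  show "evaluation (rep_ribbon (abs_ribbon (id_graph p))) t = t" if "t \<in> tensor_power scale p" for p t
    using evaluation_cls[OF ribbon_graph_id[of p]] evaluation_id[OF that] by (simp add: cls_nat ribbon_graph_id)
  show "evaluation (rep_ribbon (abs_ribbon crossing_graph)) (pure_tensor scale [x, y]) = pure_tensor scale [y, x]" for x y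
    using evaluation_cls[OF ribbon_graph_crossing] evaluation_crossing by (simp add: cls_nat ribbon_graph_crossing)
qed

lemma prop_extension_evaluation:
  assumes "ribbon_graph (G :: nat rgraph)" "ins G = p" "outs G = q"
  shows "prop_extension (\<lambda>A. evaluation (rep_ribbon A)) p q (basis_elt G) = evaluation G"
proof -
  interpret graph_family scale "\<lambda>A. evaluation (rep_ribbon A)"
    by unfold_locales (simp add: ribbon_ins_def ribbon_outs_def evaluation(1)[OF ribbon_graph_rep])
  have "ribbon_ins (cls G) = p" "ribbon_outs (cls G) = q"
    using assms by (simp_all add: ribbon_ins_cls ribbon_outs_cls)
  then show ?thesis
    using evaluation_cls[OF assms(1)]
    by (simp add: basis_elt_def fun_eq_iff prop_extension_single flip: cls_nat[OF assms(1)])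
qed

end

lemma scalar_part_hom:
  fixes f :: "('k::field, 'v::ab_group_add) tensor \<Rightarrow> ('k, 'v) tensor"
  assumes "f \<in> tensor_hom scale p q"
  shows "scalar_part \<circ> f \<in> linear_maps tensor_scale (tensor_power scale p) (*) UNIV"
proof -
  note f = linear_mapsD[OF assms[unfolded tensor_hom_def]]
  have "scalar_part (s + t) = scalar_part s + scalar_part t" "scalar_part (tensor_scale c t) = c * scalar_part t"
    "scalar_part 0 = 0" for s t :: "('k, 'v) tensor" and c
    by (simp_all add: scalar_part_def plus_fun_apply zero_fun_apply tensor_scale_def)
  then show ?thesis unfolding linear_maps_def by (auto simp: f)
qed

text \<open>
  The tensors \<open>T r\<close> for all \<open>r\<close> together are one function on lists, since the length of the list
  recovers \<open>r\<close>.
\<close>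
lemma cyclic_structure_of_algebra:
  fixes scale :: "'k::field \<Rightarrow> 'v::ab_group_add \<Rightarrow> 'v"
  assumes fd: "finite_dimensional_vector_space scale Basis" and ca: "cyclic_algebra scale b T"
  shows "cyclic_structure scale Basis (\<lambda>x y. b (pure_tensor scale [x, y])) (\<lambda>xs. T (length xs) (pure_tensor scale xs))"
proof -
  have b: "b \<in> linear_maps tensor_scale (tensor_power scale 2) (*) UNIV"
    and b_sym: "\<And>x y. b (pure_tensor scale [x, y]) = b (pure_tensor scale [y, x])"
    and b_nd: "\<And>x. (\<And>y. b (pure_tensor scale [x, y]) = 0) \<Longrightarrow> x = 0"
    and T: "\<And>r. r \<ge> 1 \<Longrightarrow> T r \<in> linear_maps tensor_scale (tensor_power scale r) (*) UNIV"
    and T_cyc: "\<And>r xs x. r \<ge> 1 \<Longrightarrow> length xs = r - 1 \<Longrightarrow>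
        T r (pure_tensor scale (xs @ [x])) = T r (pure_tensor scale (x # xs))"
    and T0: "T 0 = 0"
    using ca unfolding cyclic_algebra_def by blast+
  let ?b = "\<lambda>x y. b (pure_tensor scale [x, y])" and ?M = "\<lambda>xs. T (length xs) (pure_tensor scale xs)"
  have in2: "pure_tensor scale [x, y] \<in> tensor_power scale 2" for x y by (rule pure_in_tensor_power) simp
  show ?thesis
  proof (intro cyclic_structure.intro fd cyclic_structure_axioms.intro)
    show "?b (x + y) z = ?b x z + ?b y z" for x y z
      using pure_tensor_add[of scale "[]" x y "[z]"] linear_mapsD(2)[OF b in2 in2] by simp
    show "?b (scale c x) z = c * ?b x z" for c x z
      using pure_tensor_scale[of scale "[]" c x "[z]"] linear_mapsD(3)[OF b in2] by simp
    show "multilinear_form scale ?M"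
      unfolding multilinear_form_def
    proof (intro conjI allI)
      fix xs ys x y c
      have p: "pure_tensor scale (xs @ [z] @ ys) \<in> tensor_power scale (length (xs @ [z] @ ys))" for z
        by (rule pure_in_tensor_power) simp
      have T': "T (length (xs @ [z] @ ys)) \<in> linear_maps tensor_scale (tensor_power scale (length (xs @ [z'] @ ys))) (*) UNIV" for z z'
        using T[of "length (xs @ [z] @ ys)"] by simp
      show "?M (xs @ [x + y] @ ys) = ?M (xs @ [x] @ ys) + ?M (xs @ [y] @ ys)"
        unfolding pure_tensor_add using linear_mapsD(2)[OF T' p, of _ x] p[of y] by simp
      show "?M (xs @ [scale c x] @ ys) = c * ?M (xs @ [x] @ ys)"
        unfolding pure_tensor_scale using linear_mapsD(3)[OF T' p] by simp
    qed
    show "?M (xs @ [x]) = ?M (x # xs)" for xs x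
      using T_cyc[of "Suc (length xs)" xs x] by simp
  qed (rule b_sym b_nd, assumption?)+
qed

theorem cyclic_algebra_imp_action:
  fixes scale :: "'k::field \<Rightarrow> 'v::ab_group_add \<Rightarrow> 'v"
  assumes fd: "finite_dimensional_vector_space scale Basis" and ca: "cyclic_algebra scale b T"
  shows "\<exists>Z. R_action scale Z \<and> induced_form Z = b \<and> induced_cyclic Z = T"
proof -
  have b: "b \<in> linear_maps tensor_scale (tensor_power scale 2) (*) UNIV"
    and b_sym: "\<And>x y. b (pure_tensor scale [x, y]) = b (pure_tensor scale [y, x])"
    and b_nd: "\<And>x. (\<And>y. b (pure_tensor scale [x, y]) = 0) \<Longrightarrow> x = 0"
    and T: "\<And>r. r \<ge> 1 \<Longrightarrow> T r \<in> linear_maps tensor_scale (tensor_power scale r) (*) UNIV"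
    and T_cyc: "\<And>r xs x. r \<ge> 1 \<Longrightarrow> length xs = r - 1 \<Longrightarrow>
        T r (pure_tensor scale (xs @ [x])) = T r (pure_tensor scale (x # xs))"
    and T0: "T 0 = 0"
    using ca unfolding cyclic_algebra_def by blast+
  let ?b = "\<lambda>x y. b (pure_tensor scale [x, y])" and ?M = "\<lambda>xs. T (length xs) (pure_tensor scale xs)"
  have in2: "pure_tensor scale [x, y] \<in> tensor_power scale 2" for x y by (rule pure_in_tensor_power) simp
  interpret cyclic_structure scale Basis ?b ?M
    by (rule cyclic_structure_of_algebra[OF fd ca])
  let ?Z = "prop_extension (\<lambda>A. evaluation (rep_ribbon A))"
  have "induced_form ?Z = b"
  proof (rule tensor_map_eqI[OF _ b])
    have io: "ins coupling_graph = 2" "outs coupling_graph = 0" by (simp_all add: coupling_graph_def)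
    note Z = prop_extension_evaluation[OF ribbon_graph_coupling io]
    show "induced_form ?Z \<in> linear_maps tensor_scale (tensor_power scale 2) (*) UNIV"
      using scalar_part_hom[OF evaluation(1)[OF ribbon_graph_coupling]] unfolding induced_form_def Z io .
    fix xs :: "'v list" assume "length xs = 2"
    then obtain x y where xs: "xs = [x, y]" by (auto simp: numeral_2_eq_2 length_Suc_conv)
    show "induced_form ?Z (pure_tensor scale xs) = b (pure_tensor scale xs)"
      unfolding induced_form_def Z comp_apply xs evaluation_coupling scalar_part_unit ..
  qed
  moreover have "induced_cyclic ?Z r = T r" for r
  proof (cases "r \<ge> 1")
    case True
    have io: "ins (star_graph r) = r" "outs (star_graph r) = 0" by (simp_all add: star_graph_def)
    note Z = prop_extension_evaluation[OF ribbon_graph_star[of r] io]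
    show ?thesis
    proof (rule tensor_map_eqI[OF _ T[OF True]])
      show "induced_cyclic ?Z r \<in> linear_maps tensor_scale (tensor_power scale r) (*) UNIV"
        using scalar_part_hom[OF evaluation(1)[OF ribbon_graph_star[of r]]] True unfolding induced_cyclic_def Z io by simp
      fix xs :: "'v list" assume xs: "length xs = r"
      show "induced_cyclic ?Z r (pure_tensor scale xs) = T r (pure_tensor scale xs)"
        using True evaluation_star[OF True xs] xs by (simp add: induced_cyclic_def Z scalar_part_unit)
    qed
  next
    case False
    then have "r = 0" by simp
    then show ?thesis using T0 by (simp add: induced_cyclic_def)
  qed
  ultimately show ?thesis using R_action_state_sum by blast
qed

section \<open>Two kinds of gluing\<close>

text \<open>
  Both gluings below attach a graph \<open>G\<close> whose edges only prolong or connect edges of the other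
  graph \<open>F\<close>. Each flag then has an owner among the flags of \<open>F\<close>, to which it is connected inside
  the chain, and the chains are read off from a partition of the owners.
\<close>
lemma quotient_by_owner:
  assumes P: "partition_on Y P" and "sym R"
    and own: "\<And>x. x \<in> X \<Longrightarrow> own x \<in> Y" and rep: "\<And>y. y \<in> Y \<Longrightarrow> rep y \<in> X \<and> own (rep y) = y"
    and R: "\<And>x y. (x, y) \<in> R \<Longrightarrow> x \<in> X \<and> y \<in> X \<and> (\<exists>e\<in>P. own x \<in> e \<and> own y \<in> e)"
    and to_rep: "\<And>x. x \<in> X \<Longrightarrow> (rep (own x), x) \<in> R\<^sup>*"
    and in_block: "\<And>e y y'. e \<in> P \<Longrightarrow> y \<in> e \<Longrightarrow> y' \<in> e \<Longrightarrow> (rep y, rep y') \<in> R\<^sup>*"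
  shows "X // R\<^sup>* = (\<lambda>e. {x \<in> X. own x \<in> e}) ` P"
proof (rule quotient_rtrancl_eqI)
  let ?f = "\<lambda>e. {x \<in> X. own x \<in> e}"
  have sub: "e \<subseteq> Y" if "e \<in> P" for e using P that unfolding partition_on_def by blast
  have ne: "e \<noteq> {}" if "e \<in> P" for e using P that unfolding partition_on_def by blast
  show "partition_on X (?f ` P)"
  proof (rule partition_onI)
    show "\<Union>(?f ` P) = X" using own P unfolding partition_on_def by auto
    have "?f e \<noteq> {}" if eP: "e \<in> P" for e
    proof -
      obtain y where "y \<in> e" using ne[OF eP] by blast
      then have "rep y \<in> ?f e" using rep sub[OF eP] by auto
      then show ?thesis by blast
    qed
    then show "{} \<notin> ?f ` P" by fastforce
    fix c d assume "c \<in> ?f ` P" "d \<in> ?f ` P" "c \<noteq> d"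
    then obtain e e' where e: "e \<in> P" "e' \<in> P" "e \<noteq> e'" "c = ?f e" "d = ?f e'" by blast
    then have "e \<inter> e' = {}" using P unfolding partition_on_def disjoint_def by blast
    then show "disjnt c d" unfolding e disjnt_def by blast
  qed
  show "y \<in> c" if c: "c \<in> ?f ` P" "x \<in> c" "(x, y) \<in> R" for c x y
  proof -
    obtain e where e: "e \<in> P" "c = ?f e" using c by blast
    obtain e' where e': "e' \<in> P" "own x \<in> e'" "own y \<in> e'" "y \<in> X" using R[OF c(3)] by blast
    have "e = e'" using edge_eqI[OF P e(1) e'(1)] c(2) e'(2) unfolding e by blast
    then show ?thesis using e' e by simp
  qed
  show "\<exists>r. \<forall>y\<in>c. (r, y) \<in> R\<^sup>*" if c: "c \<in> ?f ` P" for c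
  proof -
    obtain e where e: "e \<in> P" "c = ?f e" using c by blast
    obtain y where y: "y \<in> e" using ne[OF e(1)] by blast
    have "(rep y, x) \<in> R\<^sup>*" if "x \<in> c" for x
      using in_block[OF e(1) y, of "own x"] to_rep[of x] that unfolding e by auto
    then show ?thesis by blast
  qed
qed (rule assms(2))

lemma chain_rel_glueE:
  assumes "(x, y) \<in> chain_rel (sum_edges G F) out_glued in_glued N"
  obtains (left) u v e where "x = Inl u" "y = Inl v" "e \<in> edges G" "u \<in> e" "v \<in> e"
    | (right) u v e where "x = Inr u" "y = Inr v" "e \<in> edges F" "u \<in> e" "v \<in> e"
    | (out) k where "k \<in> N" "x = out_glued k" "y = in_glued k"
    | ("in") k where "k \<in> N" "x = in_glued k" "y = out_glued k"
  using assms unfolding chain_rel_def by auto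

lemma chain_rel_glueI:
  "e \<in> edges G \<Longrightarrow> u \<in> e \<Longrightarrow> v \<in> e \<Longrightarrow> (Inl u, Inl v) \<in> chain_rel (sum_edges G F) out_glued in_glued N"
  "e' \<in> edges F \<Longrightarrow> u' \<in> e' \<Longrightarrow> v' \<in> e' \<Longrightarrow> (Inr u', Inr v') \<in> chain_rel (sum_edges G F) out_glued in_glued N"
  "k \<in> N \<Longrightarrow> (out_glued k, in_glued k) \<in> chain_rel (sum_edges G F) out_glued in_glued N"
  "k \<in> N \<Longrightarrow> (in_glued k, out_glued k) \<in> chain_rel (sum_edges G F) out_glued in_glued N"
  unfolding chain_rel_def by auto

text \<open>
  Graphs in which every incoming endpoint is joined by an edge to a flag \<open>f i\<close> that is not itself
  incoming: identities, permutations, stars and their juxtapositions.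
\<close>
definition leg_graph :: "'h rgraph \<Rightarrow> (nat \<Rightarrow> 'h flag) \<Rightarrow> bool" where
  "leg_graph G f \<longleftrightarrow> ribbon_graph G \<and> edges G = (\<lambda>i. {InEnd i, f i}) ` {..<ins G} \<and>
     (\<forall>i<ins G. f i \<notin> range InEnd) \<and> circles G = 0"

definition leg_subst :: "(nat \<Rightarrow> 'h flag) \<Rightarrow> 'g flag \<Rightarrow> ('h + 'g) flag" where
  "leg_subst f x = (case x of HalfEdge h \<Rightarrow> HalfEdge (Inr h) | InEnd i \<Rightarrow> InEnd i | OutEnd i \<Rightarrow> left_flag (f i))"

lemma leg_subst_simps [simp]:
  "leg_subst f (HalfEdge h) = HalfEdge (Inr h)" "leg_subst f (InEnd i) = InEnd i"
  "leg_subst f (OutEnd i) = left_flag (f i)"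
  by (simp_all add: leg_subst_def)

text \<open>
  Every leg of \<open>G\<close> lengthens one edge of \<open>F\<close>. No two edges of \<open>F\<close> are connected by \<open>G\<close>, so gluing merely
  replaces the outgoing endpoint \<open>i\<close> of \<open>F\<close> by \<open>f i\<close>.
\<close>
lemma glue_leg:
  fixes G :: "'h rgraph" and F :: "'g rgraph"
  assumes leg: "leg_graph G f" and F: "ribbon_graph F" and io: "ins G = outs F"
  shows "edges (glue G F) = (`) (leg_subst f) ` edges F" and "circles (glue G F) = circles F"
proof -
  have G: "ribbon_graph G" and EG: "edges G = (\<lambda>i. {InEnd i, f i}) ` {..<outs F}"
    and f: "\<And>i. i < outs F \<Longrightarrow> f i \<notin> range InEnd" and circ: "circles G = 0"
    using leg io unfolding leg_graph_def by auto
  note RG = ribbon_graphD[OF G] and RF = ribbon_graphD[OF F]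
  let ?X = "flags G <+> flags F" and ?N = "{..<outs F}"
  let ?R = "chain_rel (sum_edges G F) out_glued in_glued ?N"
  have f_in: "f i \<in> flags G" if "i < outs F" for i using RG(5) that unfolding EG by blast
  have f_inj: "i = j" if "i < outs F" "j < outs F" "f i = f j" for i j
  proof -
    have "{InEnd i, f i} = {InEnd j, f j}"
      by (rule edge_eqI[OF RG(3), of _ _ "f i"]) (use that in \<open>auto simp: EG\<close>)
    then show ?thesis using f[OF that(1)] f[OF that(2)] by (auto simp: doubleton_eq_iff)
  qed
  have flagsG: "u \<in> InEnd ` ?N \<or> u \<in> f ` ?N" if "u \<in> flags G" for u
    using that RG(3) unfolding EG partition_on_def by auto
  (* the leg of G through its incoming endpoint i belongs to the outgoing endpoint i of F *)
  define own :: "'h flag + 'g flag \<Rightarrow> 'g flag" where "own = (\<lambda>x. case x of Inr y \<Rightarrow> y | Inl u \<Rightarrow>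
    if u \<in> InEnd ` ?N then (case u of InEnd i \<Rightarrow> OutEnd i) else OutEnd (inv_into ?N f u))"
  have own_r: "own (Inr y) = y" for y by (simp add: own_def)
  have own_in: "own (Inl (InEnd i)) = OutEnd i" if "i < outs F" for i using that by (simp add: own_def)
  have own_f: "own (Inl (f i)) = OutEnd i" if "i < outs F" for i
  proof -
    have "inv_into ?N f (f i) = i" using that f_inj by (intro inv_into_f_f) (auto simp: inj_on_def)
    moreover have "f i \<notin> InEnd ` ?N" using f[OF that] by blast
    ultimately show ?thesis by (simp add: own_def)
  qed
  have ch: "chains G F = (\<lambda>e. {x \<in> ?X. own x \<in> e}) ` edges F"
    unfolding chains_eq
  proof (rule quotient_by_owner[where rep = Inr, OF RF(3) sym_chain_rel])
    show "own x \<in> flags F" if "x \<in> ?X" for x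
      using that flagsG own_r own_in own_f by (auto; fastforce)
    show "Inr y \<in> ?X \<and> own (Inr y) = y" if "y \<in> flags F" for y using that by (simp add: own_r InrI)
    show "x \<in> ?X \<and> y \<in> ?X \<and> (\<exists>e\<in>edges F. own x \<in> e \<and> own y \<in> e)" if xy: "(x, y) \<in> ?R" for x y
    proof -
      have X: "x \<in> ?X \<and> y \<in> ?X" using chain_rel_subset[OF chain_system_glue[OF G F io]] xy by blast
      have blk: "\<exists>e\<in>edges F. OutEnd k \<in> e" if "k < outs F" for k
        using that RF(3) unfolding partition_on_def by (metis OutEnd_in_flags Union_iff)
      from xy show ?thesis
      proof (cases rule: chain_rel_glueE)
        case (left u v e)
        then obtain i where i: "i < outs F" "e = {InEnd i, f i}" unfolding EG by blast
        then have "own x = OutEnd i" "own y = OutEnd i" using left own_in own_f by auto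
        then show ?thesis using X blk[OF i(1)] by auto
      next
        case (right u v e)
        then show ?thesis using X by (auto simp: own_r)
      next
        case (out k)
        then show ?thesis using X blk[of k] own_in by (auto simp: own_r)
      next
        case ("in" k)
        then show ?thesis using X blk[of k] own_in by (auto simp: own_r)
      qed
    qed
    show "(Inr (own x), x) \<in> ?R\<^sup>*" if xX: "x \<in> ?X" for x
    proof (cases x)
      case (Inr y)
      then show ?thesis by (simp add: own_r)
    next
      case (Inl u)
      then have "u \<in> InEnd ` ?N \<or> u \<in> f ` ?N" using xX flagsG by auto
      then consider i where "i < outs F" "u = InEnd i" | i where "i < outs F" "u = f i" by auto
      then show ?thesis
      proof cases
        case 1
        then show ?thesis using chain_rel_glueI(3)[of i ?N G F] Inl own_in by auto
      next
        case 2
        then have "(Inr (OutEnd i), Inl (InEnd i)) \<in> ?R" "(Inl (InEnd i), Inl (f i)) \<in> ?R"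
          using chain_rel_glueI(3)[of i ?N G F] chain_rel_glueI(1)[of "{InEnd i, f i}" G] EG by auto
        then show ?thesis using 2 Inl own_f by (auto intro: rtrancl_trans)
      qed
    qed
    show "(Inr y, Inr y') \<in> ?R\<^sup>*" if "e \<in> edges F" "y \<in> e" "y' \<in> e" for e y y'
      using chain_rel_glueI(2)[OF that] by blast
  qed
  have ends: "chain_ends {x \<in> ?X. own x \<in> e} = leg_subst f ` e" if eF: "e \<in> edges F" for e
  proof -
    have "z \<in> chain_ends {x \<in> ?X. own x \<in> e} \<longleftrightarrow> z \<in> leg_subst f ` e" for z
    proof
      assume "z \<in> chain_ends {x \<in> ?X. own x \<in> e}"
      then obtain x where x: "x \<in> ?X" "own x \<in> e" "outer_flag x = Some z"
        unfolding chain_ends_def Option.these_def by force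
      show "z \<in> leg_subst f ` e"
      proof (cases x)
        case (Inl u)
        then have "u \<in> InEnd ` ?N \<or> u \<in> f ` ?N" using x(1) flagsG by auto
        moreover have "u \<notin> InEnd ` ?N" using x(3) Inl by auto
        ultimately obtain i where i: "i < outs F" "u = f i" by blast
        then have "z = left_flag (f i)" using x(3) Inl f[OF i(1)] by (cases "f i") auto
        then have "z = leg_subst f (own x)" using own_f[OF i(1)] i Inl by simp
        then show ?thesis using x(2) by blast
      next
        case (Inr y)
        then have "z = leg_subst f (own x)" using x(3) by (cases y) (auto simp: own_r)
        then show ?thesis using x(2) by blast
      qed
    next
      assume "z \<in> leg_subst f ` e"
      then obtain y where y: "y \<in> e" "z = leg_subst f y" by blast
      have yF: "y \<in> flags F" using RF(5) eF y by blast
      have "\<exists>x\<in>?X. own x = y \<and> outer_flag x = Some z"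
      proof (cases y)
        case (OutEnd i)
        then have i: "i < outs F" using yF by simp
        show ?thesis
          by (rule bexI[of _ "Inl (f i)"])
            (use own_f[OF i] f_in[OF i] f[OF i] y OutEnd in \<open>cases "f i"; auto\<close>)+
      next
        case (HalfEdge h)
        then show ?thesis using yF y by (intro bexI[of _ "Inr y"]) (auto simp: own_r)
      next
        case (InEnd h)
        then show ?thesis using yF y by (intro bexI[of _ "Inr y"]) (auto simp: own_r)
      qed
      then show "z \<in> chain_ends {x \<in> ?X. own x \<in> e}"
        using y(1) unfolding chain_ends_def Option.these_def by force
    qed
    then show ?thesis by blast
  qed
  have ne: "e \<noteq> {}" if "e \<in> edges F" for e using RF(3) that unfolding partition_on_def by blast
  have "chain_ends ` chains G F = (`) (leg_subst f) ` edges F"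
    unfolding ch image_image using ends by (intro image_cong refl)
  moreover have "{} \<notin> (`) (leg_subst f) ` edges F" using ne by auto
  ultimately show "edges (glue G F) = (`) (leg_subst f) ` edges F" by (simp add: glue_def)
  have "{c \<in> chains G F. chain_ends c = {}} = {}" unfolding ch using ends ne by auto
  then have "card {c \<in> chains G F. chain_ends c = {}} = 0" by (simp only: card.empty)
  then show "circles (glue G F) = circles F" using circ by (simp add: glue_def)
qed

lemma disjnt_insert_blocks:
  assumes "\<And>e. e \<in> Q \<Longrightarrow> disjnt B e" "\<And>e e'. e \<in> Q \<Longrightarrow> e' \<in> Q \<Longrightarrow> e \<noteq> e' \<Longrightarrow> disjnt e e'"
    and "e \<in> insert B Q" "e' \<in> insert B Q" "e \<noteq> e'"
  shows "disjnt e e'"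
  using assms disjnt_sym[of B] by auto

lemma edges_id: "edges (id_graph q) = (\<lambda>i. {InEnd i, OutEnd i}) ` {..<q}"
  by (auto simp: id_graph_def)

text \<open>
  The outgoing endpoints 0 and 1 are consumed by the coupling, the others move down by two.
\<close>
definition coupling_subst :: "'h flag \<Rightarrow> ('g + 'h) flag" where
  "coupling_subst x = (case x of HalfEdge h \<Rightarrow> HalfEdge (Inr h) | InEnd i \<Rightarrow> InEnd i | OutEnd j \<Rightarrow> OutEnd (j - 2))"

lemma coupling_subst_simps [simp]:
  "coupling_subst (HalfEdge h) = HalfEdge (Inr h)" "coupling_subst (InEnd i) = InEnd i"
  "coupling_subst (OutEnd j) = OutEnd (j - 2)"
  by (simp_all add: coupling_subst_def)

abbreviation joined_edge :: "'h rgraph \<Rightarrow> 'h flag set" where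
  "joined_edge K \<equiv> \<Union>{e \<in> edges K. OutEnd 0 \<in> e \<or> OutEnd 1 \<in> e}"

abbreviation other_edges :: "'h rgraph \<Rightarrow> 'h flag set set" where
  "other_edges K \<equiv> {e \<in> edges K. OutEnd 0 \<notin> e \<and> OutEnd 1 \<notin> e}"

text \<open>
  The one elementary gluing that connects edges: the coupling joins the first two outgoing endpoints
  of \<open>K\<close>. If they are the ends of the same edge, a circle arises.
\<close>
lemma glue_coupling:
  fixes K :: "'h rgraph"
  assumes K: "ribbon_graph K" and outs: "outs K = 2 + q"
  defines "H \<equiv> juxtapose coupling_graph (id_graph q)"
  shows "edges (glue H K) = insert (coupling_subst ` (joined_edge K - {OutEnd 0, OutEnd 1}))
      ((`) coupling_subst ` other_edges K) - {{}}"
    and "circles (glue H K) = circles K + (if joined_edge K \<subseteq> {OutEnd 0, OutEnd 1} then 1 else 0)"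
proof -
  have H: "ribbon_graph H"
    unfolding H_def by (intro ribbon_graph_juxtapose ribbon_graph_coupling ribbon_graph_id)
  have io: "ins H = outs K" and oH: "outs H = q" and hH: "halfs H = {}" and cH: "circles H = 0"
    by (auto simp: H_def outs coupling_graph_def id_graph_def)
  have EH: "edges H = insert {InEnd 0, InEnd 1} ((\<lambda>j. {InEnd (2 + j), OutEnd j}) ` {..<q})"
    unfolding H_def edges_juxtapose edges_id image_image by (simp add: coupling_graph_def)
  note RK = ribbon_graphD[OF K]
  let ?X = "flags H <+> flags K" and ?N = "{..<outs K}"
  let ?R = "chain_rel (sum_edges H K) out_glued in_glued ?N"
  let ?B = "joined_edge K"
  let ?P = "insert ?B (other_edges K)"
  have blk: "\<exists>e\<in>edges K. y \<in> e" if "y \<in> flags K" for y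
    using that RK(3) unfolding partition_on_def by (metis Union_iff)
  have O: "OutEnd 0 \<in> ?B" "OutEnd 1 \<in> ?B" using blk[of "OutEnd 0"] blk[of "OutEnd 1"] outs by auto
  have edgeP: "\<exists>e'\<in>?P. e \<subseteq> e'" if eK: "e \<in> edges K" for e
  proof (cases "OutEnd 0 \<in> e \<or> OutEnd 1 \<in> e")
    case True
    then have "e \<subseteq> ?B" using eK by blast
    then show ?thesis by (rule bexI[OF _ insertI1])
  next
    case False
    then have "e \<in> ?P" using eK by simp
    then show ?thesis by blast
  qed
  have blkP: "\<exists>e\<in>?P. y \<in> e" if "y \<in> flags K" for y
    using blk[OF that] edgeP by (meson subsetD)
  have P: "partition_on (flags K) ?P"
  proof (rule partition_onI)
    show "\<Union>?P = flags K" using RK(3) unfolding partition_on_def by blast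
    show "{} \<notin> ?P" using O RK(3) unfolding partition_on_def by blast
    have B: "disjnt ?B e" if "e \<in> other_edges K" for e
    proof -
      have "e' \<inter> e = {}" if e': "e' \<in> edges K" "OutEnd 0 \<in> e' \<or> OutEnd 1 \<in> e'" for e'
        using edge_eqI[OF RK(3) e'(1), of e] e'(2) \<open>e \<in> other_edges K\<close> by blast
      then show ?thesis unfolding disjnt_def by blast
    qed
    have o: "disjnt e e'" if "e \<in> other_edges K" "e' \<in> other_edges K" "e \<noteq> e'" for e e'
      using that RK(3) unfolding partition_on_def disjoint_def disjnt_def by blast
    show "disjnt e e'" if "e \<in> ?P" "e' \<in> ?P" "e \<noteq> e'" for e e'
      by (rule disjnt_insert_blocks[OF B o that])
  qed
  define B where "B = ?B"
  define P where "P = insert B (other_edges K)"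
  note facts = O[folded B_def] edgeP[folded B_def, folded P_def] blkP[folded B_def, folded P_def]
    P[folded B_def, folded P_def]
  have BP: "B \<in> P" unfolding P_def by (rule insertI1)
  have P_cases: "e = B \<or> e \<in> edges K" if "e \<in> P" for e using that unfolding P_def by auto
  have B_elim: "\<exists>e\<in>edges K. (OutEnd 0 \<in> e \<or> OutEnd 1 \<in> e) \<and> y \<in> e" if "y \<in> B" for y
    using that unfolding B_def by blast
  (* strand j of the identity part enters at the incoming endpoint 2 + j *)
  define ow :: "(nat + nat) flag + 'h flag \<Rightarrow> 'h flag" where
    "ow = (\<lambda>x. case x of Inr y \<Rightarrow> y | Inl u \<Rightarrow> (case u of InEnd i \<Rightarrow> OutEnd i | OutEnd j \<Rightarrow> OutEnd (2 + j)))"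
  have ow: "ow (Inr y) = y" "ow (Inl (InEnd i)) = OutEnd i" "ow (Inl (OutEnd j)) = OutEnd (2 + j)" for y i j
    by (simp_all add: ow_def)
  have XH: "(\<exists>i<outs K. u = InEnd i) \<or> (\<exists>j<q. u = OutEnd j)" if "u \<in> flags H" for u
    using that hH io oH by (auto simp: flags_def)
  have ch: "chains H K = (\<lambda>e. {x \<in> ?X. ow x \<in> e}) ` P"
    unfolding chains_eq
  proof (rule quotient_by_owner[where rep = Inr, OF facts(5) sym_chain_rel])
    show "ow x \<in> flags K" if "x \<in> ?X" for x
    proof (cases x)
      case (Inl u)
      then have "u \<in> flags H" using that by auto
      then show ?thesis using XH[of u] outs Inl by (auto simp: ow)
    next
      case (Inr y)
      then show ?thesis using that by (auto simp: ow)
    qed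
    show "Inr y \<in> ?X \<and> ow (Inr y) = y" if "y \<in> flags K" for y using that by (simp add: ow InrI)
    show "x \<in> ?X \<and> y \<in> ?X \<and> (\<exists>e\<in>P. ow x \<in> e \<and> ow y \<in> e)" if xy: "(x, y) \<in> ?R" for x y
    proof -
      have X: "x \<in> ?X \<and> y \<in> ?X" using chain_rel_subset[OF chain_system_glue[OF H K io]] xy by blast
      have k: "\<exists>e\<in>P. OutEnd k \<in> e" if "k < outs K" for k using facts(4) that by simp
      from xy have "\<exists>e\<in>P. ow x \<in> e \<and> ow y \<in> e"
      proof (cases rule: chain_rel_glueE)
        case (left u v e)
        then consider "e = {InEnd 0, InEnd 1}" | j where "j < q" "e = {InEnd (2 + j), OutEnd j}"
          unfolding EH by auto
        then show ?thesis
        proof cases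
          case 1
          then have "ow x \<in> B" "ow y \<in> B" using left facts(1,2) by (auto simp: ow)
          then show ?thesis using BP by blast
        next
          case 2
          then have "ow x = OutEnd (2 + j)" "ow y = OutEnd (2 + j)" using left by (auto simp: ow)
          then show ?thesis using k[of "2 + j"] 2 outs by auto
        qed
      next
        case (right u v e)
        then show ?thesis using facts(3)[of e] by (auto simp: ow)
      next
        case (out j)
        then show ?thesis using k[of j] by (auto simp: ow)
      next
        case ("in" j)
        then show ?thesis using k[of j] by (auto simp: ow)
      qed
      then show ?thesis using X by blast
    qed
    have oi: "(Inr (OutEnd i), Inl (InEnd i)) \<in> ?R" "(Inl (InEnd i), Inr (OutEnd i)) \<in> ?R" if "i < outs K" for i
      using chain_rel_glueI(3,4)[of i ?N H K] that by auto
    show "(Inr (ow x), x) \<in> ?R\<^sup>*" if xX: "x \<in> ?X" for x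
    proof (cases x)
      case (Inr y)
      then show ?thesis by (simp add: ow)
    next
      case (Inl u)
      then consider i where "i < outs K" "u = InEnd i" | j where "j < q" "u = OutEnd j"
        using xX XH by blast
      then show ?thesis
      proof cases
        case 1
        then show ?thesis using oi Inl by (auto simp: ow)
      next
        case 2
        then have "(Inr (OutEnd (2 + j)), Inl (InEnd (2 + j))) \<in> ?R" "(Inl (InEnd (2 + j)), Inl (OutEnd j)) \<in> ?R"
          using oi(1)[of "2 + j"] chain_rel_glueI(1)[of "{InEnd (2 + j), OutEnd j}" H] EH outs by auto
        then show ?thesis using 2 Inl by (auto simp: ow intro: rtrancl_trans)
      qed
    qed
    have one: "(Inr y, Inr y') \<in> ?R\<^sup>*" if "e \<in> edges K" "y \<in> e" "y' \<in> e" for e y y'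
      using chain_rel_glueI(2)[OF that] by blast
    have "(Inl (InEnd 0), Inl (InEnd 1)) \<in> ?R"
      using chain_rel_glueI(1)[of "{InEnd 0, InEnd 1}" H] EH by auto
    then have z1: "(Inr (OutEnd 0), Inr (OutEnd 1)) \<in> ?R\<^sup>*"
      using oi(1)[of 0] oi(2)[of 1] outs by (auto intro: rtrancl_trans)
    then have z2: "(Inr (OutEnd 1), Inr (OutEnd 0)) \<in> ?R\<^sup>*"
      using sym_rtrancl[OF sym_chain_rel] by (rule symD[rotated])
    have toO: "(Inr y, Inr (OutEnd 0)) \<in> ?R\<^sup>*" if y: "y \<in> B" for y
    proof -
      obtain e where "e \<in> edges K" "OutEnd 0 \<in> e \<or> OutEnd 1 \<in> e" "y \<in> e" using B_elim[OF y] by blast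
      then have "(Inr y, Inr (OutEnd 0)) \<in> ?R\<^sup>* \<or> (Inr y, Inr (OutEnd 1)) \<in> ?R\<^sup>*" using one by blast
      then show ?thesis using z2 by (auto intro: rtrancl_trans)
    qed
    show "(Inr y, Inr y') \<in> ?R\<^sup>*" if e: "e \<in> P" "y \<in> e" "y' \<in> e" for e y y'
    proof (cases "e = B")
      case True
      have "(Inr (OutEnd 0), Inr y') \<in> ?R\<^sup>*"
        using symD[OF sym_rtrancl[OF sym_chain_rel] toO] e True by blast
      then show ?thesis using toO e True by (auto intro: rtrancl_trans)
    next
      case False
      then have "e \<in> edges K" using P_cases e(1) by blast
      then show ?thesis using e one by blast
    qed
  qed
  have ends: "chain_ends {x \<in> ?X. ow x \<in> e} = coupling_subst ` (e - {OutEnd 0, OutEnd 1})" if eP: "e \<in> P" for e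
  proof -
    have "z \<in> chain_ends {x \<in> ?X. ow x \<in> e} \<longleftrightarrow> z \<in> coupling_subst ` (e - {OutEnd 0, OutEnd 1})" for z
    proof
      assume "z \<in> chain_ends {x \<in> ?X. ow x \<in> e}"
      then obtain x where x: "x \<in> ?X" "ow x \<in> e" "outer_flag x = Some z"
        unfolding chain_ends_def Option.these_def by force
      have "z = coupling_subst (ow x) \<and> ow x \<notin> {OutEnd 0, OutEnd 1}"
        using x(3) x(1) hH by (cases x rule: outer_flag.cases) (auto simp: ow)
      then show "z \<in> coupling_subst ` (e - {OutEnd 0, OutEnd 1})" using x(2) by blast
    next
      assume "z \<in> coupling_subst ` (e - {OutEnd 0, OutEnd 1})"
      then obtain y where y: "y \<in> e" "y \<noteq> OutEnd 0" "y \<noteq> OutEnd 1" "z = coupling_subst y" by blast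
      have yK: "y \<in> flags K" using facts(5) eP y(1) unfolding partition_on_def by blast
      have "\<exists>x\<in>?X. ow x = y \<and> outer_flag x = Some z"
      proof (cases y)
        case (OutEnd i)
        then have "2 \<le> i" using y(2,3) by (cases i; cases "i - 1") auto
        then show ?thesis
          using OutEnd yK y(4) oH outs by (intro bexI[of _ "Inl (OutEnd (i - 2))"]) (auto simp: ow)
      next
        case (HalfEdge h)
        then show ?thesis using yK y by (intro bexI[of _ "Inr y"]) (auto simp: ow)
      next
        case (InEnd h)
        then show ?thesis using yK y by (intro bexI[of _ "Inr y"]) (auto simp: ow)
      qed
      then show "z \<in> chain_ends {x \<in> ?X. ow x \<in> e}"
        using y(1) unfolding chain_ends_def Option.these_def by force
    qed
    then show ?thesis by blast
  qed
  have oth: "e - {OutEnd 0, OutEnd 1} = e \<and> e \<noteq> {}" if "e \<in> other_edges K" for e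
    using that RK(3) unfolding partition_on_def by auto
  have "chain_ends ` chains H K = (\<lambda>e. coupling_subst ` (e - {OutEnd 0, OutEnd 1})) ` P"
    unfolding ch image_image using ends by (intro image_cong refl)
  also have "\<dots> = insert (coupling_subst ` (B - {OutEnd 0, OutEnd 1})) ((`) coupling_subst ` other_edges K)"
    unfolding P_def image_insert using oth by (intro arg_cong[where f = "insert _"] image_cong refl) simp
  finally show "edges (glue H K) = insert (coupling_subst ` (?B - {OutEnd 0, OutEnd 1}))
      ((`) coupling_subst ` other_edges K) - {{}}" by (simp add: glue_def B_def)
  let ?c = "{x \<in> ?X. ow x \<in> B}"
  have "{c \<in> chains H K. chain_ends c = {}} = (if B \<subseteq> {OutEnd 0, OutEnd 1} then {?c} else {})"
  proof -
    have "chain_ends ?c = {} \<longleftrightarrow> B \<subseteq> {OutEnd 0, OutEnd 1}"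
      using ends[OF BP] by auto
    moreover have "chain_ends {x \<in> ?X. ow x \<in> e} \<noteq> {}" if "e \<in> other_edges K" for e
      using ends[of e] oth[OF that] that unfolding P_def by auto
    ultimately show ?thesis unfolding ch P_def by auto
  qed
  then show "circles (glue H K) = circles K + (if ?B \<subseteq> {OutEnd 0, OutEnd 1} then 1 else 0)"
    unfolding B_def[symmetric] using cH by (simp add: glue_def)
qed

section \<open>Ribbon graphs are generated by the elementary ones\<close>

definition copairing_graph :: "nat rgraph" where
  "copairing_graph = \<lparr>ins = 0, outs = 2, halfs = {}, nxt = id, edges = {{OutEnd 0, OutEnd 1}}, circles = 0\<rparr>"

lemma ribbon_graph_copairing: "ribbon_graph copairing_graph"
  by (auto simp: ribbon_graph_def copairing_graph_def flags_def partition_on_def disjoint_def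
      permutes_id less_2_cases_iff)

lemma id_graph_simps [simp]:
  "ins (id_graph n) = n" "outs (id_graph n) = n" "halfs (id_graph n) = {}" "nxt (id_graph n) = id" "circles (id_graph n) = 0"
  by (simp_all add: id_graph_def)

subsection \<open>Permuting the outgoing endpoints\<close>

definition out_map :: "(nat \<Rightarrow> nat) \<Rightarrow> 'h flag \<Rightarrow> 'h flag" where
  "out_map \<sigma> x = (case x of OutEnd i \<Rightarrow> OutEnd (\<sigma> i) | _ \<Rightarrow> x)"

lemma out_map_simps [simp]:
  "out_map \<sigma> (HalfEdge h) = HalfEdge h" "out_map \<sigma> (InEnd i) = InEnd i" "out_map \<sigma> (OutEnd i) = OutEnd (\<sigma> i)"
  by (simp_all add: out_map_def)

lemma out_map_comp: "out_map \<sigma> (out_map \<tau> x) = out_map (\<sigma> \<circ> \<tau>) x"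
  by (cases x) auto

lemma out_map_id [simp]: "out_map id x = x" by (cases x) auto

definition permute_outs :: "(nat \<Rightarrow> nat) \<Rightarrow> 'h rgraph \<Rightarrow> 'h rgraph" where
  "permute_outs \<sigma> G = G\<lparr>edges := (`) (out_map \<sigma>) ` edges G\<rparr>"

lemma permute_outs_simps [simp]:
  "ins (permute_outs \<sigma> G) = ins G" "outs (permute_outs \<sigma> G) = outs G" "halfs (permute_outs \<sigma> G) = halfs G"
  "nxt (permute_outs \<sigma> G) = nxt G" "circles (permute_outs \<sigma> G) = circles G"
  "edges (permute_outs \<sigma> G) = (`) (out_map \<sigma>) ` edges G"
  by (simp_all add: permute_outs_def)

lemma permute_outs_comp: "permute_outs \<sigma> (permute_outs \<tau> G) = permute_outs (\<sigma> \<circ> \<tau>) G"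
  by (simp add: permute_outs_def image_image out_map_comp)

lemma permute_outs_id: "permute_outs id G = G"
  by (simp add: permute_outs_def)

lemma flags_permute_outs: "flags (permute_outs \<sigma> G) = flags G"
  by (simp add: flags_def)

lemma ribbon_graph_permute_outs:
  assumes "ribbon_graph G" "\<sigma> permutes {..<outs G}"
  shows "ribbon_graph (permute_outs \<sigma> G)"
proof (rule ribbon_graphI_image[OF assms(1), of "out_map \<sigma>"])
  show "inj_on (out_map \<sigma>) (flags G)"
  proof (rule inj_onI)
    fix x y :: "'a flag" assume "out_map \<sigma> x = out_map \<sigma> y"
    then show "x = y" using permutes_inj[OF assms(2)] by (cases x; cases y) (auto simp: inj_eq)
  qed
  have "out_map \<sigma> ` flags G = HalfEdge ` halfs G \<union> InEnd ` {..<ins G} \<union> OutEnd ` \<sigma> ` {..<outs G}"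
    by (simp add: flags_def image_Un image_image)
  then show "flags (permute_outs \<sigma> G) = out_map \<sigma> ` flags G"
    unfolding permutes_image[OF assms(2)] by (simp add: flags_def)
qed (use ribbon_graphD[OF assms(1)] in auto)

definition perm_graph :: "(nat \<Rightarrow> nat) \<Rightarrow> nat \<Rightarrow> nat rgraph" where
  "perm_graph \<sigma> n = permute_outs \<sigma> (id_graph n)"

lemma ribbon_graph_perm: "\<sigma> permutes {..<n} \<Longrightarrow> ribbon_graph (perm_graph \<sigma> n)"
  unfolding perm_graph_def by (rule ribbon_graph_permute_outs[OF ribbon_graph_id]) (simp add: id_graph_def)

lemma perm_graph_simps [simp]:
  "ins (perm_graph \<sigma> n) = n" "outs (perm_graph \<sigma> n) = n" "halfs (perm_graph \<sigma> n) = {}" "circles (perm_graph \<sigma> n) = 0"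
  by (simp_all add: perm_graph_def id_graph_def)

lemma edges_perm: "edges (perm_graph \<sigma> n) = (\<lambda>i. {InEnd i, OutEnd (\<sigma> i)}) ` {..<n}"
  by (simp add: perm_graph_def edges_id image_image)

lemma leg_perm: "\<sigma> permutes {..<n} \<Longrightarrow> leg_graph (perm_graph \<sigma> n) (\<lambda>i. OutEnd (\<sigma> i))"
  unfolding leg_graph_def by (simp add: ribbon_graph_perm edges_perm image_iff)

lemma leg_id: "leg_graph (id_graph n) OutEnd"
  unfolding leg_graph_def using edges_id[of n] ribbon_graph_id[of n] by (auto simp: id_graph_def)

lemma leg_crossing: "leg_graph crossing_graph (\<lambda>i. OutEnd (1 - i))"
  unfolding leg_graph_def using ribbon_graph_crossing
  by (auto simp: crossing_graph_def lessThan_Suc numeral_2_eq_2)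

lemma leg_star: "leg_graph (star_graph r) HalfEdge"
  unfolding leg_graph_def using ribbon_graph_star[of r] by (auto simp: star_graph_def image_iff)

lemma leg_juxtapose:
  assumes G: "leg_graph G f" and F: "leg_graph F g"
  shows "leg_graph (juxtapose G F) (\<lambda>k. if k < ins G then left_flag (f k) else right_flag G (g (k - ins G)))"
    (is "leg_graph _ ?h")
proof -
  have "(\<lambda>k. {InEnd k, ?h k}) ` {..<ins G + ins F} =
      (\<lambda>k. {InEnd k, left_flag (f k)}) ` {..<ins G} \<union> (\<lambda>k. {InEnd (ins G + k), right_flag G (g k)}) ` {..<ins F}"
    unfolding image_add_lessThan_Un image_Un image_image by (intro arg_cong2[where f = "(\<union>)"] image_cong refl) auto
  moreover have "edges (juxtapose G F) = \<dots>"
    unfolding edges_juxtapose using G F by (simp add: leg_graph_def image_image)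
  moreover have "?h k \<notin> range InEnd" if "k < ins G + ins F" for k
  proof (cases "k < ins G")
    case True
    then have "f k \<notin> range InEnd" using G by (auto simp: leg_graph_def)
    then show ?thesis using True by (cases "f k") auto
  next
    case False
    then have "k - ins G < ins F" using that by simp
    then have "g (k - ins G) \<notin> range InEnd" using F unfolding leg_graph_def by blast
    then show ?thesis using False by (cases "g (k - ins G)") auto
  qed
  ultimately show ?thesis
    using G F ribbon_graph_juxtapose unfolding leg_graph_def by auto
qed

lemma glue_perm:
  fixes F :: "'h rgraph"
  assumes F: "ribbon_graph F" and \<sigma>: "\<sigma> permutes {..<outs F}"
  shows "rgraph_iso (permute_outs \<sigma> F) (glue (perm_graph \<sigma> (outs F)) F)"
proof (rule rgraph_isoI[where \<phi> = Inr])
  note g = glue_leg[OF leg_perm[OF \<sigma>] F, simplified]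
  show "bij_betw Inr (halfs (permute_outs \<sigma> F)) (halfs (glue (perm_graph \<sigma> (outs F)) F))"
    by (auto simp: bij_betw_def inj_on_def Plus_def)
  have "leg_subst (\<lambda>i. OutEnd (\<sigma> i)) = (\<lambda>x :: 'h flag. map_flag Inr (out_map \<sigma> x) :: (nat + 'h) flag)"
  proof
    show "leg_subst (\<lambda>i. OutEnd (\<sigma> i)) x = map_flag Inr (out_map \<sigma> x)" for x by (cases x) auto
  qed
  then show "edges (glue (perm_graph \<sigma> (outs F)) F) = (`) (map_flag Inr) ` edges (permute_outs \<sigma> F)"
    by (simp add: g(1) image_image)
  show "circles (permute_outs \<sigma> F) = circles (glue (perm_graph \<sigma> (outs F)) F)" by (simp add: g(2))
qed auto

lemma adjacent_transposition_iso:
  assumes "Suc i < n"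
  shows "rgraph_iso (juxtapose (juxtapose (id_graph i) crossing_graph) (id_graph (n - i - 2)))
    (perm_graph (transpose i (Suc i)) n)"
    (is "rgraph_iso ?J _")
proof (rule rgraph_isoI[where \<phi> = "\<lambda>_. undefined"])
  define h where "h = (\<lambda>k. if k < i + 2
    then left_flag (if k < i then left_flag (OutEnd k) else right_flag (id_graph i) (OutEnd (1 - (k - i))))
    else right_flag (juxtapose (id_graph i) crossing_graph) (OutEnd (k - (i + 2)) :: nat flag))"
  have io: "ins crossing_graph = 2" "outs crossing_graph = 2" by (simp_all add: crossing_graph_def)
  have "leg_graph ?J h"
    using leg_juxtapose[OF leg_juxtapose[OF leg_id[of i] leg_crossing] leg_id[of "n - i - 2"]]
    unfolding h_def by (simp only: io id_graph_simps juxtapose_simps)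
  moreover have "i + 2 + (n - i - 2) = n" using assms by simp
  ultimately have "edges ?J = (\<lambda>k. {InEnd k, h k}) ` {..<n}"
    unfolding leg_graph_def by (simp only: io id_graph_simps juxtapose_simps)
  moreover have "map_flag (\<lambda>_. undefined) (h k) = (OutEnd (transpose i (Suc i) k) :: nat flag)" for k
  proof -
    consider "k < i" | "k = i" | "k = Suc i" | "k \<ge> i + 2" by linarith
    then show ?thesis by cases (auto simp: h_def io Transposition.transpose_def)
  qed
  ultimately show "edges (perm_graph (transpose i (Suc i)) n) = (`) (map_flag (\<lambda>_. undefined)) ` edges ?J"
    unfolding edges_perm by (simp add: image_image)
qed (use assms in \<open>auto simp: crossing_graph_def bij_betw_def Plus_def\<close>)

text \<open>
  Adjacent transpositions are all that the crossing provides. A transposition of \<open>a\<close> and \<open>b + 1\<close> is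
  that of \<open>a\<close> and \<open>b\<close> conjugated by the adjacent one of \<open>b\<close> and \<open>b + 1\<close>, which gives all
  transpositions and hence all permutations.
\<close>
lemma adjacent_induct [consumes 1, case_names id adjacent]:
  assumes \<sigma>: "\<sigma> permutes {..<n::nat}" and id: "P id"
    and step: "\<And>i \<tau>. Suc i < n \<Longrightarrow> \<tau> permutes {..<n} \<Longrightarrow> P \<tau> \<Longrightarrow> P (transpose i (Suc i) \<circ> \<tau>)"
  shows "P \<sigma>"
proof -
  have tr: "transpose a b permutes {..<n}" if "a < n" "b < n" for a b
    using that by (intro permutes_swap_id) auto
  have swap: "P (transpose a (Suc (a + k)) \<circ> \<tau>)" if "Suc (a + k) < n" "\<tau> permutes {..<n}" "P \<tau>" for a k \<tau>
    using that
  proof (induction k arbitrary: \<tau>)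
    case 0
    then show ?case using step[of a \<tau>] by (simp only: add_0_right)
  next
    case (Suc k)
    let ?c = "Suc (a + k)"
    let ?s = "transpose ?c (Suc ?c)"
    have s: "?s permutes {..<n}" using Suc.prems by (intro tr) auto
    have "P (?s \<circ> \<tau>)" "(?s \<circ> \<tau>) permutes {..<n}"
      using step[of ?c \<tau>] Suc.prems permutes_compose[OF Suc.prems(2) s] by simp_all
    moreover have lt: "Suc (a + k) < n" "Suc ?c < n" "a < n" using Suc.prems(1) by simp_all
    ultimately have "P (transpose a ?c \<circ> (?s \<circ> \<tau>))" "(transpose a ?c \<circ> (?s \<circ> \<tau>)) permutes {..<n}"
      using Suc.IH[OF lt(1)] permutes_compose[OF _ tr[OF lt(3) lt(1)]] by blast+
    then have "P (?s \<circ> (transpose a ?c \<circ> (?s \<circ> \<tau>)))" using step[OF lt(2)] by blast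
    moreover have "?s \<circ> (transpose a ?c \<circ> (?s \<circ> \<tau>)) = transpose a (Suc (a + Suc k)) \<circ> \<tau>"
      by (auto simp: fun_eq_iff Transposition.transpose_def)
    ultimately show ?case by (simp only:)
  qed
  have "P \<sigma>" if "\<sigma> permutes {..<n}" using that finite_lessThan
  proof (induction rule: permutes_induct)
    case id
    show ?case by (rule assms(2))
  next
    case (swap a b p)
    have "P (transpose a b \<circ> p)" if "a < b" "b < n" for a b
    proof -
      have "Suc (a + (b - Suc a)) = b" using that by simp
      then show ?thesis using \<open>\<And>a k \<tau>. Suc (a + k) < n \<Longrightarrow> \<tau> permutes {..<n} \<Longrightarrow> P \<tau> \<Longrightarrow> P (transpose a (Suc (a + k)) \<circ> \<tau>)\<close>[of a "b - Suc a" p]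
        swap that by simp
    qed
    then show ?case using swap by (metis lessThan_iff linorder_neqE_nat transpose_commute)
  qed
  then show ?thesis using \<sigma> .
qed

subsection \<open>Bending, circles and vertices\<close>

definition bend_flag :: "'h flag \<Rightarrow> 'h flag" where
  "bend_flag x = (case x of HalfEdge h \<Rightarrow> HalfEdge h | InEnd i \<Rightarrow> (case i of 0 \<Rightarrow> OutEnd 0 | Suc i \<Rightarrow> InEnd i) | OutEnd j \<Rightarrow> OutEnd (Suc j))"

lemma bend_flag_simps [simp]:
  "bend_flag (HalfEdge h) = HalfEdge h" "bend_flag (InEnd 0) = OutEnd 0" "bend_flag (InEnd (Suc i)) = InEnd i"
  "bend_flag (OutEnd j) = OutEnd (Suc j)"
  by (simp_all add: bend_flag_def)

definition bend :: "'h rgraph \<Rightarrow> 'h rgraph" where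
  "bend G = G\<lparr>ins := ins G - 1, outs := Suc (outs G), edges := (`) bend_flag ` edges G\<rparr>"

lemma inj_bend_flag: "inj bend_flag"
proof (rule injI)
  fix x y :: "'h flag" assume "bend_flag x = bend_flag y"
  then show "x = y" by (cases x; cases y) (auto simp: bend_flag_def split: nat.splits)
qed

lemma ribbon_graph_bend:
  assumes "ribbon_graph G" "ins G = Suc p"
  shows "ribbon_graph (bend G)"
proof (rule ribbon_graphI_image[OF assms(1), of bend_flag])
  show "inj_on bend_flag (flags G)" using inj_bend_flag by (rule inj_on_subset) simp
  show "flags (bend G) = bend_flag ` flags G"
    using assms(2) unfolding flags_def bend_def
    by (simp add: image_Un image_image lessThan_Suc_eq_insert_0)
qed (use ribbon_graphD[OF assms(1)] in \<open>auto simp: bend_def\<close>)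

lemma bij_betw_Inr_Inr: "bij_betw (Inr \<circ> Inr) A (({} <+> {}) <+> ({} <+> A))"
  by (auto simp: bij_betw_def inj_on_def Plus_def image_image)

text \<open>
  Bending an incoming endpoint to the outgoing side is undone by the coupling. This allows to get rid
  of incoming endpoints, and for the identity on one strand (\<open>bend_id\<close>) it is the snake identity.
\<close>
lemma bend_iso:
  fixes G :: "'a rgraph"
  assumes G: "ribbon_graph G" and p: "ins G = Suc p"
  shows "rgraph_iso G (glue (juxtapose coupling_graph (id_graph (outs G))) (juxtapose (id_graph 1) (bend G)))"
proof -
  let ?K = "juxtapose (id_graph 1) (bend G)"
  note RG = ribbon_graphD[OF G]
  have K: "ribbon_graph ?K" by (intro ribbon_graph_juxtapose ribbon_graph_id ribbon_graph_bend[OF assms])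
  have oK: "outs ?K = 2 + outs G" by (simp add: id_graph_def bend_def)
  (* m takes the flags of G into the graph to be joined; only the former incoming endpoint 0 lands on
     one of the two endpoints that the coupling consumes *)
  define m where "m = (\<lambda>x :: 'a flag. right_flag (id_graph 1) (bend_flag x))"
  define \<phi> :: "'a \<Rightarrow> (nat + nat) + nat + 'a" where "\<phi> = Inr \<circ> Inr"
  have EK: "edges ?K = insert {InEnd 0, OutEnd 0} ((`) m ` edges G)"
    unfolding edges_juxtapose by (simp add: edges_id bend_def image_image m_def lessThan_Suc)
  have m: "m (HalfEdge h) = HalfEdge (Inr h)" "m (InEnd 0) = OutEnd 1" "m (InEnd (Suc i)) = InEnd (Suc i)"
    "m (OutEnd j) = OutEnd (Suc (Suc j))" for h i j
    unfolding m_def by simp_all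
  have m0: "m x \<noteq> OutEnd 0" for x
    by (cases x) (auto simp: m, metis m(2,3) flag.distinct(5) flag.inject(3) not0_implies_Suc zero_neq_one)
  have m1: "m x = OutEnd 1 \<longleftrightarrow> x = InEnd 0" for x
  proof (cases x)
    case (InEnd i)
    then show ?thesis by (cases i) (auto simp: m)
  qed (auto simp: m)
  have cm: "coupling_subst (m x) = map_flag \<phi> x" if "x \<noteq> InEnd 0" for x
  proof (cases x)
    case (InEnd i)
    then show ?thesis using that by (cases i) (auto simp: m)
  qed (auto simp: m \<phi>_def)
  obtain a where a: "{InEnd 0, a} \<in> edges G" "InEnd 0 \<noteq> a"
    using edge_partner[OF RG(3) _ , of "InEnd 0"] RG(4) p by (metis InEnd_in_flags zero_less_Suc)
  have e0: "InEnd 0 \<in> e \<longleftrightarrow> e = {InEnd 0, a}" if "e \<in> edges G" for e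
    using edge_eqI[OF RG(3) that a(1), of "InEnd 0"] by auto
  have m_out: "OutEnd 0 \<notin> m ` e" "OutEnd 1 \<in> m ` e \<longleftrightarrow> InEnd 0 \<in> e" for e
    using m0 m1 by (metis imageE, metis imageE imageI)
  have m_eq: "m ` e = m ` {InEnd 0, a} \<longleftrightarrow> e = {InEnd 0, a}" if "e \<in> edges G" for e
  proof
    assume "m ` e = m ` {InEnd 0, a}"
    then have "InEnd 0 \<in> e" using m_out(2)[of e] m_out(2)[of "{InEnd 0, a}"] by simp
    then show "e = {InEnd 0, a}" using e0[OF that] by blast
  qed simp
  have m_ne: "m ` e \<noteq> {InEnd 0, OutEnd 0}" for e using m_out(1)[of e] by blast
  have hit: "OutEnd 0 \<in> e \<or> OutEnd 1 \<in> e \<longleftrightarrow> e = {InEnd 0, OutEnd 0} \<or> e = m ` {InEnd 0, a}" if e: "e \<in> edges ?K" for e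
  proof (cases "e = {InEnd 0, OutEnd 0}")
    case True
    then show ?thesis by blast
  next
    case False
    then obtain e' where e': "e' \<in> edges G" "e = m ` e'" using e unfolding EK by blast
    show ?thesis
    proof (cases "e' = {InEnd 0, a}")
      case True
      then have "OutEnd 1 \<in> e" "e = m ` {InEnd 0, a}" using m_out(2)[of e'] e'(2) by blast+
      then show ?thesis by blast
    next
      case False
      then have "OutEnd 0 \<notin> e" "OutEnd 1 \<notin> e" "e \<noteq> {InEnd 0, OutEnd 0}" "e \<noteq> m ` {InEnd 0, a}"
        using m_out[of e'] m_eq[OF e'(1)] m_ne[of e'] e0[OF e'(1)] e'(2) by metis+
      then show ?thesis by blast
    qed
  qed
  have joined: "joined_edge ?K = {InEnd 0, OutEnd 0, OutEnd 1, m a}"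
  proof -
    have "{e \<in> edges ?K. OutEnd 0 \<in> e \<or> OutEnd 1 \<in> e} = {{InEnd 0, OutEnd 0}, m ` {InEnd 0, a}}"
    proof -
      have "{InEnd 0, OutEnd 0} \<in> edges ?K" "m ` {InEnd 0, a} \<in> edges ?K" unfolding EK
        by (rule insertI1) (intro insertI2 imageI a(1))
      then show ?thesis using hit by blast
    qed
    then show ?thesis by (auto simp: m)
  qed
  have others: "other_edges ?K = (`) m ` (edges G - {{InEnd 0, a}})"
  proof -
    have "e \<in> other_edges ?K \<longleftrightarrow> e \<in> edges ?K \<and> e \<noteq> {InEnd 0, OutEnd 0} \<and> e \<noteq> m ` {InEnd 0, a}" for e
      using hit[of e] by blast
    moreover have "e \<in> edges ?K \<and> e \<noteq> {InEnd 0, OutEnd 0} \<and> e \<noteq> m ` {InEnd 0, a} \<longleftrightarrow>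
        e \<in> (`) m ` (edges G - {{InEnd 0, a}})" for e
    proof
      assume e: "e \<in> edges ?K \<and> e \<noteq> {InEnd 0, OutEnd 0} \<and> e \<noteq> m ` {InEnd 0, a}"
      then obtain e' where e': "e' \<in> edges G" "e = m ` e'" unfolding EK by blast
      moreover have "e' \<noteq> {InEnd 0, a}" using e e'(2) by metis
      ultimately show "e \<in> (`) m ` (edges G - {{InEnd 0, a}})" by simp
    next
      assume "e \<in> (`) m ` (edges G - {{InEnd 0, a}})"
      then obtain e' where e': "e' \<in> edges G" "e' \<noteq> {InEnd 0, a}" "e = m ` e'" by blast
      have "e \<in> edges ?K" unfolding EK e'(3) using e'(1) by (intro insertI2 imageI)
      then show "e \<in> edges ?K \<and> e \<noteq> {InEnd 0, OutEnd 0} \<and> e \<noteq> m ` {InEnd 0, a}"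
        unfolding e'(3) using m_eq[OF e'(1)] e'(2) m_ne[of e'] by (simp only:) simp
    qed
    ultimately show ?thesis by (intro set_eqI) (simp only:)
  qed
  have mane: "m a \<noteq> OutEnd 0" "m a \<noteq> OutEnd 1" using m0 m1 a(2) by auto
  note g = glue_coupling[OF K oK]
  have joined': "coupling_subst ` (joined_edge ?K - {OutEnd 0, OutEnd 1}) = map_flag \<phi> ` {InEnd 0, a}"
  proof -
    have "joined_edge ?K - {OutEnd 0, OutEnd 1} = {InEnd 0, m a}" unfolding joined using mane by auto
    then show ?thesis using cm[of a] a(2) by simp
  qed
  have others': "(`) coupling_subst ` other_edges ?K = (`) (map_flag \<phi>) ` (edges G - {{InEnd 0, a}})"
    unfolding others image_image
  proof (intro image_cong refl)
    fix e x assume "e \<in> edges G - {{InEnd 0, a}}" "x \<in> e"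
    then have "x \<noteq> InEnd 0" using e0 by blast
    then show "coupling_subst (m x) = map_flag \<phi> x" by (rule cm)
  qed
  have "{} \<notin> edges G" using RG(3) unfolding partition_on_def by blast
  then have ne: "{} \<notin> (`) (map_flag \<phi>) ` edges G" by auto
  have "insert (map_flag \<phi> ` {InEnd 0, a}) ((`) (map_flag \<phi>) ` (edges G - {{InEnd 0, a}})) = (`) (map_flag \<phi>) ` edges G"
    using a(1) by (metis image_insert insert_Diff)
  then have E: "edges (glue (juxtapose coupling_graph (id_graph (outs G))) ?K) = (`) (map_flag \<phi>) ` edges G"
    unfolding g(1) joined' others' using ne by simp
  show ?thesis
  proof (rule rgraph_isoI[where \<phi> = \<phi>])
    show "bij_betw \<phi> (halfs G) (halfs (glue (juxtapose coupling_graph (id_graph (outs G))) ?K))"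
      using bij_betw_Inr_Inr[of "halfs G"] by (simp add: \<phi>_def bend_def id_graph_def coupling_graph_def)
    show "circles G = circles (glue (juxtapose coupling_graph (id_graph (outs G))) ?K)"
      unfolding g(2) joined by (simp add: bend_def id_graph_def)
  qed (use E p in \<open>auto simp: \<phi>_def bend_def id_graph_def coupling_graph_def\<close>)
qed

lemma bend_id: "bend (id_graph 1) = copairing_graph"
  by (simp add: bend_def id_graph_def copairing_graph_def)

text \<open>
  A circle is the coupling applied to both ends of a copairing.
\<close>
lemma circle_iso:
  fixes G :: "'a rgraph"
  assumes G: "ribbon_graph G"
  shows "rgraph_iso (G\<lparr>circles := Suc (circles G)\<rparr>)
    (glue (juxtapose coupling_graph (id_graph (outs G))) (juxtapose copairing_graph G))"
proof -
  let ?K = "juxtapose copairing_graph G"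
  note RG = ribbon_graphD[OF G]
  have K: "ribbon_graph ?K" by (intro ribbon_graph_juxtapose ribbon_graph_copairing G)
  have oK: "outs ?K = 2 + outs G" by (simp add: copairing_graph_def)
  define m :: "'a flag \<Rightarrow> (nat + 'a) flag" where "m = right_flag copairing_graph"
  define \<phi> :: "'a \<Rightarrow> (nat + nat) + nat + 'a" where "\<phi> = Inr \<circ> Inr"
  have EK: "edges ?K = insert {OutEnd 0, OutEnd 1} ((`) m ` edges G)"
    unfolding edges_juxtapose by (simp add: copairing_graph_def m_def)
  have m: "m (HalfEdge h) = HalfEdge (Inr h)" "m (InEnd i) = InEnd i" "m (OutEnd j) = OutEnd (2 + j)" for h i j
    unfolding m_def by (simp_all add: copairing_graph_def)
  have m01: "m x \<noteq> OutEnd 0" "m x \<noteq> OutEnd 1" for x by (cases x; simp add: m)+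
  have cm: "coupling_subst (m x) = map_flag \<phi> x" for x by (cases x) (simp_all add: m \<phi>_def)
  have "OutEnd 0 \<noteq> m x" "OutEnd (Suc 0) \<noteq> m x" for x using m01[of x] by auto
  then have hits: "{e \<in> edges ?K. OutEnd 0 \<in> e \<or> OutEnd 1 \<in> e} = {{OutEnd 0, OutEnd 1}}"
    and others: "other_edges ?K = (`) m ` edges G"
    unfolding EK by auto
  have joined: "joined_edge ?K = {OutEnd 0, OutEnd 1}" unfolding hits by simp
  note g = glue_coupling[OF K oK]
  have "{} \<notin> edges G" using RG(3) unfolding partition_on_def by blast
  then have E: "edges (glue (juxtapose coupling_graph (id_graph (outs G))) ?K) = (`) (map_flag \<phi>) ` edges G"
    unfolding g(1) joined others by (auto simp: image_image cm)
  show ?thesis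
  proof (rule rgraph_isoI[where \<phi> = \<phi>])
    show "bij_betw \<phi> (halfs (G\<lparr>circles := Suc (circles G)\<rparr>)) (halfs (glue (juxtapose coupling_graph (id_graph (outs G))) ?K))"
      using bij_betw_Inr_Inr[of "halfs G"] by (simp add: \<phi>_def copairing_graph_def id_graph_def coupling_graph_def)
    show "circles (G\<lparr>circles := Suc (circles G)\<rparr>) = circles (glue (juxtapose coupling_graph (id_graph (outs G))) ?K)"
      unfolding g(2) joined by (simp add: copairing_graph_def)
  qed (use E in \<open>auto simp: \<phi>_def copairing_graph_def id_graph_def coupling_graph_def\<close>)
qed

lemma coupling_crossing_iso:
  "rgraph_iso coupling_graph (glue (juxtapose coupling_graph (id_graph 0)) crossing_graph)"
proof -
  have oK: "outs crossing_graph = 2 + 0" by (simp add: crossing_graph_def)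
  note g = glue_coupling[OF ribbon_graph_crossing oK]
  have EK: "edges crossing_graph = {{InEnd 0, OutEnd 1}, {InEnd 1, OutEnd 0}}" by (simp add: crossing_graph_def)
  have hits: "{e \<in> edges crossing_graph. OutEnd 0 \<in> e \<or> OutEnd 1 \<in> e} = {{InEnd 0, OutEnd 1}, {InEnd 1, OutEnd 0}}"
    and others: "other_edges crossing_graph = {}"
    unfolding EK by auto
  have "joined_edge crossing_graph = {InEnd 0, OutEnd 1, InEnd 1, OutEnd 0}" unfolding hits by auto
  then have joined: "joined_edge crossing_graph - {OutEnd 0, OutEnd 1} = {InEnd 0, InEnd 1}"
    and nsub: "\<not> joined_edge crossing_graph \<subseteq> {OutEnd 0, OutEnd 1}" by auto
  show ?thesis
  proof (rule rgraph_isoI[where \<phi> = "\<lambda>_. undefined"])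
    show "edges (glue (juxtapose coupling_graph (id_graph 0)) crossing_graph) =
        (`) (map_flag (\<lambda>_. undefined)) ` edges coupling_graph"
      unfolding g(1) joined others by (simp add: coupling_graph_def)
    show "circles coupling_graph = circles (glue (juxtapose coupling_graph (id_graph 0)) crossing_graph)"
      unfolding g(2) using nsub by (simp add: coupling_graph_def crossing_graph_def)
  qed (auto simp: coupling_graph_def crossing_graph_def id_graph_def bij_betw_def)
qed

text \<open>
  The permutation that rotates the legs of the star is the cyclic order of its vertex itself, so the
  rotation of the half-edges is an isomorphism.
\<close>
lemma star_rotation_iso:
  fixes r :: nat
  defines "\<sigma> \<equiv> nxt (star_graph r)"
  shows "rgraph_iso (star_graph r) (glue (star_graph r) (perm_graph \<sigma> r))"
proof -
  have \<sigma>: "\<sigma> permutes {..<r}" using ribbon_graphD(2)[OF ribbon_graph_star[of r]] by (simp add: \<sigma>_def star_graph_def)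
  have P: "ribbon_graph (perm_graph \<sigma> r)" using \<sigma> by (rule ribbon_graph_perm)
  have io: "ins (star_graph r) = outs (perm_graph \<sigma> r)" and h: "halfs (star_graph r) = {..<r}"
    by (simp_all add: star_graph_def)
  have es: "edges (star_graph r) = (\<lambda>i. {HalfEdge i, InEnd i}) ` {..<r}" by (auto simp: star_graph_def)
  note g = glue_leg[OF leg_star P io]
  let ?\<phi> = "\<lambda>i. Inl (\<sigma> i)"
  show ?thesis
  proof (rule rgraph_isoI[where \<phi> = ?\<phi>])
    show "bij_betw ?\<phi> (halfs (star_graph r)) (halfs (glue (star_graph r) (perm_graph \<sigma> r)))"
    proof -
      have "?\<phi> ` {..<r} = Inl ` \<sigma> ` {..<r}" by (simp add: image_image)
      moreover have "inj_on ?\<phi> {..<r}" by (intro inj_onI) (use permutes_inj[OF \<sigma>] in \<open>simp add: inj_eq\<close>)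
      ultimately show ?thesis by (simp add: h bij_betw_def permutes_image[OF \<sigma>] Plus_def)
    qed
    show "edges (glue (star_graph r) (perm_graph \<sigma> r)) = (`) (map_flag ?\<phi>) ` edges (star_graph r)"
      unfolding g(1) edges_perm es image_image by (rule image_cong[OF refl]) auto
    show "circles (star_graph r) = circles (glue (star_graph r) (perm_graph \<sigma> r))"
      unfolding g(2) by (simp add: star_graph_def)
    show "?\<phi> (nxt (star_graph r) i) = nxt (glue (star_graph r) (perm_graph \<sigma> r)) (?\<phi> i)" for i
      by (simp add: \<sigma>_def)
  qed (simp_all add: star_graph_def)
qed

text \<open>
  A vertex is split off by cutting all edges at its half-edges: these become the first \<open>r\<close> outgoing
  endpoints of the remaining graph \<open>K\<close>, listed in cyclic order, and composing with a star restores
  the vertex.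
\<close>
lemma vertex_iso:
  fixes G :: "'h rgraph"
  assumes G: "ribbon_graph G" and h0: "h0 \<in> halfs G"
  obtains r and K :: "'h rgraph" where "r \<ge> 1" "ribbon_graph K" "ins K = ins G" "outs K = r + outs G"
    "card (halfs K) < card (halfs G)"
    "rgraph_iso G (glue (juxtapose (star_graph r) (id_graph (outs G))) K)"
proof -
  note RG = ribbon_graphD[OF G]
  let ?p = "nxt G"
  define r where "r = least_power ?p h0"
  define c where "c = (\<lambda>k. (?p ^^ k) h0)"
  define V where "V = c ` {..<r}"
  define idx where "idx = inv_into {..<r} c"
  note perm = permutation_nxt[OF G]
  have r: "r \<ge> 1" "c r = h0" using least_power_of_permutation[OF perm, of h0] by (simp_all add: r_def c_def)
  have inj: "inj_on c {..<r}"
    using cycle_of_permutation[OF perm, of h0] unfolding distinct_map r_def c_def by (simp add: atLeast0LessThan)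
  have V_supp: "set (support ?p h0) = V" unfolding V_def c_def r_def by auto
  have cH: "c k \<in> halfs G" for k
    unfolding c_def using permutes_in_image[OF permutes_funpow[OF RG(2)]] h0 by blast
  then have VH: "V \<subseteq> halfs G" unfolding V_def by blast
  have idx: "idx (c k) = k" if "k < r" for k using inv_into_f_f[OF inj] that unfolding idx_def by simp
  have idx_less: "idx h < r" "c (idx h) = h" if "h \<in> V" for h
    using that inv_into_into[of h c "{..<r}"] f_inv_into_f[of h c "{..<r}"] unfolding V_def idx_def by auto
  have idx_inj: "idx h = idx h' \<longleftrightarrow> h = h'" if "h \<in> V" "h' \<in> V" for h h'
    using idx_less(2)[OF that(1)] idx_less(2)[OF that(2)] by metis
  have idx_ne: "idx h \<noteq> r + j" if "h \<in> V" for h j using idx_less(1)[OF that] by simp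
  have h0V: "h0 \<in> V" using r idx[of 0] unfolding V_def by (auto simp: c_def intro!: image_eqI[of _ _ 0])
  (* the cut half-edges become the outgoing endpoints below r, the old ones are shifted by r *)
  define \<tau> where "\<tau> = (\<lambda>x :: 'h flag. case x of HalfEdge h \<Rightarrow> (if h \<in> V then OutEnd (idx h) else HalfEdge h)
    | InEnd i \<Rightarrow> InEnd i | OutEnd j \<Rightarrow> OutEnd (r + j))"
  have \<tau>: "\<tau> (HalfEdge h) = (if h \<in> V then OutEnd (idx h) else HalfEdge h)" "\<tau> (InEnd i) = InEnd i"
    "\<tau> (OutEnd j) = OutEnd (r + j)" for h i j by (simp_all add: \<tau>_def)
  define K where "K = \<lparr>ins = ins G, outs = r + outs G, halfs = halfs G - V,
    nxt = (\<lambda>y. if y \<in> halfs G - V then ?p y else y), edges = (`) \<tau> ` edges G, circles = circles G\<rparr>"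
  have nxtK: "nxt K permutes halfs K"
    using semidecomposition[OF RG(2,1), of h0] unfolding V_supp by (simp add: K_def)
  have K: "ribbon_graph K"
  proof (rule ribbon_graphI_image[OF G, of \<tau>])
    show "inj_on \<tau> (flags G)"
    proof (rule inj_onI)
      fix x y assume "x \<in> flags G" "y \<in> flags G" "\<tau> x = \<tau> y"
      then show "x = y"
        by (cases x; cases y) (auto simp: \<tau> idx_inj idx_ne idx_ne[symmetric] split: if_splits)
    qed
    have "OutEnd ` idx ` V = (OutEnd ` {..<r} :: 'h flag set)" unfolding V_def image_image using idx by auto
    moreover have "halfs G = (halfs G - V) \<union> V" using VH by blast
    then have "HalfEdge ` halfs G = HalfEdge ` (halfs G - V) \<union> HalfEdge ` V" by (metis image_Un)
    moreover have "\<tau> ` HalfEdge ` (halfs G - V) = HalfEdge ` (halfs G - V)" "\<tau> ` HalfEdge ` V = OutEnd ` idx ` V"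
      unfolding image_image by (auto simp: \<tau>)
    ultimately show "flags K = \<tau> ` flags G"
      unfolding flags_def by (simp add: K_def image_Un image_image image_add_lessThan_Un \<tau>) blast
  qed (use nxtK RG(1) in \<open>auto simp: K_def\<close>)
  let ?S = "juxtapose (star_graph r) (id_graph (outs G))"
  have io: "ins ?S = outs K" by (simp add: K_def star_graph_def id_graph_def)
  note g = glue_leg[OF leg_juxtapose[OF leg_star[of r] leg_id[of "outs G"]] K io]
  define \<phi> where "\<phi> = (\<lambda>h. if h \<in> V then Inl (Inl (idx h)) else Inr h :: (nat + nat) + 'h)"
  have "card (halfs K) < card (halfs G)"
    using h0 h0V RG(1) by (intro psubset_card_mono) (auto simp: K_def)
  moreover have "rgraph_iso G (glue ?S K)"
  proof (rule rgraph_isoI[where \<phi> = \<phi>])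
    have "\<phi> ` V = Inl ` Inl ` {..<r}"
    proof -
      have "idx ` V = {..<r}" unfolding V_def image_image using idx by auto
      then show ?thesis by (auto simp: \<phi>_def image_image image_iff)
    qed
    moreover have "\<phi> ` (halfs G - V) = Inr ` (halfs G - V)" by (auto simp: \<phi>_def)
    moreover have "\<phi> ` halfs G = \<phi> ` V \<union> \<phi> ` (halfs G - V)" using VH by blast
    ultimately have "\<phi> ` halfs G = halfs (glue ?S K)"
      by (simp add: K_def star_graph_def id_graph_def Plus_def)
    moreover have "inj_on \<phi> (halfs G)"
    proof (rule inj_onI)
      fix x y assume "\<phi> x = \<phi> y"
      then show "x = y" by (cases "x \<in> V"; cases "y \<in> V") (simp_all add: \<phi>_def idx_inj)
    qed
    ultimately show "bij_betw \<phi> (halfs G) (halfs (glue ?S K))" by (simp add: bij_betw_def)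
    show "edges (glue ?S K) = (`) (map_flag \<phi>) ` edges G"
    proof -
      have "leg_subst (\<lambda>k. if k < ins (star_graph r) then left_flag (HalfEdge k)
          else right_flag (star_graph r) (OutEnd (k - ins (star_graph r)))) (\<tau> x) = map_flag \<phi> x" for x
        by (cases x) (auto simp: \<tau> \<phi>_def idx_less star_graph_def)
      then show ?thesis unfolding g(1) by (simp add: K_def image_image)
    qed
    show "circles G = circles (glue ?S K)" unfolding g(2) by (simp add: K_def)
    fix h assume h: "h \<in> halfs G"
    show "\<phi> (?p h) = nxt (glue ?S K) (\<phi> h)"
    proof (cases "h \<in> V")
      case True
      then obtain k where k: "k < r" "h = c k" unfolding V_def by blast
      have "?p h = c (Suc k mod r)"
        using k r by (cases "Suc k = r") (auto simp: c_def)
      moreover have "Suc k mod r < r" using r by simp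
      ultimately have "\<phi> (?p h) = Inl (Inl (Suc k mod r))"
        using idx unfolding \<phi>_def V_def by auto
      moreover have "\<phi> h = Inl (Inl k)" using True k idx by (simp add: \<phi>_def)
      ultimately show ?thesis using k(1) by (simp add: star_graph_def)
    next
      case False
      then have "nxt K h = ?p h" "h \<in> halfs K" using h by (simp_all add: K_def)
      moreover from this have "?p h \<notin> V" using permutes_in_image[OF nxtK, of h] by (simp add: K_def)
      ultimately show ?thesis using False by (simp add: \<phi>_def)
    qed
  qed (simp_all add: K_def star_graph_def id_graph_def)
  ultimately show thesis using that[of r K] r(1) K by (simp add: K_def)
qed

subsection \<open>Induction over ribbon graphs\<close>

lemma partition_on_remove:
  assumes "partition_on X E" "e \<in> E"
  shows "partition_on (X - e) (E - {e})"
proof -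
  have "disjnt e (\<Union>(E - {e}))" using assms unfolding partition_on_def disjoint_def disjnt_def by blast
  moreover have "insert e (E - {e}) = E" using assms(2) by blast
  ultimately show ?thesis using assms(1) partition_on_insert by metis
qed

text \<open>
  A property of graphs that passes to composites and juxtapositions and holds for the elementary
  graphs. The copairing is listed separately because an action determines its value only through the
  snake identity.
\<close>
locale generated =
  fixes good :: "ribbon \<Rightarrow> bool"
  assumes good_comp: "ribbon_ins A = ribbon_outs B \<Longrightarrow> good A \<Longrightarrow> good B \<Longrightarrow> good (ribbon_comp A B)"
    and good_tensor: "good A \<Longrightarrow> good B \<Longrightarrow> good (ribbon_tensor A B)"
    and good_id: "good (cls (id_graph p))" and good_crossing: "good (cls crossing_graph)"
    and good_coupling: "good (cls coupling_graph)" and good_copairing: "good (cls copairing_graph)"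
    and good_star: "r \<ge> 1 \<Longrightarrow> good (cls (star_graph r))"
begin

lemma good_glue:
  assumes "ribbon_graph G" "ribbon_graph F" "ins G = outs F" "good (cls G)" "good (cls F)"
  shows "good (cls (glue G F))"
  using good_comp[of "cls G" "cls F"] assms by (simp add: cls_glue ribbon_ins_cls ribbon_outs_cls)

lemma good_juxtapose:
  assumes "ribbon_graph G" "ribbon_graph F" "good (cls G)" "good (cls F)"
  shows "good (cls (juxtapose G F))"
  using good_tensor[of "cls G" "cls F"] assms by (simp add: cls_juxtapose)

lemma good_iso:
  assumes "ribbon_graph G" "ribbon_graph H" "rgraph_iso G H"
  shows "good (cls G) \<longleftrightarrow> good (cls H)"
  using cls_eqI[OF assms] by simp

lemma good_permute_outs:
  assumes F: "ribbon_graph F" and "good (cls F)" and "\<sigma> permutes {..<outs F}"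
  shows "good (cls (permute_outs \<sigma> F))"
  using assms(3)
proof (induction rule: adjacent_induct)
  case id
  then show ?case unfolding permute_outs_id by (rule assms(2))
next
  case (adjacent i \<tau>)
  let ?s = "transpose i (Suc i)" and ?n = "outs F"
  let ?F = "permute_outs \<tau> F"
  have s: "?s permutes {..<?n}" using adjacent(1) by (intro permutes_swap_id) auto
  have F': "ribbon_graph ?F" using F adjacent(2) by (rule ribbon_graph_permute_outs)
  have P: "ribbon_graph (perm_graph ?s ?n)" using s by (rule ribbon_graph_perm)
  have J: "ribbon_graph (juxtapose (juxtapose (id_graph i) crossing_graph) (id_graph (?n - i - 2)))"
    by (intro ribbon_graph_juxtapose ribbon_graph_id ribbon_graph_crossing)
  have "good (cls (juxtapose (juxtapose (id_graph i) crossing_graph) (id_graph (?n - i - 2))))"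
    by (intro good_juxtapose ribbon_graph_juxtapose ribbon_graph_id ribbon_graph_crossing good_id good_crossing)
  then have "good (cls (perm_graph ?s ?n))"
    using good_iso[OF J P adjacent_transposition_iso[OF adjacent(1)]] by simp
  then have g: "good (cls (glue (perm_graph ?s ?n) ?F))"
    using adjacent(3) by (intro good_glue P F') simp_all
  have "rgraph_iso (permute_outs ?s ?F) (glue (perm_graph ?s ?n) ?F)"
    using glue_perm[OF F', of ?s] s by simp
  then have "good (cls (permute_outs ?s ?F))"
    using g good_iso[of "permute_outs ?s ?F" "glue (perm_graph ?s ?n) ?F"] ribbon_graph_permute_outs[OF F', of ?s]
      ribbon_graph_glue[OF P F'] s by simp
  then show ?case unfolding permute_outs_comp .
qed

text \<open>
  Without vertices and incoming endpoints a graph is a matching of its outgoing endpoints. After a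
  permutation the endpoint 0 is matched with 1, and this edge splits off as a copairing.
\<close>
lemma good_matching:
  fixes G :: "nat rgraph"
  assumes "ribbon_graph G" "ins G = 0" "halfs G = {}" "circles G = 0"
  shows "good (cls G)"
  using assms
proof (induction "outs G" arbitrary: G rule: less_induct)
  case less
  note RG = ribbon_graphD[OF less.prems(1)]
  have fl: "flags G = OutEnd ` {..<outs G}" using less.prems by (simp add: flags_def)
  show ?case
  proof (cases "outs G = 0")
    case True
    then have "edges G = {}" using RG(3) fl by (simp add: partition_on_empty)
    then have "rgraph_iso G (id_graph 0)"
      using less.prems True by (intro rgraph_isoI[where \<phi> = id]) (auto simp: id_graph_def)
    then show ?thesis using good_iso[OF less.prems(1) ribbon_graph_id] good_id by blast
  next
    case False
    then have "OutEnd 0 \<in> flags G" by simp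
    then obtain y where "{OutEnd 0, y} \<in> edges G" "OutEnd 0 \<noteq> y" "y \<in> flags G"
      using edge_partner[OF RG(3)] RG(4) by metis
    then obtain j where j: "{OutEnd 0, OutEnd j} \<in> edges G" "j \<noteq> 0" "j < outs G" using fl by auto
    (* j is not 0 but may be 1, in which case the transposition is trivial *)
    let ?s = "transpose 1 j"
    let ?G = "permute_outs ?s G"
    have s: "?s permutes {..<outs G}" using j by (intro permutes_swap_id) auto
    have G1: "ribbon_graph ?G" using less.prems(1) s by (rule ribbon_graph_permute_outs)
    note RG1 = ribbon_graphD[OF G1]
    have "out_map ?s ` {OutEnd 0, OutEnd j} \<in> edges ?G" unfolding permute_outs_simps by (rule imageI[OF j(1)])
    moreover have "?s 0 = 0" using j(2) by (simp add: Transposition.transpose_def)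
    ultimately have e: "{OutEnd 0, OutEnd 1} \<in> edges ?G" by simp
    let ?e = "{OutEnd 0, OutEnd 1} :: nat flag set" and ?d = "out_map (\<lambda>i. i - 2) :: nat flag \<Rightarrow> nat flag"
    define G2 where "G2 = \<lparr>ins = 0, outs = outs G - 2, halfs = {} :: nat set, nxt = id,
      edges = (`) ?d ` (edges ?G - {?e}), circles = 0\<rparr>"
    have part: "partition_on (flags ?G - ?e) (edges ?G - {?e})" by (rule partition_on_remove[OF RG1(3) e])
    have fl1: "flags ?G - ?e = (\<lambda>i. OutEnd (2 + i)) ` {..<outs G - 2}"
    proof -
      have "x \<in> (\<lambda>i. OutEnd (2 + i)) ` {..<outs G - 2}" if "x = OutEnd k" "k < outs G" "k \<noteq> 0" "k \<noteq> 1" for x :: "nat flag" and k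
        using that by (intro image_eqI[of _ _ "k - 2"]) auto
      then show ?thesis unfolding flags_permute_outs fl by auto
    qed
    have sub: "f \<subseteq> flags ?G - ?e" if "f \<in> edges ?G - {?e}" for f
      using part that unfolding partition_on_def by blast
    have inj: "inj_on ?d (flags ?G - ?e)" unfolding fl1 by (auto simp: inj_on_def)
    have G2: "ribbon_graph G2"
      unfolding ribbon_graph_def
    proof (intro conjI ballI)
      have "flags G2 = ?d ` (flags ?G - ?e)" unfolding fl1 by (simp add: flags_def G2_def image_image)
      then show "partition_on (flags G2) (edges G2)"
        using partition_on_image[OF part inj] by (simp add: G2_def)
      show "card f = 2" if f: "f \<in> edges G2" for f
      proof -
        obtain f' where f': "f' \<in> edges ?G - {?e}" "f = ?d ` f'" using f by (auto simp: G2_def)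
        then have "card f = card f'" using card_image[OF inj_on_subset[OF inj sub[OF f'(1)]]] by simp
        then show ?thesis using RG1(4) f'(1) by simp
      qed
    qed (simp_all add: G2_def permutes_id)
    have "good (cls G2)"
      by (rule less.hyps[OF _ G2]) (use False in \<open>simp_all add: G2_def\<close>)
    then have good_J: "good (cls (juxtapose copairing_graph G2))"
      by (intro good_juxtapose ribbon_graph_copairing G2 good_copairing)
    have J: "ribbon_graph (juxtapose copairing_graph G2)" by (intro ribbon_graph_juxtapose ribbon_graph_copairing G2)
    let ?\<phi> = "\<lambda>_ :: nat. undefined :: nat + nat"
    have "rgraph_iso ?G (juxtapose copairing_graph G2)"
    proof (rule rgraph_isoI[where \<phi> = ?\<phi>])
      have undo: "right_flag copairing_graph (?d x) = map_flag ?\<phi> x" if "x \<in> flags ?G - ?e" for x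
        using that unfolding fl1 by (auto simp: copairing_graph_def)
      have moved: "(`) (right_flag copairing_graph) ` edges G2 = (`) (map_flag ?\<phi>) ` (edges ?G - {?e})"
        unfolding G2_def rgraph.simps image_image
        by (intro image_cong refl undo) (use sub in blast)
      have "edges (juxtapose copairing_graph G2) = insert {OutEnd 0, OutEnd 1} ((`) (right_flag copairing_graph) ` edges G2)"
        unfolding edges_juxtapose by (simp add: copairing_graph_def)
      moreover have "map_flag ?\<phi> ` ?e = {OutEnd 0, OutEnd 1}" by simp
      ultimately show "edges (juxtapose copairing_graph G2) = (`) (map_flag ?\<phi>) ` edges ?G"
        unfolding moved using image_insert[of "(`) (map_flag ?\<phi>)" ?e "edges ?G - {?e}"] insert_Diff[OF e]
        by (simp only:)
    qed (use less.prems j in \<open>auto simp: copairing_graph_def G2_def bij_betw_def\<close>)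
    then have "good (cls ?G)" using good_J good_iso[OF G1 J] by blast
    then have "good (cls (permute_outs ?s ?G))" using good_permute_outs[OF G1, of ?s] s by simp
    then show ?thesis by (simp add: permute_outs_comp permute_outs_id)
  qed
qed

lemma good_circles:
  fixes G :: "nat rgraph"
  assumes "ribbon_graph G" "ins G = 0" "halfs G = {}"
  shows "good (cls G)"
  using assms
proof (induction "circles G" arbitrary: G)
  case 0
  then show ?case by (intro good_matching) simp_all
next
  case (Suc c)
  let ?G = "G\<lparr>circles := c\<rparr>"
  have fl: "flags ?G = flags G" by (simp add: flags_def)
  have G': "ribbon_graph ?G" using Suc.prems(1) fl unfolding ribbon_graph_def by simp
  have "good (cls ?G)" using Suc G' by simp
  then have good_K: "good (cls (juxtapose copairing_graph ?G))"
    by (intro good_juxtapose ribbon_graph_copairing G' good_copairing)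
  let ?H = "juxtapose coupling_graph (id_graph (outs ?G))" and ?K = "juxtapose copairing_graph ?G"
  have K: "ribbon_graph ?K" by (intro ribbon_graph_juxtapose ribbon_graph_copairing G')
  have H: "ribbon_graph ?H" by (intro ribbon_graph_juxtapose ribbon_graph_coupling ribbon_graph_id)
  have io: "ins ?H = outs ?K" by (simp add: coupling_graph_def id_graph_def copairing_graph_def)
  have "good (cls (glue ?H ?K))"
    by (intro good_glue H K io good_K good_juxtapose ribbon_graph_coupling ribbon_graph_id good_coupling good_id)
  moreover have "?G\<lparr>circles := Suc (circles ?G)\<rparr> = G" using Suc.hyps(2) by simp
  then have "rgraph_iso G (glue ?H ?K)" using circle_iso[OF G'] by simp
  ultimately show ?case using good_iso[OF Suc.prems(1) ribbon_graph_glue[OF H K io]] by blast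
qed

lemma good_no_ins:
  fixes G :: "nat rgraph"
  assumes "ribbon_graph G" "ins G = 0"
  shows "good (cls G)"
  using assms
proof (induction "card (halfs G)" arbitrary: G rule: less_induct)
  case less
  show ?case
  proof (cases "halfs G = {}")
    case True
    then show ?thesis using less.prems by (intro good_circles)
  next
    case False
    then obtain h0 where "h0 \<in> halfs G" by blast
    then obtain r and K :: "nat rgraph" where r: "r \<ge> 1" and K: "ribbon_graph K" "ins K = ins G" "outs K = r + outs G"
        "card (halfs K) < card (halfs G)"
        and iso: "rgraph_iso G (glue (juxtapose (star_graph r) (id_graph (outs G))) K)"
      by (rule vertex_iso[OF less.prems(1)])
    let ?S = "juxtapose (star_graph r) (id_graph (outs G))"
    have S: "ribbon_graph ?S" by (intro ribbon_graph_juxtapose ribbon_graph_star ribbon_graph_id)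
    have io: "ins ?S = outs K" using K(3) by (simp add: star_graph_def id_graph_def)
    have "good (cls K)" using less.hyps[OF K(4,1)] K(2) less.prems(2) by simp
    then have "good (cls (glue ?S K))"
      by (intro good_glue S K(1) io good_juxtapose ribbon_graph_star ribbon_graph_id good_star good_id r)
    then show ?thesis using good_iso[OF less.prems(1) ribbon_graph_glue[OF S K(1) io] iso] by simp
  qed
qed

lemma good_graph:
  fixes G :: "nat rgraph"
  assumes "ribbon_graph G"
  shows "good (cls G)"
  using assms
proof (induction "ins G" arbitrary: G)
  case 0
  then show ?case by (intro good_no_ins) simp_all
next
  case (Suc p)
  let ?H = "juxtapose coupling_graph (id_graph (outs G))" and ?K = "juxtapose (id_graph 1) (bend G)"
  note p = Suc.hyps(2)[symmetric]
  have B: "ribbon_graph (bend G)" by (rule ribbon_graph_bend[OF Suc.prems p])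
  have K: "ribbon_graph ?K" by (intro ribbon_graph_juxtapose ribbon_graph_id B)
  have H: "ribbon_graph ?H" by (intro ribbon_graph_juxtapose ribbon_graph_coupling ribbon_graph_id)
  have io: "ins ?H = outs ?K" by (simp add: coupling_graph_def id_graph_def bend_def)
  have "good (cls (bend G))" using Suc.hyps(1)[OF _ B] p by (simp add: bend_def)
  then have "good (cls (glue ?H ?K))"
    by (intro good_glue H K io good_juxtapose ribbon_graph_coupling ribbon_graph_id good_coupling good_id B)
  then show ?case using good_iso[OF Suc.prems ribbon_graph_glue[OF H K io] bend_iso[OF Suc.prems p]] by simp
qed

text \<open>
  Incoming endpoints are removed by bending, vertices by splitting off stars, circles by
  \<open>circle_iso\<close>, and what remains is a matching.
\<close>
theorem all_good: "good A"
  using good_graph[OF ribbon_graph_rep[of A]] by (simp add: cls_rep)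

end

section \<open>From actions to cyclic algebras\<close>

lemma tensor_power_0:
  fixes t :: "('k::field, 'v::ab_group_add) tensor"
  assumes "t \<in> tensor_power scale 0"
  shows "t = tensor_scale (scalar_part t) (pure_tensor scale [])"
  using assms
proof (induction rule: tensor_power_induct)
  case zero
  show ?case by (simp add: scalar_part_def zero_fun_apply)
next
  case (step c xs t)
  let ?e = "pure_tensor scale []"
  have "scalar_part (tensor_scale c ?e + t) = c + scalar_part t"
    using scalar_part_unit[of c scale] by (simp add: scalar_part_def plus_fun_apply)
  then have "tensor_scale (scalar_part (tensor_scale c ?e + t)) ?e = tensor_scale c ?e + tensor_scale (scalar_part t) ?e"
    by (simp only: tensor.scale_left_distrib)
  then show ?case using step by (simp del: tensor.scale_left_distrib)
qed

text \<open>
  The universal property applied to the identity map recovers \<open>x\<close> from its tensor.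
\<close>
lemma pure_tensor_eq_0:
  fixes scale :: "'k::field \<Rightarrow> 'v::ab_group_add \<Rightarrow> 'v"
  assumes "vector_space scale" "pure_tensor scale [x] = 0"
  shows "x = 0"
proof -
  have "\<exists>!f. f \<in> linear_maps tensor_scale (tensor_power scale 1) scale UNIV \<and>
      (\<forall>xs. length xs = 1 \<longrightarrow> f (pure_tensor scale xs) = hd xs)"
    by (rule tensor_power_universal[OF assms(1)]) auto
  then obtain f where f: "f \<in> linear_maps tensor_scale (tensor_power scale 1) scale UNIV"
    "\<forall>xs. length xs = 1 \<longrightarrow> f (pure_tensor scale xs) = hd xs" by blast
  have "x = f (pure_tensor scale [x])" using f(2) by simp
  then show ?thesis using linear_maps_zero[OF f(1) tensor_power_zero] assms(2) by simp
qed

locale ribbon_action =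
  fixes scale :: "'k::field \<Rightarrow> 'v::ab_group_add \<Rightarrow> 'v"
    and Z :: "nat \<Rightarrow> nat \<Rightarrow> (ribbon \<Rightarrow>\<^sub>0 'k) \<Rightarrow> ('k, 'v) tensor \<Rightarrow> ('k, 'v) tensor"
  assumes R_action: "R_action scale Z"
begin

lemma Z_linear: "Z p q \<in> linear_maps prop_scale (prop_R p q) hom_scale (tensor_hom scale p q)"
  and Z_comp: "g \<in> prop_R q r \<Longrightarrow> f \<in> prop_R p q \<Longrightarrow> Z p r (prop_comp g f) = Z q r g \<circ> Z p q f"
  and Z_tensor: "g \<in> prop_R p q \<Longrightarrow> f \<in> prop_R p' q' \<Longrightarrow> t \<in> tensor_power scale p \<Longrightarrow> s \<in> tensor_power scale p' \<Longrightarrow>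
      Z (p + p') (q + q') (prop_tensor g f) (tensor_mult scale t s) = tensor_mult scale (Z p q g t) (Z p' q' f s)"
  and Z_id: "t \<in> tensor_power scale p \<Longrightarrow> Z p p (basis_elt (id_graph p)) t = t"
  and Z_crossing: "Z 2 2 (basis_elt crossing_graph) (pure_tensor scale [x, y]) = pure_tensor scale [y, x]"
  using R_action unfolding R_action_def by blast+

definition act :: "'h rgraph \<Rightarrow> ('k, 'v) tensor \<Rightarrow> ('k, 'v) tensor" where
  "act G = Z (ins G) (outs G) (Poly_Mapping.single (cls G) 1)"

lemma single_cls_in: "ribbon_graph G \<Longrightarrow> Poly_Mapping.single (cls G) c \<in> prop_R (ins G) (outs G)"
  by (intro prop_R_singleI ribbon_ins_cls ribbon_outs_cls)

lemma act_hom: "ribbon_graph G \<Longrightarrow> act G \<in> tensor_hom scale (ins G) (outs G)"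
  unfolding act_def by (rule linear_mapsD(1)[OF Z_linear single_cls_in])

lemma act_iso:
  assumes "ribbon_graph G" "ribbon_graph H" "rgraph_iso G H"
  shows "act G = act H"
  using cls_eqI[OF assms] assms(3) unfolding act_def rgraph_iso_def by simp

lemma act_glue:
  assumes "ribbon_graph G" "ribbon_graph F" "ins G = outs F"
  shows "act (glue G F) = act G \<circ> act F"
  using Z_comp[OF single_cls_in[OF assms(1), of 1, unfolded assms(3)] single_cls_in[OF assms(2), of 1]]
  by (simp add: bilinear_ext_single cls_glue[OF assms] act_def assms(3))

lemma act_juxtapose:
  assumes "ribbon_graph G" "ribbon_graph F" "t \<in> tensor_power scale (ins G)" "s \<in> tensor_power scale (ins F)"
  shows "act (juxtapose G F) (tensor_mult scale t s) = tensor_mult scale (act G t) (act F s)"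
  using Z_tensor[OF single_cls_in[OF assms(1), of 1] single_cls_in[OF assms(2), of 1] assms(3,4)]
  by (simp add: bilinear_ext_single cls_juxtapose[OF assms(1,2)] act_def)

lemma act_juxtapose_pure:
  assumes "ribbon_graph G" "ribbon_graph F" "length xs = ins G" "length ys = ins F"
  shows "act (juxtapose G F) (pure_tensor scale (xs @ ys)) =
    tensor_mult scale (act G (pure_tensor scale xs)) (act F (pure_tensor scale ys))"
  using act_juxtapose[OF assms(1,2)] assms(3,4) by (simp add: pure_in_tensor_power flip: tensor_mult_pure)

lemma act_basis_elt: "ribbon_graph G \<Longrightarrow> Z (ins G) (outs G) (basis_elt G) = act G"
  by (simp add: act_def basis_elt_def cls_nat)

lemma act_id: "t \<in> tensor_power scale p \<Longrightarrow> act (id_graph p) t = t"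
  using act_basis_elt[OF ribbon_graph_id[of p]] Z_id[of t p] by simp

lemma act_crossing: "act crossing_graph (pure_tensor scale [x, y]) = pure_tensor scale [y, x]"
  using act_basis_elt[OF ribbon_graph_crossing] Z_crossing by (simp add: crossing_graph_def)

lemma induced_form_eq: "induced_form Z = scalar_part \<circ> act coupling_graph"
  using act_basis_elt[OF ribbon_graph_coupling] by (simp add: induced_form_def coupling_graph_def)

lemma induced_cyclic_eq: "r \<ge> 1 \<Longrightarrow> induced_cyclic Z r = scalar_part \<circ> act (star_graph r)"
  using act_basis_elt[OF ribbon_graph_star[of r]] by (simp add: induced_cyclic_def star_graph_def)

definition form :: "'v \<Rightarrow> 'v \<Rightarrow> 'k" where
  "form x y = induced_form Z (pure_tensor scale [x, y])"

lemma act_coupling: "act coupling_graph (pure_tensor scale [x, y]) = tensor_scale (form x y) (pure_tensor scale [])"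
proof -
  have "act coupling_graph (pure_tensor scale [x, y]) \<in> tensor_power scale 0"
    using tensor_homD(2)[OF act_hom[OF ribbon_graph_coupling]] by (simp add: coupling_graph_def)
  then show ?thesis using tensor_power_0 by (simp add: form_def induced_form_eq)
qed

lemma act_star:
  assumes "r \<ge> 1"
  shows "act (star_graph r) t = tensor_scale (induced_cyclic Z r t) (pure_tensor scale [])"
proof -
  have "act (star_graph r) t \<in> tensor_power scale 0"
    using tensor_homD(2)[OF act_hom[OF ribbon_graph_star[of r]]] by (simp add: star_graph_def)
  then show ?thesis using tensor_power_0 assms by (simp add: induced_cyclic_eq)
qed

lemma act_coupling_id:
  assumes "length zs = q"
  shows "act (juxtapose coupling_graph (id_graph q)) (pure_tensor scale (x # y # zs)) =
    tensor_scale (form x y) (pure_tensor scale zs)"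
  using act_juxtapose_pure[OF ribbon_graph_coupling ribbon_graph_id, of "[x, y]" zs q] assms
  by (simp add: coupling_graph_def[THEN arg_cong[where f = ins]] act_coupling act_id pure_in_tensor_power
      tensor_mult_left tensor_mult_pure)

text \<open>
  The coupling composed with the crossing is the coupling.
\<close>
lemma form_sym: "form x y = form y x"
proof -
  let ?H = "juxtapose coupling_graph (id_graph 0)"
  have H: "ribbon_graph ?H" by (intro ribbon_graph_juxtapose ribbon_graph_coupling ribbon_graph_id)
  have io: "ins ?H = outs crossing_graph" by (simp add: coupling_graph_def crossing_graph_def)
  have "act coupling_graph = act ?H \<circ> act crossing_graph"
    using act_iso[OF ribbon_graph_coupling ribbon_graph_glue[OF H ribbon_graph_crossing io] coupling_crossing_iso]
      act_glue[OF H ribbon_graph_crossing io] by simp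
  then have "act coupling_graph (pure_tensor scale [x, y]) = act ?H (pure_tensor scale [y, x])"
    by (simp only: comp_apply act_crossing)
  then have "tensor_scale (form x y) (pure_tensor scale []) = tensor_scale (form y x) (pure_tensor scale [])"
    unfolding act_coupling using act_coupling_id[of "[]" 0 y x] by (simp only: list.size)
  then show ?thesis using scalar_part_unit by metis
qed

text \<open>
  The contraction \<open>b x \<otimes> id\<close> on the second tensor power, expressed through the action.
\<close>
definition contract :: "'v \<Rightarrow> ('k, 'v) tensor \<Rightarrow> ('k, 'v) tensor" where
  "contract x t = act (juxtapose coupling_graph (id_graph 1)) (tensor_mult scale (pure_tensor scale [x]) t)"

lemma contract_pure: "contract x (pure_tensor scale [u, v]) = tensor_scale (form x u) (pure_tensor scale [v])"
  using act_coupling_id[of "[v]" 1 x u] by (simp add: contract_def tensor_mult_pure)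

lemma contract_linear:
  assumes "t \<in> tensor_power scale 2" "s \<in> tensor_power scale 2"
  shows "contract x (t + s) = contract x t + contract x s" "contract x (tensor_scale c t) = tensor_scale c (contract x t)"
    "contract x 0 = 0"
proof -
  let ?H = "juxtapose coupling_graph (id_graph 1)"
  have H: "ribbon_graph ?H" by (intro ribbon_graph_juxtapose ribbon_graph_coupling ribbon_graph_id)
  have i3: "(1::nat) + 2 = 3" by simp
  have i: "ins ?H = 3" by (simp add: coupling_graph_def)
  note lin = act_hom[OF H, unfolded tensor_hom_def i]
  have x: "pure_tensor scale [x] \<in> tensor_power scale 1" by (rule pure_in_tensor_power) simp
  have in3: "tensor_mult scale (pure_tensor scale [x]) t' \<in> tensor_power scale 3" if "t' \<in> tensor_power scale 2" for t'
    using tensor_mult_in[OF x that] unfolding i3 .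
  show "contract x (t + s) = contract x t + contract x s"
    unfolding contract_def tensor_mult_right(1)[OF x assms] by (rule linear_mapsD(2)[OF lin in3[OF assms(1)] in3[OF assms(2)]])
  show "contract x (tensor_scale c t) = tensor_scale c (contract x t)"
    unfolding contract_def tensor_mult_right(2)[OF x assms] by (rule linear_mapsD(3)[OF lin in3[OF assms(1)]])
  show "contract x 0 = 0"
    unfolding contract_def tensor_mult_zero_right[OF x] by (rule linear_maps_zero[OF lin tensor_power_zero])
qed

definition copairing :: "('k, 'v) tensor" where
  "copairing = act copairing_graph (pure_tensor scale [])"

lemma copairing_in: "copairing \<in> tensor_power scale 2"
  using tensor_homD(2)[OF act_hom[OF ribbon_graph_copairing]] by (simp add: copairing_def copairing_graph_def)

text \<open>
  Straightening an S-shaped edge: the action of the copairing inverts the form.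
\<close>
lemma snake: "contract x copairing = pure_tensor scale [x]"
proof -
  let ?H = "juxtapose coupling_graph (id_graph 1)" and ?K = "juxtapose (id_graph 1) copairing_graph"
  have H: "ribbon_graph ?H" by (intro ribbon_graph_juxtapose ribbon_graph_coupling ribbon_graph_id)
  have K: "ribbon_graph ?K" by (intro ribbon_graph_juxtapose ribbon_graph_copairing ribbon_graph_id)
  have io: "ins ?H = outs ?K" by (simp add: coupling_graph_def copairing_graph_def)
  have iso: "rgraph_iso (id_graph 1) (glue ?H ?K)"
    using bend_iso[OF ribbon_graph_id[of 1], of 0] unfolding bend_id by simp
  have "act (id_graph 1) = act ?H \<circ> act ?K"
    using act_iso[OF ribbon_graph_id ribbon_graph_glue[OF H K io] iso] act_glue[OF H K io] by simp
  moreover have x: "pure_tensor scale [x] \<in> tensor_power scale 1" by (rule pure_in_tensor_power) simp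
  moreover have "act ?K (pure_tensor scale [x]) = tensor_mult scale (pure_tensor scale [x]) copairing"
    using act_juxtapose_pure[OF ribbon_graph_id ribbon_graph_copairing, of "[x]" 1 "[]"] act_id[OF x]
    by (simp add: copairing_def copairing_graph_def[THEN arg_cong[where f = ins]])
  ultimately show ?thesis unfolding contract_def using act_id[OF x] by simp
qed

text \<open>
  If \<open>x\<close> is in the radical, contraction with \<open>x\<close> vanishes, whereas by the snake identity it sends the
  copairing to \<open>x\<close>.
\<close>
lemma form_nondegenerate:
  assumes "vector_space scale" "\<And>y. form x y = 0"
  shows "x = 0"
proof -
  have "contract x t = 0" if "t \<in> tensor_power scale 2" for t
    using that
  proof (induction rule: tensor_power_induct)
    case zero
    show ?case by (rule contract_linear(3)[OF tensor_power_zero tensor_power_zero])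
  next
    case (step c xs t)
    obtain u v where xs: "xs = [u, v]" using step(1) by (auto simp: numeral_2_eq_2 length_Suc_conv)
    have "pure_tensor scale xs \<in> tensor_power scale 2" using step(1) by (rule pure_in_tensor_power)
    then show ?case
      using step contract_linear(1)[OF tensor_power_scale step(2)] contract_linear(2) contract_pure[of x u v] assms(2)
      by (simp add: xs)
  qed
  then have "pure_tensor scale [x] = 0" using snake[of x] copairing_in by simp
  then show ?thesis by (rule pure_tensor_eq_0[OF assms(1)])
qed

lemma act_adjacent:
  assumes "Suc i < n" "length ys = n"
  shows "act (perm_graph (transpose i (Suc i)) n) (pure_tensor scale ys) =
    pure_tensor scale (map (\<lambda>j. ys ! transpose i (Suc i) j) [0..<n])"
proof -
  let ?s = "transpose i (Suc i)" and ?J = "juxtapose (id_graph i) crossing_graph"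
  let ?K = "juxtapose ?J (id_graph (n - i - 2))"
  have s: "?s permutes {..<n}" using assms(1) by (intro permutes_swap_id) auto
  have J: "ribbon_graph ?J" and K: "ribbon_graph ?K"
    by (intro ribbon_graph_juxtapose ribbon_graph_id ribbon_graph_crossing)+
  define us x y vs where "us = take i ys" and "x = ys ! i" and "y = ys ! Suc i" and "vs = drop (Suc (Suc i)) ys"
  have ys: "ys = us @ [x, y] @ vs"
    using assms unfolding us_def x_def y_def vs_def by (simp add: Cons_nth_drop_Suc)
  have len: "length us = i" "length vs = n - i - 2" using assms by (simp_all add: us_def vs_def)
  have "act (perm_graph ?s n) (pure_tensor scale ys) = act ?K (pure_tensor scale ((us @ [x, y]) @ vs))"
    using act_iso[OF K ribbon_graph_perm[OF s] adjacent_transposition_iso[OF assms(1)]] ys by simp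
  also have "\<dots> = tensor_mult scale (act ?J (pure_tensor scale (us @ [x, y]))) (act (id_graph (n - i - 2)) (pure_tensor scale vs))"
    by (rule act_juxtapose_pure[OF J ribbon_graph_id]) (simp_all add: len crossing_graph_def)
  also have "act ?J (pure_tensor scale (us @ [x, y])) = tensor_mult scale (act (id_graph i) (pure_tensor scale us)) (act crossing_graph (pure_tensor scale [x, y]))"
    by (rule act_juxtapose_pure[OF ribbon_graph_id ribbon_graph_crossing]) (simp_all add: len crossing_graph_def)
  finally have "act (perm_graph ?s n) (pure_tensor scale ys) = pure_tensor scale (us @ [y, x] @ vs)"
    by (simp add: act_id pure_in_tensor_power len act_crossing tensor_mult_pure)
  also have "us @ [y, x] @ vs = map (\<lambda>j. ys ! ?s j) [0..<n]"
  proof (rule nth_equalityI)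
    show "length (us @ [y, x] @ vs) = length (map (\<lambda>j. ys ! ?s j) [0..<n])" using assms(1) len by simp
    fix j assume "j < length (us @ [y, x] @ vs)"
    then have j: "j < n" using assms(1) len by simp
    consider "j < i" | "j = i" | "j = Suc i" | "j \<ge> i + 2" by linarith
    then have "(us @ [y, x] @ vs) ! j = ys ! ?s j"
      unfolding ys using len
      by cases (auto simp: nth_append Transposition.transpose_def nth_Cons split: nat.splits)
    then show "(us @ [y, x] @ vs) ! j = map (\<lambda>j. ys ! ?s j) [0..<n] ! j" using j by simp
  qed
  finally show ?thesis .
qed

text \<open>
  The graph joining the incoming endpoint \<open>i\<close> to the outgoing endpoint \<open>\<sigma> i\<close> moves the \<open>i\<close>-th factor
  to position \<open>\<sigma> i\<close>, whence the inverse.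
\<close>
lemma act_perm:
  assumes "\<sigma> permutes {..<n}" "length xs = n"
  shows "act (perm_graph \<sigma> n) (pure_tensor scale xs) = pure_tensor scale (map (\<lambda>j. xs ! inv \<sigma> j) [0..<n])"
  using assms(1)
proof (induction rule: adjacent_induct)
  case id
  have "map (\<lambda>j. xs ! j) [0..<n] = xs" using map_nth[of xs] assms(2) by simp
  then show ?case
    unfolding perm_graph_def permute_outs_id using assms(2) by (simp add: act_id pure_in_tensor_power)
next
  case (adjacent i \<tau>)
  let ?s = "transpose i (Suc i)" and ?ys = "map (\<lambda>j. xs ! inv \<tau> j) [0..<n]"
  have s: "?s permutes {..<n}" using adjacent(1) by (intro permutes_swap_id) auto
  note P = ribbon_graph_perm[OF s] ribbon_graph_perm[OF adjacent(2)]
  have iso: "rgraph_iso (perm_graph (?s \<circ> \<tau>) n) (glue (perm_graph ?s n) (perm_graph \<tau> n))"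
    using glue_perm[OF P(2), of ?s] s by (simp add: perm_graph_def permute_outs_comp)
  have "act (perm_graph (?s \<circ> \<tau>) n) = act (perm_graph ?s n) \<circ> act (perm_graph \<tau> n)"
    using act_iso[OF ribbon_graph_perm[OF permutes_compose[OF adjacent(2) s]] ribbon_graph_glue[OF P] iso]
      act_glue[OF P] by simp
  then have "act (perm_graph (?s \<circ> \<tau>) n) (pure_tensor scale xs) = pure_tensor scale (map (\<lambda>j. ?ys ! ?s j) [0..<n])"
    using adjacent(3) act_adjacent[OF adjacent(1), of ?ys] by simp
  also have "map (\<lambda>j. ?ys ! ?s j) [0..<n] = map (\<lambda>j. xs ! inv (?s \<circ> \<tau>) j) [0..<n]"
  proof (rule map_cong[OF refl])
    fix j assume "j \<in> set [0..<n]"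
    then have "?s j < n" using permutes_in_image[OF s, of j] by simp
    moreover have "inv (?s \<circ> \<tau>) = inv \<tau> \<circ> ?s"
      using permutes_bij[OF s] permutes_bij[OF adjacent(2)] by (simp add: o_inv_distrib)
    ultimately show "?ys ! ?s j = xs ! inv (?s \<circ> \<tau>) j" by simp
  qed
  finally show ?case .
qed

lemma induced_cyclic_rotate:
  assumes "r \<ge> 1" "length xs = r - 1"
  shows "induced_cyclic Z r (pure_tensor scale (xs @ [x])) = induced_cyclic Z r (pure_tensor scale (x # xs))"
proof -
  let ?\<sigma> = "nxt (star_graph r)"
  have \<sigma>: "?\<sigma> permutes {..<r}" using ribbon_graphD(2)[OF ribbon_graph_star[of r]] by (simp add: star_graph_def)
  have S: "ribbon_graph (star_graph r)" and P: "ribbon_graph (perm_graph ?\<sigma> r)" and io: "ins (star_graph r) = outs (perm_graph ?\<sigma> r)"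
    using ribbon_graph_star ribbon_graph_perm[OF \<sigma>] by (simp_all add: star_graph_def)
  have "act (star_graph r) = act (star_graph r) \<circ> act (perm_graph ?\<sigma> r)"
    using act_iso[OF S ribbon_graph_glue[OF S P io] star_rotation_iso] act_glue[OF S P io] by simp
  then have "act (star_graph r) (pure_tensor scale (xs @ [x])) =
      act (star_graph r) (pure_tensor scale (map (\<lambda>j. (xs @ [x]) ! inv ?\<sigma> j) [0..<r]))"
    using act_perm[OF \<sigma>, of "xs @ [x]"] assms by (metis One_nat_def Suc_pred comp_apply length_append_singleton less_eq_Suc_le)
  also have "map (\<lambda>j. (xs @ [x]) ! inv ?\<sigma> j) [0..<r] = x # xs"
  proof (rule nth_equalityI)
    show "length (map (\<lambda>j. (xs @ [x]) ! inv ?\<sigma> j) [0..<r]) = length (x # xs)" using assms by simp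
    fix j assume "j < length (map (\<lambda>j. (xs @ [x]) ! inv ?\<sigma> j) [0..<r])"
    then have j: "j < r" by simp
    have inv: "inv ?\<sigma> (Suc i mod r) = i" if "i < r" for i
      using inv_f_f[OF permutes_inj[OF \<sigma>], of i] that by (simp add: star_graph_def)
    show "map (\<lambda>j. (xs @ [x]) ! inv ?\<sigma> j) [0..<r] ! j = (x # xs) ! j"
    proof (cases j)
      case 0
      then have "inv ?\<sigma> j = r - 1" using inv[of "r - 1"] assms(1) by simp
      then show ?thesis using 0 j assms by (simp add: nth_append)
    next
      case (Suc i)
      then have "inv ?\<sigma> j = i" "i < length xs" using inv[of i] j assms by simp_all
      then show ?thesis using Suc j by (simp add: nth_append)
    qed
  qed
  finally show ?thesis using assms(1) by (simp add: induced_cyclic_eq)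
qed

theorem cyclic_algebra_induced:
  assumes "vector_space scale"
  shows "cyclic_algebra scale (induced_form Z) (induced_cyclic Z)"
  unfolding cyclic_algebra_def
proof (intro conjI allI impI)
  show "induced_form Z \<in> linear_maps tensor_scale (tensor_power scale 2) (*) UNIV"
    using scalar_part_hom[OF act_hom[OF ribbon_graph_coupling]] by (simp add: induced_form_eq coupling_graph_def)
  show "induced_form Z (pure_tensor scale [x, y]) = induced_form Z (pure_tensor scale [y, x])" for x y
    using form_sym[of x y] by (simp add: form_def)
  show "x = 0" if "\<forall>y. induced_form Z (pure_tensor scale [x, y]) = 0" for x
    using form_nondegenerate[OF assms, of x] that by (simp add: form_def)
  show "induced_cyclic Z r \<in> linear_maps tensor_scale (tensor_power scale r) (*) UNIV" if "1 \<le> r" for r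
    using scalar_part_hom[OF act_hom[OF ribbon_graph_star[of r]]] that by (simp add: induced_cyclic_eq star_graph_def)
  show "induced_cyclic Z r (pure_tensor scale (xs @ [x])) = induced_cyclic Z r (pure_tensor scale (x # xs))"
    if "1 \<le> r" "length xs = r - 1" for r xs x
    using that by (rule induced_cyclic_rotate)
  show "induced_cyclic Z 0 = 0" by (simp add: induced_cyclic_def)
qed

end

section \<open>Uniqueness\<close>

lemma (in cyclic_structure) dual_expansion': "u = (\<Sum>w\<in>Basis. scale (b w u) (dual w))"
proof -
  have "b (u - (\<Sum>w\<in>Basis. scale (b w u) (dual w))) y = 0" for y
  proof -
    have "b (\<Sum>w\<in>Basis. scale (b w u) (dual w)) y = (\<Sum>w\<in>Basis. b y (dual w) * b w u)"
      unfolding b_sum b_scale by (intro sum.cong refl) (simp add: b_sym[of y] mult.commute)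
    also have "\<dots> = b u y" using b_contract[of y u] b_sym[of y u] by simp
    finally show ?thesis
      using b_add[of "u - (\<Sum>w\<in>Basis. scale (b w u) (dual w))" "\<Sum>w\<in>Basis. scale (b w u) (dual w)" y] by simp
  qed
  then have "u - (\<Sum>w\<in>Basis. scale (b w u) (dual w)) = 0" by (rule b_nondegenerate)
  then show ?thesis by simp
qed

lemma (in vector_space) pure_tensor_sum_left:
  "pure_tensor scale [\<Sum>w\<in>I. scale (c w) (f w), v] = (\<Sum>w\<in>I. tensor_scale (c w) (pure_tensor scale [f w, v]))"
proof (induction I rule: infinite_finite_induct)
  case (insert w I)
  then show ?case
    using pure_tensor_add[of scale "[]" "scale (c w) (f w)" "\<Sum>w\<in>I. scale (c w) (f w)" "[v]"]
      pure_tensor_scale[of scale "[]" "c w" "f w" "[v]"] by simp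
qed (use pure_tensor_scale[of scale "[]" 0 0 "[v]"] in simp_all)

text \<open>
  Expanding the first factor in the dual basis gives \<open>t = \<Sum>\<^sub>w d w \<otimes> (b w \<otimes> id) t\<close> for all tensors \<open>t\<close> of
  degree two. For the copairing the second factor is \<open>w\<close> by the snake identity, so the copairing
  depends on the form alone.
\<close>
lemma copairing_unique:
  assumes "ribbon_action scale Z" and "cyclic_structure scale Basis (ribbon_action.form scale Z) M"
  shows "ribbon_action.copairing scale Z =
    (\<Sum>w\<in>Basis. pure_tensor scale [cyclic_structure.dual Basis (ribbon_action.form scale Z) w, w])"
proof -
  interpret Z: ribbon_action scale Z by (rule assms(1))
  interpret cyclic_structure scale Basis Z.form M by (rule assms(2))
  have "t = (\<Sum>w\<in>Basis. tensor_mult scale (pure_tensor scale [dual w]) (Z.contract w t))"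
    if "t \<in> tensor_power scale 2" for t
    using that
  proof (induction rule: tensor_power_induct)
    case zero
    have "tensor_mult scale (pure_tensor scale [dual w]) 0 = 0" for w
      by (rule tensor_mult_zero_right[OF pure_in_tensor_power[OF refl]])
    then show ?case by (simp add: Z.contract_linear(3)[OF tensor_power_zero tensor_power_zero])
  next
    case (step c xs t)
    obtain u v where xs: "xs = [u, v]" using step(1) by (auto simp: numeral_2_eq_2 length_Suc_conv)
    have p: "pure_tensor scale xs \<in> tensor_power scale 2" using step(1) by (rule pure_in_tensor_power)
    have d: "pure_tensor scale [dual w] \<in> tensor_power scale 1" for w by (rule pure_in_tensor_power) simp
    have v: "pure_tensor scale [v] \<in> tensor_power scale 1" by (rule pure_in_tensor_power) simp
    have in1: "Z.contract w t' \<in> tensor_power scale 1" for w t'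
    proof -
      have H: "ribbon_graph (juxtapose coupling_graph (id_graph 1))"
        by (intro ribbon_graph_juxtapose ribbon_graph_coupling ribbon_graph_id)
      show ?thesis unfolding Z.contract_def
        using tensor_homD(2)[OF Z.act_hom[OF H]] by (simp add: coupling_graph_def)
    qed
    have "pure_tensor scale xs = (\<Sum>w\<in>Basis. tensor_scale (Z.form w u) (pure_tensor scale [dual w, v]))"
      unfolding xs by (subst dual_expansion'[of u]) (rule pure_tensor_sum_left)
    also have "\<dots> = (\<Sum>w\<in>Basis. tensor_mult scale (pure_tensor scale [dual w]) (Z.contract w (pure_tensor scale xs)))"
      unfolding xs Z.contract_pure tensor_mult_right(2)[OF d v v] by (simp add: tensor_mult_pure)
    finally have e: "pure_tensor scale xs =
      (\<Sum>w\<in>Basis. tensor_mult scale (pure_tensor scale [dual w]) (Z.contract w (pure_tensor scale xs)))" .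
    have "tensor_mult scale (pure_tensor scale [dual w]) (Z.contract w (tensor_scale c (pure_tensor scale xs) + t)) =
        tensor_scale c (tensor_mult scale (pure_tensor scale [dual w]) (Z.contract w (pure_tensor scale xs))) +
        tensor_mult scale (pure_tensor scale [dual w]) (Z.contract w t)" for w
      by (simp only: Z.contract_linear(1)[OF tensor_power_scale[OF p] step(2)] Z.contract_linear(2)[OF p p]
          tensor_mult_right(1)[OF d tensor_power_scale[OF in1] in1] tensor_mult_right(2)[OF d in1 in1])
    then show ?case
      using e step(3) by (simp add: sum.distrib flip: tensor.scale_sum_right)
  qed
  from this[OF Z.copairing_in] show ?thesis
    by (simp add: Z.snake tensor_mult_pure)
qed

text \<open>
  The graphs on which two actions agree are closed under composition and juxtaposition. They contain
  the coupling and the stars by assumption, the identities and the crossing by definition of an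
  action, and the copairing by \<open>copairing_unique\<close>; these generate all graphs.
\<close>
theorem action_unique:
  fixes scale :: "'k::field \<Rightarrow> 'v::ab_group_add \<Rightarrow> 'v"
  assumes fd: "finite_dimensional_vector_space scale Basis"
    and Z: "R_action scale Z" and Z': "R_action scale Z'"
    and form: "induced_form Z = induced_form Z'" and cyc: "induced_cyclic Z = induced_cyclic Z'"
  shows "Z = Z'"
proof -
  interpret fd: finite_dimensional_vector_space scale Basis by (rule fd)
  interpret Z: ribbon_action scale Z by unfold_locales (rule Z)
  interpret Z': ribbon_action scale Z' by unfold_locales (rule Z')
  define good where "good A \<longleftrightarrow> Z.act (rep_ribbon A) = Z'.act (rep_ribbon A)" for A
  have good_iff: "good (cls G) \<longleftrightarrow> Z.act G = Z'.act G" if "ribbon_graph G" for G :: "'h rgraph"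
    unfolding good_def
    using Z.act_iso[OF ribbon_graph_rep that rep_cls_iso[OF that]] Z'.act_iso[OF ribbon_graph_rep that rep_cls_iso[OF that]]
    by simp
  have map_eqI: "Z.act G = Z'.act G"
    if G: "ribbon_graph G" and "\<And>xs. length xs = ins G \<Longrightarrow> Z.act G (pure_tensor scale xs) = Z'.act G (pure_tensor scale xs)"
    for G :: "'h rgraph"
    using Z.act_hom[OF G] Z'.act_hom[OF G] that(2) unfolding tensor_hom_def by (rule tensor_map_eqI)
  have forms: "Z.form = Z'.form" unfolding Z.form_def Z'.form_def form ..
  have cs: "cyclic_structure scale Basis Z.form (\<lambda>xs. induced_cyclic Z (length xs) (pure_tensor scale xs))"
    using cyclic_structure_of_algebra[OF fd Z.cyclic_algebra_induced[OF fd.vector_space_axioms]]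
    by (simp add: Z.form_def[abs_def])
  have copair: "Z.copairing = Z'.copairing"
    using copairing_unique[OF Z.ribbon_action_axioms cs] copairing_unique[OF Z'.ribbon_action_axioms, folded forms, OF cs]
    by simp
  interpret generated good
  proof
    show "good (ribbon_comp A B)" if io: "ribbon_ins A = ribbon_outs B" and "good A" "good B" for A B
    proof -
      note g = ribbon_graph_rep[of A] ribbon_graph_rep[of B] io[unfolded ribbon_ins_def ribbon_outs_def]
      have "ribbon_comp A B = cls (glue (rep_ribbon A) (rep_ribbon B))" using cls_glue[OF g] by (simp add: cls_rep)
      then show ?thesis
        using good_iff[OF ribbon_graph_glue[OF g]] Z.act_glue[OF g] Z'.act_glue[OF g] that(2,3) by (simp add: good_def)
    qed
    show "good (ribbon_tensor A B)" if "good A" "good B" for A B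
    proof -
      note g = ribbon_graph_rep[of A] ribbon_graph_rep[of B]
      have "Z.act (juxtapose (rep_ribbon A) (rep_ribbon B)) = Z'.act (juxtapose (rep_ribbon A) (rep_ribbon B))"
      proof (rule map_eqI[OF ribbon_graph_juxtapose[OF g]])
        fix xs :: "'v list" assume xs: "length xs = ins (juxtapose (rep_ribbon A) (rep_ribbon B))"
        let ?ys = "take (ins (rep_ribbon A)) xs" and ?zs = "drop (ins (rep_ribbon A)) xs"
        have "length ?ys = ins (rep_ribbon A)" "length ?zs = ins (rep_ribbon B)" using xs by simp_all
        from Z.act_juxtapose_pure[OF g this] Z'.act_juxtapose_pure[OF g this] that
        show "Z.act (juxtapose (rep_ribbon A) (rep_ribbon B)) (pure_tensor scale xs) =
            Z'.act (juxtapose (rep_ribbon A) (rep_ribbon B)) (pure_tensor scale xs)"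
          by (simp add: good_def)
      qed
      moreover have "ribbon_tensor A B = cls (juxtapose (rep_ribbon A) (rep_ribbon B))"
        using cls_juxtapose[OF g] by (simp add: cls_rep)
      ultimately show ?thesis using good_iff[OF ribbon_graph_juxtapose[OF g]] by simp
    qed
    show "good (cls (id_graph p))" for p
      unfolding good_iff[OF ribbon_graph_id]
      by (rule map_eqI[OF ribbon_graph_id]) (simp add: Z.act_id Z'.act_id pure_in_tensor_power)
    show "good (cls crossing_graph)"
      unfolding good_iff[OF ribbon_graph_crossing]
    proof (rule map_eqI[OF ribbon_graph_crossing])
      fix xs :: "'v list" assume "length xs = ins crossing_graph"
      then obtain x y where "xs = [x, y]" by (auto simp: crossing_graph_def numeral_2_eq_2 length_Suc_conv)
      then show "Z.act crossing_graph (pure_tensor scale xs) = Z'.act crossing_graph (pure_tensor scale xs)"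
        by (simp add: Z.act_crossing Z'.act_crossing)
    qed
    show "good (cls coupling_graph)"
      unfolding good_iff[OF ribbon_graph_coupling]
    proof (rule map_eqI[OF ribbon_graph_coupling])
      fix xs :: "'v list" assume "length xs = ins coupling_graph"
      then obtain x y where "xs = [x, y]" by (auto simp: coupling_graph_def numeral_2_eq_2 length_Suc_conv)
      then show "Z.act coupling_graph (pure_tensor scale xs) = Z'.act coupling_graph (pure_tensor scale xs)"
        by (simp add: Z.act_coupling Z'.act_coupling forms)
    qed
    show "good (cls copairing_graph)"
      unfolding good_iff[OF ribbon_graph_copairing]
    proof (rule map_eqI[OF ribbon_graph_copairing])
      fix xs :: "'v list" assume "length xs = ins copairing_graph"
      then have "xs = []" by (simp add: copairing_graph_def)
      then show "Z.act copairing_graph (pure_tensor scale xs) = Z'.act copairing_graph (pure_tensor scale xs)"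
        using copair by (simp add: Z.copairing_def Z'.copairing_def)
    qed
    show "good (cls (star_graph r))" if "r \<ge> 1" for r
      unfolding good_iff[OF ribbon_graph_star]
      by (rule map_eqI[OF ribbon_graph_star]) (simp add: Z.act_star[OF that] Z'.act_star[OF that] cyc)
  qed
  have single: "Z p q (Poly_Mapping.single A 1) = Z' p q (Poly_Mapping.single A 1)"
    if "ribbon_ins A = p" "ribbon_outs A = q" for A p q
    using all_good[of A] that unfolding good_def Z.act_def Z'.act_def by (simp add: cls_rep ribbon_ins_def ribbon_outs_def)
  have "Z p q f = Z' p q f" for p q f
  proof (cases "f \<in> prop_R p q")
    case True
    have "Z p q (Poly_Mapping.single A 1) = Z' p q (Poly_Mapping.single A 1)" if "A \<in> Poly_Mapping.keys f" for A
      using single that True unfolding prop_R_def by blast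
    then show ?thesis
      using linear_maps_prop_sum[OF Z.Z_linear True] linear_maps_prop_sum[OF Z'.Z_linear True] by simp
  next
    case False
    then show ?thesis using linear_mapsD(4)[OF Z.Z_linear] linear_mapsD(4)[OF Z'.Z_linear] by metis
  qed
  then show "Z = Z'" by (intro ext) simp
qed

theorem theorem2p2:
  fixes scale :: "'k::field \<Rightarrow> 'v::ab_group_add \<Rightarrow> 'v" and Basis :: "'v set"
  assumes "finite_dimensional_vector_space scale Basis"
  shows "bij_betw (\<lambda>Z. (induced_form Z, induced_cyclic Z))
           {Z. R_action scale Z}
           {(b, T). cyclic_algebra scale b T}"
proof -
  interpret finite_dimensional_vector_space scale Basis by (rule assms)
  show ?thesis
    unfolding bij_betw_def
  proof
    show "inj_on (\<lambda>Z. (induced_form Z, induced_cyclic Z)) {Z. R_action scale Z}"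
      using action_unique[OF assms] by (intro inj_onI) simp
    show "(\<lambda>Z. (induced_form Z, induced_cyclic Z)) ` {Z. R_action scale Z} = {(b, T). cyclic_algebra scale b T}"
    proof (intro equalityI subsetI)
      fix x assume "x \<in> (\<lambda>Z. (induced_form Z, induced_cyclic Z)) ` {Z. R_action scale Z}"
      then obtain Z where "R_action scale Z" "x = (induced_form Z, induced_cyclic Z)" by blast
      then show "x \<in> {(b, T). cyclic_algebra scale b T}"
        using ribbon_action.cyclic_algebra_induced[OF ribbon_action.intro vector_space_axioms] by simp
    next
      fix x assume "x \<in> {(b, T). cyclic_algebra scale b T}"
      then obtain b T where "x = (b, T)" "cyclic_algebra scale b T" by blast
      then show "x \<in> (\<lambda>Z. (induced_form Z, induced_cyclic Z)) ` {Z. R_action scale Z}"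
        using cyclic_algebra_imp_action[OF assms] by force
    qed
  qed
qed

end
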